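(* Let $g=1+\sum_{|\alpha|\ge1}b_\alpha Z_\alpha$ be an admissible free holomorphic function such that $\sup_{\alpha\in\mathbb F_n^+}\frac{b_\alpha}{b_{\alpha g_i}}<\infty$ for any $i\in\{1,\ldots,n\}$, and let ${\bf W}=(W_1,\ldots,W_n)$ be the universal model of the noncommutative domain $\mathcal D_{g^{-1}}$. If $T=(T_1,\ldots,T_n)\in\mathcal D_{g^{-1}}(\mathcal H)$ is a pure $n$-tuple of operators, then the map $\Psi_T:F^\infty(g)\to B(\mathcal H)$ defined by $$\Psi_T(\varphi({\bf W})):=K_{g,T}^*(\varphi({\bf W})\otimes I_{\mathcal H})K_{g,T},\qquad\varphi({\bf W})\in F^\infty(g),$$ has the following properties: (i) $\Psi_T$ is a sequentially WOT-continuous (resp. SOT-continuous) map; (ii) $\Psi_T$ is a unital completely contractive homomorphism; (iii) $\Psi_T$ is a $w^*$-continuous linear map such that $\Psi_T\big(\sum_{|\alpha|\le m}d_\alpha W_\alpha\big)=\sum_{|\alpha|\le m}d_\alpha T_\alpha$ for any $m\in\mathbb N$, $d_\alpha\in\mathbb C$. If, in addition, ${\bf W}$ is radially pure with respect to $\mathcal D_{g^{-1}}(F^2(H_n))$ and $\varphi({\bf W})\in F^\infty(g)$ has the Fourier representation $\sum_{\alpha\in\mathbb F_n^+}c_\alpha W_\alpha$, then, for $r\in[0,1)$, $\varphi_r(T):=\sum_{k=0}^\infty\sum_{|\alpha|=k}r^{|\alpha|}c_\alpha T_\alpha$ converges in the operator norm and $$\Psi_T(\varphi({\bf W}))=\t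ext{SOT-}\lim_{r\to1}\varphi_r(T).$$
   Context: $\mathbb F_n^+$ is the unital free semigroup on generators $g_1,\ldots,g_n$ with identity $g_0$, and $|\alpha|$ is the length of $\alpha$. For $\alpha=g_{i_1}\cdots g_{i_k}$, $X_\alpha:=X_{i_1}\cdots X_{i_k}$, $X_{g_0}:=I$. $F^2(H_n)$ is the full Fock space with orthonormal basis $\{e_\alpha\}_{\alpha\in\mathbb F_n^+}$, $e_\alpha=e_{i_1}\otimes\cdots\otimes e_{i_k}$, $e_{g_0}=1$. A formal power series $\sum_\alpha c_\alpha Z_\alpha$ in noncommuting indeterminates is a free holomorphic function in a neighborhood of the origin if there is $\rho>0$ such that $\sum_{k}\sum_{|\alpha|=k}c_\alpha X_\alpha$ converges in norm for every Hilbert space $\mathcal H$ and every $X\in B(\mathcal H)^n$ with $\|\sum_iX_iX_i^*\|^{1/2}\le\rho$; equivalently $\limsup_k(\sum_{|\alpha|=k}|c_\alpha|^2)^{1/2k}<\infty$. $g$ is admissible if: (a) $b_{g_0}=1$, all $b_\alpha>0$, and $\sup_\alpha b_\alpha/b_{g_i\alpha}<\infty$ for each $i$; (b) $g$ is free holomorphic in a neighborhood of the origin; (c) $\sup_{k}\big\|\sum_{p=0}^k\sum_{|\alpha|=p}a_\alpha W_\alpha W_\alpha^*\big\|<\infty$, where $g^{-1}=1+\sum_{|\alpha|\ge1}a_\alpha Z_\alpha$ is the inverse power series ($a_{g_0}=1$) and $W_ie_\alpha=\sqrt{b_\alpha/b_{g_i\alpha}}\,e_{g_i\alpha}$ are the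 weighted left creation operators on $F^2(H_n)$. ${\bf W}=(W_1,\ldots,W_n)$ is the universal model. $\mathcal D_{g^{-1}}(\mathcal H)$ is the set of all $X\in B(\mathcal H)^n$ such that (i) $\Delta_{g^{-1}}(X,X^* ):=\sum_{p=0}^\infty\sum_{|\alpha|=p}a_\alpha X_\alpha X_\alpha^*$ converges in the weak operator topology and is $\ge0$; (ii) $\sum_{\alpha}b_\alpha X_\alpha\Delta_{g^{-1}}(X,X^* )X_\alpha^*\le I$ (WOT convergence). $X\in\mathcal D_{g^{-1}}(\mathcal H)$ is pure if equality holds in (ii). $X\in B(\mathcal H)^n$ is radially pure with respect to $\mathcal D_{g^{-1}}(\mathcal H)$ if there is $\delta\in(0,1)$ such that $rX\in\mathcal D_{g^{-1}}(\mathcal H)$ is pure for every $r\in(\delta,1)$. The noncommutative Berezin kernel of $T\in\mathcal D_{g^{-1}}(\mathcal H)$ is $K_{g,T}:\mathcal H\to F^2(H_n)\otimes\overline{\Delta_{g^{-1}}(T,T^* )\mathcal H}\subset F^2(H_n)\otimes\mathcal H$, $K_{g,T}h:=\sum_{\alpha}\sqrt{b_\alpha}\,e_\alpha\otimes\Delta_{g^{-1}}(T,T^* )^{1/2}T_\alpha^*h$. $F^\infty(g)$: let $\mathcal P=\mathrm{span}\{e_\alpha\}$. Consider formal series $\sum_{\beta}c_\beta W_\beta$ with $\sum_{\beta}|c_\beta|^2\frac{b_\gamma}{b_{\beta\gamma}}<\infty$ for each $\gamma$ and $\sup_{p\in\mathcal P,\|p\|\le1}\|\sum_\beta c_\beta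 W_\beta(p)\|<\infty$. Each determines a unique bounded operator $\varphi({\bf W})$ with $\varphi({\bf W})p=\sum_\beta c_\beta W_\beta(p)$, $p\in\mathcal P$; $F^\infty(g)$ is the algebra of all such operators, and $\sum_\beta c_\beta W_\beta$ is the (unique) Fourier representation of $\varphi({\bf W})$. *)

theory Defs
  imports "HOL-Analysis.Analysis"
begin

section \<open>Complex Hilbert spaces\<close>

class complex_vector = real_vector +
  fixes scaleC :: "complex \<Rightarrow> 'a \<Rightarrow> 'a" (infixr "*\<^sub>C" 75)
  assumes scaleC_add_right: "c *\<^sub>C (x + y) = c *\<^sub>C x + c *\<^sub>C y"
    and scaleC_add_left: "(c + d) *\<^sub>C x = c *\<^sub>C x + d *\<^sub>C x"
    and scaleC_scaleC: "c *\<^sub>C d *\<^sub>C x = (c * d) *\<^sub>C x"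
    and scaleR_scaleC: "r *\<^sub>R x = complex_of_real r *\<^sub>C x"

text \<open>The complex inner product is linear in its first argument. Its real part is the real inner
  product of the library, which supplies the norm and the topology.\<close>

class complex_inner = complex_vector + real_inner +
  fixes cinner :: "'a \<Rightarrow> 'a \<Rightarrow> complex"
  assumes cinner_commute: "cinner x y = cnj (cinner y x)"
    and cinner_add_left: "cinner (x + y) z = cinner x z + cinner y z"
    and cinner_scaleC_left: "cinner (c *\<^sub>C x) y = c * cinner x y"
    and inner_eq_Re_cinner: "inner x y = Re (cinner x y)"

class chilbert_space = complex_inner + complete_space

lemma scaleC_one [simp]: "1 *\<^sub>C (x::'a::complex_vector) = x"
  using scaleR_scaleC[of 1 x] by simp

global_interpretation complex_vector: vector_space "scaleC :: complex \<Rightarrow> 'a \<Rightarrow> 'a::complex_vector"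
  defines cspan = complex_vector.span
  by unfold_locales (simp_all add: scaleC_add_right scaleC_add_left scaleC_scaleC)

lemma cinner_add_right: "cinner (x::'a::complex_inner) (y + z) = cinner x y + cinner x z"
  by (metis cinner_add_left cinner_commute complex_cnj_add)

lemma cinner_scaleC_right: "cinner (x::'a::complex_inner) (c *\<^sub>C y) = cnj c * cinner x y"
  by (metis cinner_scaleC_left cinner_commute complex_cnj_mult)

lemma cinner_self: "cinner (x::'a::complex_inner) x = complex_of_real ((norm x)\<^sup>2)"
proof -
  have "Im (cinner x x) = 0"
    using cinner_commute[of x x] by (metis add.inverse_neutral cnj.simps(2) eq_neg_iff_add_eq_0 
        add_0 neg_equal_zero)
  moreover have "Re (cinner x x) = (norm x)\<^sup>2"
    by (simp add: inner_eq_Re_cinner[symmetric] power2_norm_eq_inner)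
  ultimately show ?thesis
    by (simp add: complex_eq_iff)
qed

lemma norm_scaleC [simp]: "norm (c *\<^sub>C (x::'a::complex_inner)) = cmod c * norm x"
proof -
  have "cinner (c *\<^sub>C x) (c *\<^sub>C x) = (c * cnj c) * cinner x x"
    by (simp add: cinner_scaleC_left cinner_scaleC_right)
  hence "complex_of_real ((norm (c *\<^sub>C x))\<^sup>2) = complex_of_real ((cmod c * norm x)\<^sup>2)"
    unfolding cinner_self complex_norm_square[symmetric] power_mult_distrib of_real_mult of_real_power .
  hence "(norm (c *\<^sub>C x))\<^sup>2 = (cmod c * norm x)\<^sup>2"
    using of_real_eq_iff by blast
  thus ?thesis
    by (simp add: power2_eq_iff_nonneg)
qed

lemma cinner_cauchy_schwarz: "cmod (cinner (x::'a::complex_inner) y) \<le> norm x * norm y"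
proof (cases "cinner x y = 0")
  case False
  define u where "u = cnj (cinner x y) / cmod (cinner x y)"
  have u: "cmod u = 1"
    using False by (simp add: u_def norm_divide)
  have "u * cinner x y = cinner x y * cnj (cinner x y) / cmod (cinner x y)"
    by (simp add: u_def)
  also have "\<dots> = cmod (cinner x y)"
    using False by (simp add: complex_norm_square[symmetric] power2_eq_square)
  finally have "Re (u * cinner x y) = cmod (cinner x y)"
    by simp
  hence "cmod (cinner x y) = inner (u *\<^sub>C x) y"
    by (simp add: inner_eq_Re_cinner cinner_scaleC_left)
  also have "\<dots> \<le> norm (u *\<^sub>C x) * norm y"
    by (rule norm_cauchy_schwarz)
  finally show ?thesis
    using u by simp
qed simp

instantiation complex :: chilbert_space
begin
definition scaleC_complex :: "complex \<Rightarrow> complex \<Rightarrow> complex"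
  where "scaleC_complex c x = c * x"
definition cinner_complex :: "complex \<Rightarrow> complex \<Rightarrow> complex"
  where "cinner_complex x y = x * cnj y"
instance
  by standard (simp_all add: scaleC_complex_def cinner_complex_def algebra_simps scaleR_conv_of_real
      inner_complex_def)
end


section \<open>Square-summable families\<close>

typedef (overloaded) ('i, 'a) l2 = "{f :: 'i \<Rightarrow> 'a::complex_inner. (\<lambda>i. (norm (f i))\<^sup>2) summable_on UNIV}"
  morphisms l2_nth Abs_l2
  by (rule exI[of _ "\<lambda>_. 0"]) simp

setup_lifting type_definition_l2

lemma l2_summable: "(\<lambda>i. (norm (l2_nth f i))\<^sup>2) summable_on UNIV"
  using l2_nth[of f] by simp

lemma square_summable_add:
  fixes f g :: "'i \<Rightarrow> 'a::real_normed_vector"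
  assumes "(\<lambda>i. (norm (f i))\<^sup>2) summable_on A" "(\<lambda>i. (norm (g i))\<^sup>2) summable_on A"
  shows "(\<lambda>i. (norm (f i + g i))\<^sup>2) summable_on A"
proof (rule summable_on_comparison_test)
  show "(\<lambda>i. 2 * (norm (f i))\<^sup>2 + 2 * (norm (g i))\<^sup>2) summable_on A"
    by (intro summable_on_add summable_on_cmult_right assms)
  fix i
  have "(norm (f i + g i))\<^sup>2 \<le> (norm (f i) + norm (g i))\<^sup>2"
    by (intro power_mono norm_triangle_ineq) auto
  also have "\<dots> \<le> 2 * (norm (f i))\<^sup>2 + 2 * (norm (g i))\<^sup>2"
    using sum_squares_ge_zero[of "norm (f i) - norm (g i)" 0]
    by (simp add: power2_eq_square algebra_simps)
  finally show "(norm (f i + g i))\<^sup>2 \<le> 2 * (norm (f i))\<^sup>2 + 2 * (norm (g i))\<^sup>2" .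
qed auto

lemma l2_cinner_summable:
  fixes f g :: "('i, 'a::complex_inner) l2"
  shows "(\<lambda>i. cinner (l2_nth f i) (l2_nth g i)) summable_on UNIV"
proof (rule abs_summable_summable, rule summable_on_comparison_test)
  show "(\<lambda>i. (norm (l2_nth f i))\<^sup>2 + (norm (l2_nth g i))\<^sup>2) summable_on UNIV"
    by (intro summable_on_add l2_summable)
  fix i
  have "norm (cinner (l2_nth f i) (l2_nth g i)) \<le> norm (l2_nth f i) * norm (l2_nth g i)"
    by (rule cinner_cauchy_schwarz)
  also have "\<dots> \<le> (norm (l2_nth f i))\<^sup>2 + (norm (l2_nth g i))\<^sup>2"
    using sum_squares_bound[of "norm (l2_nth f i)" "norm (l2_nth g i)"]
      mult_nonneg_nonneg[OF norm_ge_zero norm_ge_zero, of "l2_nth f i" "l2_nth g i"]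
    by linarith
  finally show "norm (cinner (l2_nth f i) (l2_nth g i)) \<le> (norm (l2_nth f i))\<^sup>2 + (norm (l2_nth g i))\<^sup>2" .
qed auto

instantiation l2 :: (type, complex_inner) complex_inner
begin

lift_definition zero_l2 :: "('a, 'b) l2" is "\<lambda>_. 0" by simp
lift_definition plus_l2 :: "('a, 'b) l2 \<Rightarrow> ('a, 'b) l2 \<Rightarrow> ('a, 'b) l2" is "\<lambda>f g i. f i + g i"
  by (simp add: square_summable_add)
lift_definition uminus_l2 :: "('a, 'b) l2 \<Rightarrow> ('a, 'b) l2" is "\<lambda>f i. - f i" by simp
lift_definition minus_l2 :: "('a, 'b) l2 \<Rightarrow> ('a, 'b) l2 \<Rightarrow> ('a, 'b) l2" is "\<lambda>f g i. f i - g i"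
  subgoal for f g using square_summable_add[of f UNIV "\<lambda>i. - g i"] by simp
  done
lift_definition scaleC_l2 :: "complex \<Rightarrow> ('a, 'b) l2 \<Rightarrow> ('a, 'b) l2" is "\<lambda>c f i. c *\<^sub>C f i"
  by (simp add: power_mult_distrib summable_on_cmult_right)
lift_definition scaleR_l2 :: "real \<Rightarrow> ('a, 'b) l2 \<Rightarrow> ('a, 'b) l2" is "\<lambda>r f i. r *\<^sub>R f i"
  by (simp add: power_mult_distrib summable_on_cmult_right)
definition cinner_l2 :: "('a, 'b) l2 \<Rightarrow> ('a, 'b) l2 \<Rightarrow> complex"
  where "cinner_l2 f g = (\<Sum>\<^sub>\<infinity>i. cinner (l2_nth f i) (l2_nth g i))"
definition inner_l2 :: "('a, 'b) l2 \<Rightarrow> ('a, 'b) l2 \<Rightarrow> real"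
  where "inner_l2 f g = Re (cinner f g)"
definition norm_l2 :: "('a, 'b) l2 \<Rightarrow> real" where "norm_l2 f = sqrt (inner f f)"
definition sgn_l2 :: "('a, 'b) l2 \<Rightarrow> ('a, 'b) l2" where "sgn_l2 f = inverse (norm f) *\<^sub>R f"
definition dist_l2 :: "('a, 'b) l2 \<Rightarrow> ('a, 'b) l2 \<Rightarrow> real" where "dist_l2 f g = norm (f - g)"
definition uniformity_l2 :: "(('a, 'b) l2 \<times> ('a, 'b) l2) filter"
  where "uniformity_l2 = (INF e\<in>{0 <..}. principal {(x, y). dist x y < e})"
definition open_l2 :: "('a, 'b) l2 set \<Rightarrow> bool"
  where "open_l2 U = (\<forall>x\<in>U. \<forall>\<^sub>F (x', y) in uniformity. x' = x \<longrightarrow> y \<in> U)"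

instance
proof
  fix x y z :: "('a, 'b) l2" and c d :: complex and r s :: real
  show "x + y + z = x + (y + z)" by transfer (simp add: add.assoc)
  show "x + y = y + x" by transfer (simp add: add.commute)
  show "0 + x = x" by transfer simp
  show "- x + x = 0" by transfer simp
  show "x - y = x + - y" by transfer simp
  show "r *\<^sub>R (x + y) = r *\<^sub>R x + r *\<^sub>R y" by transfer (simp add: scaleR_add_right)
  show "(r + s) *\<^sub>R x = r *\<^sub>R x + s *\<^sub>R x" by transfer (simp add: scaleR_add_left)
  show "r *\<^sub>R s *\<^sub>R x = (r * s) *\<^sub>R x" by transfer simp
  show "1 *\<^sub>R x = x" by transfer simp
  show "c *\<^sub>C (x + y) = c *\<^sub>C x + c *\<^sub>C y" by transfer (simp add: scaleC_add_right)
  show "(c + d) *\<^sub>C x = c *\<^sub>C x + d *\<^sub>C x" by transfer (simp add: scaleC_add_left)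
  show "c *\<^sub>C d *\<^sub>C x = (c * d) *\<^sub>C x" by transfer (simp add: scaleC_scaleC)
  show "r *\<^sub>R x = complex_of_real r *\<^sub>C x" by transfer (simp add: scaleR_scaleC)
  show "sgn x = inverse (norm x) *\<^sub>R x" by (rule sgn_l2_def)
  show "dist x y = norm (x - y)" by (rule dist_l2_def)
  show "uniformity = (INF e\<in>{0 <..}. principal {(x, y::('a, 'b) l2). dist x y < e})"
    by (rule uniformity_l2_def)
  show "open U = (\<forall>x\<in>U. \<forall>\<^sub>F (x', y) in uniformity. x' = x \<longrightarrow> y \<in> U)" for U :: "('a, 'b) l2 set"
    by (rule open_l2_def)
  show comm: "cinner x y = cnj (cinner y x)" for x y :: "('a, 'b) l2"
    unfolding cinner_l2_def infsum_cnj[symmetric] by (subst cinner_commute) simp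
  show add: "cinner (x + y) z = cinner x z + cinner y z" for x y z :: "('a, 'b) l2"
    unfolding cinner_l2_def
    by (simp add: plus_l2.rep_eq cinner_add_left infsum_add l2_cinner_summable)
  show scl: "cinner (c *\<^sub>C x) y = c * cinner x y" for x y :: "('a, 'b) l2" and c
    unfolding cinner_l2_def
    by (simp add: scaleC_l2.rep_eq cinner_scaleC_left infsum_cmult_right l2_cinner_summable)
  show "inner x y = Re (cinner x y)" by (rule inner_l2_def)
  show "inner x y = inner y x"
    unfolding inner_l2_def by (subst comm) simp
  show "inner (x + y) z = inner x z + inner y z"
    by (simp add: inner_l2_def add)
  have R: "r *\<^sub>R x = complex_of_real r *\<^sub>C x" by transfer (simp add: scaleR_scaleC)
  show "inner (r *\<^sub>R x) y = r * inner x y"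
    by (simp add: inner_l2_def scl R)
  have sq: "inner x x = (\<Sum>\<^sub>\<infinity>i. (norm (l2_nth x i))\<^sup>2)" for x :: "('a, 'b) l2"
  proof -
    have "cinner x x = complex_of_real (\<Sum>\<^sub>\<infinity>i. (norm (l2_nth x i))\<^sup>2)"
      unfolding cinner_l2_def cinner_self
      by (intro infsumI has_sum_of_real has_sum_infsum l2_summable)
    thus ?thesis by (simp add: inner_l2_def)
  qed
  show "0 \<le> inner x x"
    unfolding sq by (rule infsum_nonneg) simp
  show "(inner x x = 0) = (x = 0)"
  proof
    assume "inner x x = 0"
    hence "(norm (l2_nth x i))\<^sup>2 = 0" for i
      unfolding sq using nonneg_infsum_le_0D[OF _ l2_summable[of x], of i] by simp
    thus "x = 0" by transfer auto
  next
    assume "x = 0"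
    thus "inner x x = 0" unfolding sq by (simp add: zero_l2.rep_eq)
  qed
  show "norm x = sqrt (inner x x)" by (rule norm_l2_def)
qed

end

lemma norm_l2_power2: "(norm (f :: ('i, 'a::complex_inner) l2))\<^sup>2 = (\<Sum>\<^sub>\<infinity>i. (norm (l2_nth f i))\<^sup>2)"
proof -
  have "complex_of_real ((norm f)\<^sup>2) = complex_of_real (\<Sum>\<^sub>\<infinity>i. (norm (l2_nth f i))\<^sup>2)"
    unfolding cinner_self[symmetric] cinner_l2_def
    unfolding cinner_self by (intro infsumI has_sum_of_real has_sum_infsum l2_summable)
  thus ?thesis using of_real_eq_iff by blast
qed

lemma sum_le_norm_l2:
  assumes "finite F"
  shows "(\<Sum>i\<in>F. (norm (l2_nth f i))\<^sup>2) \<le> (norm (f :: ('i, 'a::complex_inner) l2))\<^sup>2"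
  unfolding norm_l2_power2 by (rule finite_sum_le_infsum) (use assms l2_summable in auto)

lemma norm_l2_nth_le: "norm (l2_nth f i) \<le> norm (f :: ('i, 'a::complex_inner) l2)"
  using sum_le_norm_l2[of "{i}" f] by (simp add: power2_le_iff_abs_le)

instance l2 :: (type, chilbert_space) chilbert_space
proof
  fix X :: "nat \<Rightarrow> ('a, 'b) l2"
  assume X: "Cauchy X"
  have "Cauchy (\<lambda>n. l2_nth (X n) i)" for i
  proof (rule metric_CauchyI)
    fix e :: real assume "e > 0"
    then obtain N where N: "\<And>m n. m \<ge> N \<Longrightarrow> n \<ge> N \<Longrightarrow> dist (X m) (X n) < e"
      using X by (metis metric_CauchyD)
    have "dist (l2_nth (X m) i) (l2_nth (X n) i) \<le> dist (X m) (X n)" for m n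
      using norm_l2_nth_le[of "X m - X n" i] by (simp add: dist_norm minus_l2.rep_eq)
    thus "\<exists>N. \<forall>m\<ge>N. \<forall>n\<ge>N. dist (l2_nth (X m) i) (l2_nth (X n) i) < e"
      using N by (meson le_less_trans)
  qed
  hence "\<exists>l. (\<lambda>n. l2_nth (X n) i) \<longlonglongrightarrow> l" for i
    by (simp add: Cauchy_convergent_iff convergent_def)
  then obtain f where f: "\<And>i. (\<lambda>n. l2_nth (X n) i) \<longlonglongrightarrow> f i"
    by metis
  have fin: "(\<Sum>i\<in>F. (norm (l2_nth (X m) i - f i))\<^sup>2) \<le> e\<^sup>2"
    if F: "finite F" and m: "\<And>n. n \<ge> m \<Longrightarrow> dist (X m) (X n) \<le> e" for e m F
  proof (rule LIMSEQ_le_const2)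
    show "(\<lambda>n. \<Sum>i\<in>F. (norm (l2_nth (X m) i - l2_nth (X n) i))\<^sup>2)
        \<longlonglongrightarrow> (\<Sum>i\<in>F. (norm (l2_nth (X m) i - f i))\<^sup>2)"
      by (intro tendsto_intros f)
    have "(\<Sum>i\<in>F. (norm (l2_nth (X m) i - l2_nth (X n) i))\<^sup>2) \<le> e\<^sup>2" if "n \<ge> m" for n
    proof -
      have "(\<Sum>i\<in>F. (norm (l2_nth (X m - X n) i))\<^sup>2) \<le> (norm (X m - X n))\<^sup>2"
        by (rule sum_le_norm_l2[OF F])
      also have "\<dots> \<le> e\<^sup>2"
        using m[OF that] by (simp add: dist_norm power_mono)
      finally show ?thesis by (simp add: minus_l2.rep_eq)
    qed
    thus "\<exists>N. \<forall>n\<ge>N. (\<Sum>i\<in>F. (norm (l2_nth (X m) i - l2_nth (X n) i))\<^sup>2) \<le> e\<^sup>2"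
      by blast
  qed
  have smd: "(\<lambda>i. (norm (l2_nth (X m) i - f i))\<^sup>2) summable_on UNIV"
    if "\<And>n. n \<ge> m \<Longrightarrow> dist (X m) (X n) \<le> e" for e m
    by (rule nonneg_bdd_above_summable_on)
       (auto intro!: bdd_aboveI2[where M = "e\<^sup>2"] fin that)
  obtain M where M: "\<And>n. n \<ge> M \<Longrightarrow> dist (X M) (X n) \<le> 1"
    using X by (metis metric_CauchyD less_imp_le order_refl zero_less_one)
  have fs: "(\<lambda>i. (norm (f i))\<^sup>2) summable_on UNIV"
  proof -
    have "(\<lambda>i. (norm (l2_nth (X M) i + - (l2_nth (X M) i - f i)))\<^sup>2) summable_on UNIV"
      by (rule square_summable_add[OF l2_summable]) (use smd[OF M] in \<open>simp only: norm_minus_cancel\<close>)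
    thus ?thesis by simp
  qed
  define L where "L = Abs_l2 f"
  have L: "l2_nth L = f"
    unfolding L_def using fs by (simp add: Abs_l2_inverse)
  have "X \<longlonglongrightarrow> L"
  proof (rule metric_LIMSEQ_I)
    fix e :: real assume e: "e > 0"
    then obtain N where N: "\<And>m n. m \<ge> N \<Longrightarrow> n \<ge> N \<Longrightarrow> dist (X m) (X n) < e / 2"
      using X by (metis metric_CauchyD half_gt_zero)
    have "dist (X m) L < e" if m: "m \<ge> N" for m
    proof -
      have le: "\<And>n. n \<ge> m \<Longrightarrow> dist (X m) (X n) \<le> e / 2"
        using N m by (meson less_imp_le order_trans)
      have "(norm (X m - L))\<^sup>2 \<le> (e / 2)\<^sup>2"
        unfolding norm_l2_power2 minus_l2.rep_eq L
        by (rule infsum_le_finite_sums[OF smd[OF le]]) (auto intro: fin le)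
      hence "norm (X m - L) \<le> e / 2"
        using e by (simp add: power2_le_iff_abs_le)
      thus ?thesis using e by (simp add: dist_norm)
    qed
    thus "\<exists>no. \<forall>n\<ge>no. dist (X n) L < e" by blast
  qed
  thus "convergent X" by (rule convergentI)
qed


section \<open>Bounded operators\<close>

typedef (overloaded) ('a, 'b) cblinfun (\<open>(_ \<Rightarrow>\<^sub>B /_)\<close> [22, 21] 21) =
  "{f :: 'a::complex_inner \<Rightarrow> 'b::complex_inner. bounded_linear f \<and> (\<forall>c x. f (c *\<^sub>C x) = c *\<^sub>C f x)}"
  morphisms cblinfun_apply Abs_cblinfun
  by (rule exI[of _ "\<lambda>_. 0"]) simp

declare [[coercion "cblinfun_apply :: ('a::complex_inner \<Rightarrow>\<^sub>B 'b::complex_inner) \<Rightarrow> 'a \<Rightarrow> 'b"]]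

setup_lifting type_definition_cblinfun

lemma bounded_linear_cblinfun_apply: "bounded_linear (cblinfun_apply A)"
  using cblinfun_apply[of A] by simp

lemma bounded_linear_scaleC: "bounded_linear (\<lambda>x::'a::complex_inner. c *\<^sub>C x)"
  by (rule bounded_linear_intro[where K = "cmod c"])
     (simp_all add: scaleC_add_right scaleR_scaleC scaleC_scaleC mult.commute)

instantiation cblinfun :: (complex_inner, complex_inner) "{complex_vector, real_normed_vector}"
begin

lift_definition zero_cblinfun :: "'a \<Rightarrow>\<^sub>B 'b" is "\<lambda>_. 0" by simp
lift_definition plus_cblinfun :: "('a \<Rightarrow>\<^sub>B 'b) \<Rightarrow> ('a \<Rightarrow>\<^sub>B 'b) \<Rightarrow> ('a \<Rightarrow>\<^sub>B 'b)" is "\<lambda>f g x. f x + g x"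
  by (simp add: bounded_linear_add scaleC_add_right)
lift_definition uminus_cblinfun :: "('a \<Rightarrow>\<^sub>B 'b) \<Rightarrow> ('a \<Rightarrow>\<^sub>B 'b)" is "\<lambda>f x. - f x"
  by (simp add: bounded_linear_minus)
lift_definition minus_cblinfun :: "('a \<Rightarrow>\<^sub>B 'b) \<Rightarrow> ('a \<Rightarrow>\<^sub>B 'b) \<Rightarrow> ('a \<Rightarrow>\<^sub>B 'b)" is "\<lambda>f g x. f x - g x"
  by (simp add: bounded_linear_sub complex_vector.scale_right_diff_distrib)
lift_definition scaleC_cblinfun :: "complex \<Rightarrow> ('a \<Rightarrow>\<^sub>B 'b) \<Rightarrow> ('a \<Rightarrow>\<^sub>B 'b)" is "\<lambda>c f x. c *\<^sub>C f x"
  by (auto intro: bounded_linear_compose[OF bounded_linear_scaleC] simp: scaleC_scaleC mult.commute)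
lift_definition scaleR_cblinfun :: "real \<Rightarrow> ('a \<Rightarrow>\<^sub>B 'b) \<Rightarrow> ('a \<Rightarrow>\<^sub>B 'b)" is "\<lambda>r f x. r *\<^sub>R f x"
  by (simp add: bounded_linear_const_scaleR scaleR_scaleC[symmetric])
     (simp add: scaleR_scaleC scaleC_scaleC mult.commute)
lift_definition norm_cblinfun :: "('a \<Rightarrow>\<^sub>B 'b) \<Rightarrow> real" is onorm .
definition sgn_cblinfun :: "('a \<Rightarrow>\<^sub>B 'b) \<Rightarrow> ('a \<Rightarrow>\<^sub>B 'b)" where "sgn_cblinfun A = inverse (norm A) *\<^sub>R A"
definition dist_cblinfun :: "('a \<Rightarrow>\<^sub>B 'b) \<Rightarrow> ('a \<Rightarrow>\<^sub>B 'b) \<Rightarrow> real" where "dist_cblinfun A B = norm (A - B)"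
definition uniformity_cblinfun :: "(('a \<Rightarrow>\<^sub>B 'b) \<times> ('a \<Rightarrow>\<^sub>B 'b)) filter"
  where "uniformity_cblinfun = (INF e\<in>{0 <..}. principal {(x, y). dist x y < e})"
definition open_cblinfun :: "('a \<Rightarrow>\<^sub>B 'b) set \<Rightarrow> bool"
  where "open_cblinfun U = (\<forall>x\<in>U. \<forall>\<^sub>F (x', y) in uniformity. x' = x \<longrightarrow> y \<in> U)"

instance
proof
  fix x y z :: "'a \<Rightarrow>\<^sub>B 'b" and c d :: complex and r s :: real
  show "x + y + z = x + (y + z)" by transfer (simp add: add.assoc)
  show "x + y = y + x" by transfer (simp add: add.commute)
  show "0 + x = x" by transfer simp
  show "- x + x = 0" by transfer simp
  show "x - y = x + - y" by transfer simp
  show "r *\<^sub>R (x + y) = r *\<^sub>R x + r *\<^sub>R y" by transfer (simp add: scaleR_add_right)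
  show "(r + s) *\<^sub>R x = r *\<^sub>R x + s *\<^sub>R x" by transfer (simp add: scaleR_add_left)
  show "r *\<^sub>R s *\<^sub>R x = (r * s) *\<^sub>R x" by transfer simp
  show "1 *\<^sub>R x = x" by transfer simp
  show "c *\<^sub>C (x + y) = c *\<^sub>C x + c *\<^sub>C y" by transfer (simp add: scaleC_add_right)
  show "(c + d) *\<^sub>C x = c *\<^sub>C x + d *\<^sub>C x" by transfer (simp add: scaleC_add_left)
  show "c *\<^sub>C d *\<^sub>C x = (c * d) *\<^sub>C x" by transfer (simp add: scaleC_scaleC)
  show "r *\<^sub>R x = complex_of_real r *\<^sub>C x" by transfer (simp add: scaleR_scaleC)
  show "sgn x = inverse (norm x) *\<^sub>R x" by (rule sgn_cblinfun_def)
  show "dist x y = norm (x - y)" by (rule dist_cblinfun_def)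
  show "uniformity = (INF e\<in>{0 <..}. principal {(x, y::'a \<Rightarrow>\<^sub>B 'b). dist x y < e})"
    by (rule uniformity_cblinfun_def)
  show "open U = (\<forall>x\<in>U. \<forall>\<^sub>F (x', y) in uniformity. x' = x \<longrightarrow> y \<in> U)" for U :: "('a \<Rightarrow>\<^sub>B 'b) set"
    by (rule open_cblinfun_def)
  show "(norm x = 0) = (x = 0)" by transfer (auto simp: onorm_eq_0)
  show "norm (x + y) \<le> norm x + norm y" by transfer (simp add: onorm_triangle)
  show "norm (r *\<^sub>R x) = \<bar>r\<bar> * norm x" by transfer (simp add: onorm_scaleR)
qed

end

lift_definition cblinfun_id :: "'a::complex_inner \<Rightarrow>\<^sub>B 'a" is "\<lambda>x. x"
  by simp

lift_definition cblinfun_compose ::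
  "('b::complex_inner \<Rightarrow>\<^sub>B 'c::complex_inner) \<Rightarrow> ('a::complex_inner \<Rightarrow>\<^sub>B 'b) \<Rightarrow> ('a \<Rightarrow>\<^sub>B 'c)"
  (infixl "o\<^sub>C" 67) is "\<lambda>f g x. f (g x)"
  by (simp add: bounded_linear_compose)

text \<open>Adjoints, positive square roots and the other operators introduced by \<open>THE\<close> below are determined
  by their defining property; they are only used where that property can be met.\<close>

definition adj :: "('a::chilbert_space \<Rightarrow>\<^sub>B 'b::chilbert_space) \<Rightarrow> ('b \<Rightarrow>\<^sub>B 'a)"
  where "adj A = (THE B :: 'b \<Rightarrow>\<^sub>B 'a. \<forall>x y. cinner (A x) y = cinner x (B y))"

definition pos_op :: "('a::chilbert_space \<Rightarrow>\<^sub>B 'a) \<Rightarrow> bool"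
  where "pos_op A \<longleftrightarrow> (\<forall>x. cinner (A x) x \<in> \<real>\<^sub>\<ge>\<^sub>0)"

definition op_le :: "('a::chilbert_space \<Rightarrow>\<^sub>B 'a) \<Rightarrow> ('a \<Rightarrow>\<^sub>B 'a) \<Rightarrow> bool"
  where "op_le A B \<longleftrightarrow> pos_op (B - A)"

definition op_sqrt :: "('a::chilbert_space \<Rightarrow>\<^sub>B 'a) \<Rightarrow> ('a \<Rightarrow>\<^sub>B 'a)"
  where "op_sqrt A = (THE B. pos_op B \<and> B o\<^sub>C B = A)"

definition wot_tendsto ::
  "('i \<Rightarrow> ('a::chilbert_space \<Rightarrow>\<^sub>B 'b::chilbert_space)) \<Rightarrow> ('a \<Rightarrow>\<^sub>B 'b) \<Rightarrow> 'i filter \<Rightarrow> bool"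
  where "wot_tendsto f A F \<longleftrightarrow> (\<forall>x y. ((\<lambda>i. cinner (f i x) y) \<longlongrightarrow> cinner (A x) y) F)"

definition sot_tendsto ::
  "('i \<Rightarrow> ('a::chilbert_space \<Rightarrow>\<^sub>B 'b::chilbert_space)) \<Rightarrow> ('a \<Rightarrow>\<^sub>B 'b) \<Rightarrow> 'i filter \<Rightarrow> bool"
  where "sot_tendsto f A F \<longleftrightarrow> (\<forall>x. ((\<lambda>i. f i x) \<longlongrightarrow> A x) F)"

definition seq_wot_continuous_on ::
  "('a::chilbert_space \<Rightarrow>\<^sub>B 'a) set \<Rightarrow> (('a \<Rightarrow>\<^sub>B 'a) \<Rightarrow> ('b::chilbert_space \<Rightarrow>\<^sub>B 'b)) \<Rightarrow> bool"
  where "seq_wot_continuous_on S \<Phi> \<longleftrightarrow>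
    (\<forall>A L. (\<forall>k::nat. A k \<in> S) \<and> L \<in> S \<and> wot_tendsto A L sequentially \<longrightarrow>
      wot_tendsto (\<lambda>k. \<Phi> (A k)) (\<Phi> L) sequentially)"

definition seq_sot_continuous_on ::
  "('a::chilbert_space \<Rightarrow>\<^sub>B 'a) set \<Rightarrow> (('a \<Rightarrow>\<^sub>B 'a) \<Rightarrow> ('b::chilbert_space \<Rightarrow>\<^sub>B 'b)) \<Rightarrow> bool"
  where "seq_sot_continuous_on S \<Phi> \<longleftrightarrow>
    (\<forall>A L. (\<forall>k::nat. A k \<in> S) \<and> L \<in> S \<and> sot_tendsto A L sequentially \<longrightarrow>
      sot_tendsto (\<lambda>k. \<Phi> (A k)) (\<Phi> L) sequentially)"

definition clinear_on ::
  "'a::complex_vector set \<Rightarrow> ('a \<Rightarrow> 'b::complex_vector) \<Rightarrow> bool"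
  where "clinear_on S \<Phi> \<longleftrightarrow>
    (\<forall>A\<in>S. \<forall>B\<in>S. \<Phi> (A + B) = \<Phi> A + \<Phi> B) \<and> (\<forall>A\<in>S. \<forall>c. \<Phi> (c *\<^sub>C A) = c *\<^sub>C \<Phi> A)"

definition unital_hom_on ::
  "('a::complex_inner \<Rightarrow>\<^sub>B 'a) set \<Rightarrow> (('a \<Rightarrow>\<^sub>B 'a) \<Rightarrow> ('b::complex_inner \<Rightarrow>\<^sub>B 'b)) \<Rightarrow> bool"
  where "unital_hom_on S \<Phi> \<longleftrightarrow>
    clinear_on S \<Phi> \<and> \<Phi> cblinfun_id = cblinfun_id \<and>
    (\<forall>A\<in>S. \<forall>B\<in>S. \<Phi> (A o\<^sub>C B) = \<Phi> A o\<^sub>C \<Phi> B)"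

text \<open>The predual of \<open>B(H)\<close> is the trace class; the trace-class operators are exactly the sums of
  rank-one operators given by two square-summable sequences, and \<open>A \<mapsto> \<Sum>k. \<langle>A x\<^sub>k, y\<^sub>k\<rangle>\<close> is the
  functional such an operator induces.\<close>

definition predual :: "(('a::chilbert_space \<Rightarrow>\<^sub>B 'a) \<Rightarrow> complex) set"
  where "predual = {\<omega>. \<exists>x y :: nat \<Rightarrow> 'a.
    summable (\<lambda>k. (norm (x k))\<^sup>2) \<and> summable (\<lambda>k. (norm (y k))\<^sup>2) \<and>
    \<omega> = (\<lambda>A :: 'a \<Rightarrow>\<^sub>B 'a. \<Sum>k. cinner (A (x k)) (y k))}"

definition weak_star_topology :: "('a::chilbert_space \<Rightarrow>\<^sub>B 'a) topology"
  where "weak_star_topology = topology_generated_by {\<omega> -` U |\<omega> U. \<omega> \<in> predual \<and> open U}"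

text \<open>The norm of the \<open>k \<times> k\<close> operator matrix \<open>M\<close> acting on the \<open>k\<close>-fold Hilbert space direct sum.
  Entries of \<open>M\<close> outside \<open>k \<times> k\<close> are ignored.\<close>

definition op_matrix_norm :: "nat \<Rightarrow> (nat \<Rightarrow> nat \<Rightarrow> ('a::chilbert_space \<Rightarrow>\<^sub>B 'a)) \<Rightarrow> real"
  where "op_matrix_norm k M = Sup {sqrt (\<Sum>i<k. (norm (\<Sum>j<k. M i j (x j)))\<^sup>2) |x.
    (\<Sum>j<k. (norm (x j))\<^sup>2) \<le> 1}"

definition completely_contractive_on ::
  "('a::chilbert_space \<Rightarrow>\<^sub>B 'a) set \<Rightarrow> (('a \<Rightarrow>\<^sub>B 'a) \<Rightarrow> ('b::chilbert_space \<Rightarrow>\<^sub>B 'b)) \<Rightarrow> bool"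
  where "completely_contractive_on S \<Phi> \<longleftrightarrow>
    (\<forall>k M. (\<forall>i<k. \<forall>j<k. M i j \<in> S) \<longrightarrow>
      op_matrix_norm k (\<lambda>i j. \<Phi> (M i j)) \<le> op_matrix_norm k M)"


section \<open>Fock space and tensor products\<close>

text \<open>Words over the finite index type \<open>'n\<close> are the elements of the free semigroup. \<open>F\<^sup>2(H\<^sub>n)\<close> is
  identified with the square-summable families on words through its orthonormal basis, and
  \<open>F\<^sup>2(H\<^sub>n) \<otimes> H\<close> with the square-summable families of vectors of \<open>H\<close>, so that \<open>f \<otimes> h\<close> is the
  family \<open>\<alpha> \<mapsto> f\<^sub>\<alpha> h\<close>.\<close>

type_synonym 'n fock = "('n list, complex) l2"

lift_definition l2_basis :: "'i \<Rightarrow> ('i, complex) l2" is "\<lambda>i j. if j = i then 1 else 0"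
  subgoal for i
    by (rule finite_nonzero_values_imp_summable_on, rule finite_subset[of _ "{i}"]) auto
  done

lift_definition tensor :: "('i, complex) l2 \<Rightarrow> 'a::complex_inner \<Rightarrow> ('i, 'a) l2" is "\<lambda>f h i. f i *\<^sub>C h"
  by (simp add: power_mult_distrib summable_on_cmult_left)

text \<open>\<open>A \<otimes> I\<^sub>H\<close> is the only bounded operator with this action on elementary tensors, which span a
  dense subspace.\<close>

definition ampliation ::
  "(('i, complex) l2 \<Rightarrow>\<^sub>B ('i, complex) l2) \<Rightarrow> (('i, 'a::chilbert_space) l2 \<Rightarrow>\<^sub>B ('i, 'a) l2)"
  where "ampliation A = (THE B :: ('i, 'a) l2 \<Rightarrow>\<^sub>B ('i, 'a) l2. \<forall>f h. B (tensor f h) = tensor (A f) h)"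


section \<open>Noncommutative power series and domains\<close>

text \<open>A formal power series \<open>\<Sum>\<alpha>. c\<^sub>\<alpha> Z\<^sub>\<alpha>\<close> is its family of coefficients. Only series with real
  coefficients occur as \<open>g\<close> and \<open>g\<^sup>-\<^sup>1\<close>.\<close>

definition nc_mult :: "('n list \<Rightarrow> real) \<Rightarrow> ('n list \<Rightarrow> real) \<Rightarrow> ('n list \<Rightarrow> real)"
  where "nc_mult f g = (\<lambda>\<alpha>. \<Sum>k\<le>length \<alpha>. f (take k \<alpha>) * g (drop k \<alpha>))"

definition nc_one :: "'n list \<Rightarrow> real"
  where "nc_one \<alpha> = (if \<alpha> = [] then 1 else 0)"

definition nc_inverse :: "('n list \<Rightarrow> real) \<Rightarrow> ('n list \<Rightarrow> real)"
  where "nc_inverse b = (THE a. nc_mult a b = nc_one \<and> nc_mult b a = nc_one)"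

text \<open>Convergence on a row ball of every Hilbert space cannot be quantified over inside a formula;
  this is the equivalent Cauchy--Hadamard condition on the coefficients.\<close>

definition free_holomorphic_near_0 :: "('n::finite list \<Rightarrow> real) \<Rightarrow> bool"
  where "free_holomorphic_near_0 c \<longleftrightarrow>
    limsup (\<lambda>k. ereal (root (2 * k) (\<Sum>\<alpha> | length \<alpha> = k. \<bar>c \<alpha>\<bar>\<^sup>2))) < \<infinity>"

primrec word_op :: "('n \<Rightarrow> ('a::complex_inner \<Rightarrow>\<^sub>B 'a)) \<Rightarrow> 'n list \<Rightarrow> ('a \<Rightarrow>\<^sub>B 'a)"
  where "word_op X [] = cblinfun_id"
  | "word_op X (i # \<alpha>) = X i o\<^sub>C word_op X \<alpha>"

definition weighted_shift :: "('n list \<Rightarrow> real) \<Rightarrow> 'n \<Rightarrow> ('n fock \<Rightarrow>\<^sub>B 'n fock)"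
  where "weighted_shift b i =
    (THE A :: 'n fock \<Rightarrow>\<^sub>B 'n fock. \<forall>\<alpha>. A (l2_basis \<alpha>) = sqrt (b \<alpha> / b (i # \<alpha>)) *\<^sub>R l2_basis (i # \<alpha>))"

definition defect_partial ::
  "('n::finite list \<Rightarrow> real) \<Rightarrow> ('n \<Rightarrow> ('a::chilbert_space \<Rightarrow>\<^sub>B 'a)) \<Rightarrow> nat \<Rightarrow> ('a \<Rightarrow>\<^sub>B 'a)"
  where "defect_partial b X k =
    (\<Sum>p\<le>k. \<Sum>\<alpha> | length \<alpha> = p. nc_inverse b \<alpha> *\<^sub>R (word_op X \<alpha> o\<^sub>C adj (word_op X \<alpha>)))"

definition admissible :: "('n::finite list \<Rightarrow> real) \<Rightarrow> bool"
  where "admissible b \<longleftrightarrow>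
    b [] = 1 \<and> (\<forall>\<alpha>. b \<alpha> > 0) \<and> (\<forall>i. bdd_above (range (\<lambda>\<alpha>. b \<alpha> / b (i # \<alpha>)))) \<and>
    free_holomorphic_near_0 b \<and>
    bdd_above (range (\<lambda>k. norm (defect_partial b (weighted_shift b) k)))"

definition defect :: "('n::finite list \<Rightarrow> real) \<Rightarrow> ('n \<Rightarrow> ('a::chilbert_space \<Rightarrow>\<^sub>B 'a)) \<Rightarrow> ('a \<Rightarrow>\<^sub>B 'a)"
  where "defect b X = (THE D. wot_tendsto (defect_partial b X) D sequentially)"

text \<open>The sum over all words has positive terms, so it is read as an unordered sum, unlike the series
  for the defect, which is summed by word length.\<close>

definition wot_sums_defect ::
  "('n::finite list \<Rightarrow> real) \<Rightarrow> ('n \<Rightarrow> ('a::chilbert_space \<Rightarrow>\<^sub>B 'a)) \<Rightarrow> ('a \<Rightarrow>\<^sub>B 'a) \<Rightarrow> bool"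
  where "wot_sums_defect b X S \<longleftrightarrow>
    wot_tendsto (\<lambda>F. \<Sum>\<alpha>\<in>F. b \<alpha> *\<^sub>R (word_op X \<alpha> o\<^sub>C defect b X o\<^sub>C adj (word_op X \<alpha>))) S
      (finite_subsets_at_top UNIV)"

definition nc_domain :: "('n::finite list \<Rightarrow> real) \<Rightarrow> ('n \<Rightarrow> ('a::chilbert_space \<Rightarrow>\<^sub>B 'a)) set"
  where "nc_domain b = {X. (\<exists>D. wot_tendsto (defect_partial b X) D sequentially) \<and>
    pos_op (defect b X) \<and> (\<exists>S. wot_sums_defect b X S \<and> op_le S cblinfun_id)}"

definition pure_tuple :: "('n::finite list \<Rightarrow> real) \<Rightarrow> ('n \<Rightarrow> ('a::chilbert_space \<Rightarrow>\<^sub>B 'a)) \<Rightarrow> bool"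
  where "pure_tuple b X \<longleftrightarrow> X \<in> nc_domain b \<and> wot_sums_defect b X cblinfun_id"

definition radially_pure :: "('n::finite list \<Rightarrow> real) \<Rightarrow> ('n \<Rightarrow> ('a::chilbert_space \<Rightarrow>\<^sub>B 'a)) \<Rightarrow> bool"
  where "radially_pure b X \<longleftrightarrow>
    (\<exists>\<delta>::real. 0 < \<delta> \<and> \<delta> < 1 \<and> (\<forall>r\<in>{\<delta><..<1}. pure_tuple b (\<lambda>i. r *\<^sub>R X i)))"

definition berezin_kernel ::
  "('n::finite list \<Rightarrow> real) \<Rightarrow> ('n \<Rightarrow> ('a::chilbert_space \<Rightarrow>\<^sub>B 'a)) \<Rightarrow> ('a \<Rightarrow>\<^sub>B ('n list, 'a) l2)"
  where "berezin_kernel b T = (THE K :: 'a \<Rightarrow>\<^sub>B ('n list, 'a) l2. \<forall>h.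
    ((\<lambda>\<alpha>. sqrt (b \<alpha>) *\<^sub>R tensor (l2_basis \<alpha>) (op_sqrt (defect b T) (adj (word_op T \<alpha>) h)))
      has_sum K h) UNIV)"


section \<open>The Hardy algebra and its functional calculus\<close>

definition fock_polys :: "'n fock set"
  where "fock_polys = cspan (range l2_basis)"

definition fourier_rep :: "('n::finite list \<Rightarrow> real) \<Rightarrow> ('n list \<Rightarrow> complex) \<Rightarrow> ('n fock \<Rightarrow>\<^sub>B 'n fock) \<Rightarrow> bool"
  where "fourier_rep b c A \<longleftrightarrow>
    (\<forall>\<gamma>. (\<lambda>\<beta>. (cmod (c \<beta>))\<^sup>2 * (b \<gamma> / b (\<beta> @ \<gamma>))) summable_on UNIV) \<and>
    bdd_above {norm (\<Sum>\<^sub>\<infinity>\<beta>. c \<beta> *\<^sub>C word_op (weighted_shift b) \<beta> p) |p. p \<in> fock_polys \<and> norm p \<le> 1} \<and>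
    (\<forall>p\<in>fock_polys. ((\<lambda>\<beta>. c \<beta> *\<^sub>C word_op (weighted_shift b) \<beta> p) has_sum A p) UNIV)"

definition hardy_algebra :: "('n::finite list \<Rightarrow> real) \<Rightarrow> ('n fock \<Rightarrow>\<^sub>B 'n fock) set"
  where "hardy_algebra b = {A. \<exists>c. fourier_rep b c A}"

definition hardy_calculus ::
  "('n::finite list \<Rightarrow> real) \<Rightarrow> ('n \<Rightarrow> ('a::chilbert_space \<Rightarrow>\<^sub>B 'a)) \<Rightarrow> ('n fock \<Rightarrow>\<^sub>B 'n fock) \<Rightarrow> ('a \<Rightarrow>\<^sub>B 'a)"
  where "hardy_calculus b T A = adj (berezin_kernel b T) o\<^sub>C ampliation A o\<^sub>C berezin_kernel b T"

text \<open>\<open>\<phi>\<^sub>r(T)\<close> is the sum over \<open>k\<close> of these terms, in operator norm.\<close>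

definition radial_term ::
  "('n::finite list \<Rightarrow> complex) \<Rightarrow> ('n \<Rightarrow> ('a::chilbert_space \<Rightarrow>\<^sub>B 'a)) \<Rightarrow> real \<Rightarrow> nat \<Rightarrow> ('a \<Rightarrow>\<^sub>B 'a)"
  where "radial_term c T r k = (\<Sum>\<alpha> | length \<alpha> = k. (complex_of_real (r ^ length \<alpha>) * c \<alpha>) *\<^sub>C word_op T \<alpha>)"

end

theory Submission
  imports Defs
begin

text \<open>Write \<open>\<Psi>(A) = K\<^sup>*(A \<otimes> I) K\<close>. Purity makes the Berezin kernel \<open>K\<close> an isometry, and
  \<open>K\<^sup>*(W\<^sub>\<alpha> \<otimes> I) = T\<^sub>\<alpha> K\<^sup>*\<close>, so on polynomials \<open>\<Psi>\<close> is the homomorphism \<open>W\<^sub>\<alpha> \<mapsto> T\<^sub>\<alpha>\<close>. The Abel means of the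
  Fourier series of an operator \<open>A\<close> of the Hardy algebra arise from \<open>A\<close> by a Schur multiplier, the Poisson
  kernel in the degrees; they are therefore bounded by \<open>\<parallel>A\<parallel>\<close> and converge strongly to \<open>A\<close>. Hence
  \<open>K\<^sup>*(A \<otimes> I) = \<Psi>(A) K\<^sup>*\<close> persists in the limit, which gives multiplicativity and the radial limit
  formula.\<close>

section \<open>Operators on complex Hilbert spaces\<close>

text \<open>An operator of the Hardy algebra need not be a norm limit of polynomials, and the
  partial sums of its Fourier series have no evident common bound, so multiplicativity does not pass
  from polynomials to it directly. Abel means help because of the grading by word length: such an
  operator never lowers the degree, so the one-sided weights r^(i-j) may be read as the positive
  definite Poisson kernel r^|i-j|. The classical argument averages over rotations of the degrees;
  here an explicit factorization of the kernel replaces the integral. The bounds for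
  \<open>A \<otimes> I\<close> and for operator matrices have one common source, a Gram matrix
  argument with the square root of \<open>\<parallel>M\<parallel>\<^sup>2 - M\<^sup>* M\<close>.
  This and the Berezin kernel are the two reasons for building square roots of positive operators so
  early. Sequential WOT continuity depends on Baire, through the norm boundedness of convergent
  sequences, and weak-star continuity on splitting a pulled-back functional into slices along the
  second tensor factor.\<close>

instance chilbert_space \<subseteq> banach ..

lemma scaleC_scaleR_commute: "c *\<^sub>C r *\<^sub>R x = r *\<^sub>R c *\<^sub>C (x::'a::complex_vector)"
  by (simp add: scaleR_scaleC scaleC_scaleC mult.commute)

lemma bounded_bilinear_cinner: "bounded_bilinear (cinner :: 'a::complex_inner \<Rightarrow> 'a \<Rightarrow> complex)"
proof
  show "\<exists>K. \<forall>x y :: 'a. norm (cinner x y) \<le> norm x * norm y * K"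
    using cinner_cauchy_schwarz by (intro exI[of _ 1]) auto
qed (simp_all add: cinner_add_left cinner_add_right scaleR_scaleC cinner_scaleC_left
      cinner_scaleC_right scaleC_complex_def)

interpretation cinner: bounded_bilinear "cinner :: 'a::complex_inner \<Rightarrow> 'a \<Rightarrow> complex"
  by (rule bounded_bilinear_cinner)

lemma cinner_scaleR_left: "cinner (r *\<^sub>R x) y = r *\<^sub>R cinner (x::'a::complex_inner) y"
  and cinner_scaleR_right: "cinner x (r *\<^sub>R y) = r *\<^sub>R cinner (x::'a::complex_inner) y"
  by (rule cinner.scaleR_left cinner.scaleR_right)+

lemma cinner_eqI: "(\<And>z. cinner x z = cinner y z) \<Longrightarrow> x = (y::'a::complex_inner)"
  by (metis cinner.diff_left cinner_self eq_iff_diff_eq_0 norm_eq_zero of_real_eq_0_iff power_eq_0_iff)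

lemma cinner_eqI': "(\<And>z. cinner z x = cinner z y) \<Longrightarrow> x = (y::'a::complex_inner)"
  by (rule cinner_eqI) (metis cinner_commute)

lemma norm_le_cinnerI:
  assumes "0 \<le> K" "\<And>y. cmod (cinner x y) \<le> K * norm y"
  shows "norm (x::'a::complex_inner) \<le> K"
proof (cases "x = 0")
  case False
  have "norm x * norm x \<le> K * norm x"
    using assms(2)[of x] by (simp add: cinner_self norm_mult power2_eq_square)
  thus ?thesis using False by simp
qed (use assms in auto)

lemma cblinfun_eqI: "(\<And>x. cblinfun_apply A x = cblinfun_apply B x) \<Longrightarrow> A = B"
  by (simp add: cblinfun_apply_inject[symmetric] fun_eq_iff)

lemma cblinfun_scaleC: "cblinfun_apply A (c *\<^sub>C x) = c *\<^sub>C A x"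
  using cblinfun_apply[of A] by simp

lemma norm_cblinfun: "norm (cblinfun_apply A x) \<le> norm A * norm x"
  unfolding norm_cblinfun.rep_eq by (rule onorm) (rule bounded_linear_cblinfun_apply)

lemma norm_cblinfun_bound:
  "0 \<le> K \<Longrightarrow> (\<And>x. norm (cblinfun_apply A x) \<le> K * norm x) \<Longrightarrow> norm A \<le> K"
  unfolding norm_cblinfun.rep_eq by (rule onorm_bound)

lemma ex_cblinfun:
  assumes "\<And>x y. f (x + y) = f x + f y" "\<And>c x. f (c *\<^sub>C x) = c *\<^sub>C f x"
    "\<And>x. norm (f x) \<le> norm x * K"
  shows "\<exists>A. cblinfun_apply A = f"
proof -
  have "bounded_linear f"
    using assms by (intro bounded_linear_intro[of f K]) (auto simp: scaleR_scaleC)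
  thus ?thesis
    using assms(2) by (intro exI[of _ "Abs_cblinfun f"]) (simp add: Abs_cblinfun_inverse)
qed

lemma bounded_bilinear_cblinfun_apply:
  "bounded_bilinear (cblinfun_apply :: ('a::complex_inner \<Rightarrow>\<^sub>B 'b::complex_inner) \<Rightarrow> 'a \<Rightarrow> 'b)"
proof
  fix A B :: "'a \<Rightarrow>\<^sub>B 'b" and x y r
  show "cblinfun_apply (A + B) x = A x + B x" by (simp add: plus_cblinfun.rep_eq)
  show "cblinfun_apply (r *\<^sub>R A) x = r *\<^sub>R A x" by (simp add: scaleR_cblinfun.rep_eq)
  show "cblinfun_apply A (x + y) = A x + A y" "cblinfun_apply A (r *\<^sub>R x) = r *\<^sub>R A x"
    by (simp_all add: linear_simps bounded_linear_cblinfun_apply)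
  show "\<exists>K. \<forall>(A::'a \<Rightarrow>\<^sub>B 'b) x. norm (cblinfun_apply A x) \<le> norm A * norm x * K"
    using norm_cblinfun by (intro exI[of _ 1]) auto
qed

interpretation capply: bounded_bilinear "cblinfun_apply :: ('a::complex_inner \<Rightarrow>\<^sub>B 'b::complex_inner) \<Rightarrow> 'a \<Rightarrow> 'b"
  by (rule bounded_bilinear_cblinfun_apply)

lemmas capply_simps [simp] = capply.add_left capply.add_right capply.diff_left capply.diff_right
  capply.minus_left capply.minus_right capply.zero_left capply.zero_right capply.scaleR_left
  capply.scaleR_right cblinfun_scaleC scaleC_cblinfun.rep_eq cblinfun_id.rep_eq
  cblinfun_compose.rep_eq

lemma norm_cblinfun_compose: "norm (A o\<^sub>C B) \<le> norm A * norm B"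
proof (rule norm_cblinfun_bound)
  fix x
  have "norm (A (B x)) \<le> norm A * norm (B x)" by (rule norm_cblinfun)
  also have "\<dots> \<le> norm A * (norm B * norm x)" by (intro mult_left_mono norm_cblinfun) auto
  finally show "norm ((A o\<^sub>C B) x) \<le> norm A * norm B * norm x" by (simp add: mult.assoc)
qed simp

lemma bounded_bilinear_cblinfun_compose:
  "bounded_bilinear ((o\<^sub>C) :: ('b::complex_inner \<Rightarrow>\<^sub>B 'c::complex_inner) \<Rightarrow> ('a::complex_inner \<Rightarrow>\<^sub>B 'b) \<Rightarrow> _)"
proof
  show "\<exists>K. \<forall>(A::'b \<Rightarrow>\<^sub>B 'c) (B::'a \<Rightarrow>\<^sub>B 'b). norm (A o\<^sub>C B) \<le> norm A * norm B * K"
    using norm_cblinfun_compose by (intro exI[of _ 1]) auto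
qed (auto intro!: cblinfun_eqI)

interpretation ccompose: bounded_bilinear
  "(o\<^sub>C) :: ('b::complex_inner \<Rightarrow>\<^sub>B 'c::complex_inner) \<Rightarrow> ('a::complex_inner \<Rightarrow>\<^sub>B 'b) \<Rightarrow> _"
  by (rule bounded_bilinear_cblinfun_compose)

lemma compose_scaleC_left: "(c *\<^sub>C A) o\<^sub>C B = c *\<^sub>C (A o\<^sub>C B)"
  and compose_scaleC_right: "A o\<^sub>C (c *\<^sub>C B) = c *\<^sub>C (A o\<^sub>C B)"
  and compose_assoc: "(A o\<^sub>C B) o\<^sub>C C = A o\<^sub>C (B o\<^sub>C C)"
  and compose_id_left [simp]: "cblinfun_id o\<^sub>C A = A"
  and compose_id_right [simp]: "A o\<^sub>C cblinfun_id = A"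
  by (auto intro!: cblinfun_eqI)

text \<open>Pointwise limits exist in the target, and \<open>close\<close> passes the Cauchy
  estimate to the limit uniformly on bounded sets. Completeness is what lets the square-root
  iteration and the Abel series converge in operator norm.\<close>

instance cblinfun :: (complex_inner, chilbert_space) banach
proof
  fix X :: "nat \<Rightarrow> 'a \<Rightarrow>\<^sub>B 'b"
  assume X: "Cauchy X"
  have dist_le: "dist (X m x) (X n x) \<le> dist (X m) (X n) * norm x" for m n x
    using norm_cblinfun[of "X m - X n" x] by (simp add: dist_norm)
  have "Cauchy (\<lambda>n. X n x)" for x
  proof (rule metric_CauchyI)
    fix e :: real assume e: "e > 0"
    \<comment> \<open>The summand 1 keeps the divisor positive at \<open>x = 0\<close>.\<close>
    then obtain N where N: "\<And>m n. m \<ge> N \<Longrightarrow> n \<ge> N \<Longrightarrow> dist (X m) (X n) < e / (norm x + 1)"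
      using X by (metis metric_CauchyD add_nonneg_pos divide_pos_pos norm_ge_zero zero_less_one)
    have "dist (X m x) (X n x) < e" if "m \<ge> N" "n \<ge> N" for m n
    proof -
      have "dist (X m x) (X n x) \<le> dist (X m) (X n) * (norm x + 1)"
        using dist_le[of m x n] by (simp add: algebra_simps) (smt (verit) zero_le_dist)
      also have "\<dots> < e"
        using N[OF that] by (smt (verit) norm_ge_zero pos_less_divide_eq)
      finally show ?thesis .
    qed
    thus "\<exists>M. \<forall>m\<ge>M. \<forall>n\<ge>M. dist (X m x) (X n x) < e" by blast
  qed
  then obtain f where f: "\<And>x. (\<lambda>n. X n x) \<longlonglongrightarrow> f x"
    unfolding Cauchy_convergent_iff convergent_def by metis
  have close: "norm (X m x - f x) \<le> e * norm x" if m: "\<And>n. n \<ge> m \<Longrightarrow> dist (X m) (X n) \<le> e" for m e x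
  proof (rule LIMSEQ_le_const2)
    show "(\<lambda>n. norm (X m x - X n x)) \<longlonglongrightarrow> norm (X m x - f x)"
      by (intro tendsto_intros f)
    show "\<exists>N. \<forall>n\<ge>N. norm (X m x - X n x) \<le> e * norm x"
      using m dist_le[of m x] by (metis dist_norm mult_right_mono norm_ge_zero order_trans)
  qed
  obtain M where M: "\<And>n. n \<ge> M \<Longrightarrow> dist (X M) (X n) \<le> 1"
    using X by (metis metric_CauchyD less_imp_le order_refl zero_less_one)
  have "\<exists>L. cblinfun_apply L = f"
  proof (rule ex_cblinfun)
    fix x y c
    show "f (x + y) = f x + f y"
      using tendsto_add[OF f[of x] f[of y]] f[of "x + y"] by (auto intro: LIMSEQ_unique)
    show "f (c *\<^sub>C x) = c *\<^sub>C f x"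
      using bounded_linear.tendsto[OF bounded_linear_scaleC f[of x]] f[of "c *\<^sub>C x"]
      by (auto intro: LIMSEQ_unique)
    show "norm (f x) \<le> norm x * (norm (X M) + 1)"
      using close[of M 1 x, OF M] norm_triangle_sub[of "f x" "X M x"] norm_cblinfun[of "X M" x]
      by (simp add: norm_minus_commute algebra_simps)
  qed
  then obtain L where L: "cblinfun_apply L = f" by blast
  have "X \<longlonglongrightarrow> L"
  proof (rule metric_LIMSEQ_I)
    fix e :: real assume e: "e > 0"
    then obtain N where N: "\<And>m n. m \<ge> N \<Longrightarrow> n \<ge> N \<Longrightarrow> dist (X m) (X n) < e / 2"
      using X by (metis metric_CauchyD half_gt_zero)
    have "dist (X m) L < e" if m: "m \<ge> N" for m
    proof -
      have "norm (X m - L) \<le> e / 2"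
        using e close[of m "e / 2"] N m by (intro norm_cblinfun_bound) (auto simp: L less_imp_le)
      thus ?thesis using e by (simp add: dist_norm)
    qed
    thus "\<exists>no. \<forall>n\<ge>no. dist (X n) L < e" by blast
  qed
  thus "convergent X" by (rule convergentI)
qed

section \<open>Riesz representation and adjoints\<close>

lemma Riesz_representation:
  fixes f :: "'a::chilbert_space \<Rightarrow> complex"
  assumes bl: "bounded_linear f" and sc: "\<And>c x. f (c *\<^sub>C x) = c * f x"
  shows "\<exists>z. \<forall>x. f x = cinner x z"
proof -
  interpret f: bounded_linear f by (rule bl)
  \<comment> \<open>If \<open>f\<close> is the inner product with \<open>z\<close>, then \<open>q x
    = \<parallel>x - z\<parallel>\<^sup>2 - \<parallel>z\<parallel>\<^sup>2\<close>; so the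
    representing vector is sought as a minimizer of \<open>q\<close>.\<close>
  define q where "q x = (norm x)\<^sup>2 - 2 * Re (f x)" for x
  obtain B where B: "\<And>x. norm (f x) \<le> norm x * B"
    using f.bounded by blast
  have "q x \<ge> - B\<^sup>2" for x
  proof -
    have "Re (f x) \<le> norm x * B"
      using B[of x] complex_Re_le_cmod[of "f x"] by linarith
    moreover have "0 \<le> (norm x - B)\<^sup>2" by simp
    ultimately show ?thesis
      unfolding q_def power2_diff by simp
  qed
  hence bdd: "bdd_below (range q)" by (auto intro!: bdd_belowI)
  define m where "m = Inf (range q)"
  have mle: "m \<le> q x" for x
    unfolding m_def using bdd by (simp add: cINF_lower)
  have "\<exists>x. q x < m + 1 / Suc n" for n
    using cInf_lessD[of "range q" "m + 1 / Suc n"] by (auto simp: m_def)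
  then obtain X where X: "\<And>n. q (X n) < m + 1 / Suc n" by metis
  \<comment> \<open>Parallelogram law together with \<open>m \<le> q\<close> at the midpoint:
    near-minimizers lie close together, so a minimizing sequence is Cauchy.\<close>
  have par: "(norm (x - y))\<^sup>2 \<le> 2 * (q x - m) + 2 * (q y - m)" for x y
  proof -
    have "(norm (x - y))\<^sup>2 + (norm (x + y))\<^sup>2 = 2 * (norm x)\<^sup>2 + 2 * (norm y)\<^sup>2"
      unfolding power2_norm_eq_inner
      by (simp add: inner_diff_left inner_diff_right inner_add_left inner_add_right inner_commute)
    moreover have "4 * q ((1/2) *\<^sub>R (x + y)) = (norm (x + y))\<^sup>2 - 4 * (Re (f x) + Re (f y))"
      unfolding q_def f.scaleR f.add norm_scaleR by (simp add: power_divide algebra_simps add_divide_distrib)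
    ultimately show ?thesis
      using mle[of "(1/2) *\<^sub>R (x + y)"] by (simp add: q_def)
  qed
  have "Cauchy X"
  proof (rule metric_CauchyI)
    fix e :: real assume e: "e > 0"
    obtain N where N: "1 / Suc N < e\<^sup>2 / 4"
      using reals_Archimedean[of "e\<^sup>2 / 4"] e by (auto simp: inverse_eq_divide)
    have "dist (X i) (X j) < e" if "i \<ge> N" "j \<ge> N" for i j
    proof -
      have small: "q (X i) - m < e\<^sup>2 / 4" if "i \<ge> N" for i
      proof -
        have "1 / real (Suc i) \<le> 1 / Suc N" using that by (simp add: frac_le)
        thus ?thesis using X[of i] N by linarith
      qed
      have "(norm (X i - X j))\<^sup>2 < e\<^sup>2"
        using par[of "X i" "X j"] small[OF that(1)] small[OF that(2)] by (simp add: field_simps)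
      thus ?thesis
        using e by (simp add: dist_norm power_less_imp_less_base)
    qed
    thus "\<exists>M. \<forall>i\<ge>M. \<forall>j\<ge>M. dist (X i) (X j) < e" by blast
  qed
  then obtain z where z: "X \<longlonglongrightarrow> z"
    unfolding Cauchy_convergent_iff convergent_def by blast
  have "(\<lambda>n. q (X n)) \<longlonglongrightarrow> q z"
    unfolding q_def by (intro tendsto_intros z f.tendsto)
  moreover have "(\<lambda>n. m + 1 / Suc n) \<longlonglongrightarrow> m + 0"
    by (intro tendsto_intros) (use lim_inverse_n' LIMSEQ_Suc in fastforce)
  ultimately have "q z \<le> m"
    using X by (intro LIMSEQ_le[of "\<lambda>n. q (X n)" "q z" "\<lambda>n. m + 1 / Suc n" m]) (auto intro: less_imp_le)
  hence qz: "q z \<le> q x" for x using mle[of x] by linarith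
  have re: "Re (f x) = inner x z" for x
  proof -
    define d where "d = inner x z - Re (f x)"
    define n where "n = (norm x)\<^sup>2"
    \<comment> \<open>A step against the derivative \<open>2 * d\<close> of \<open>q\<close> at
      \<open>z\<close> in direction \<open>x\<close>. The optimal length would divide by
      \<open>n\<close>; \<open>n + 1\<close> also covers \<open>x = 0\<close>.\<close>
    define t where "t = - d / (n + 1)"
    have n: "n \<ge> 0" by (simp add: n_def)
    have "q (z + t *\<^sub>R x) = q z + t\<^sup>2 * n + 2 * t * d"
      unfolding q_def d_def n_def f.add f.scaleR power2_norm_eq_inner
      by (simp add: inner_add_left inner_add_right inner_commute power2_eq_square algebra_simps)
    hence "0 \<le> t\<^sup>2 * n + 2 * t * d" using qz[of "z + t *\<^sub>R x"] by linarith
    also have "\<dots> = - (d\<^sup>2 * (n + 2)) / (n + 1)\<^sup>2"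
      using n by (simp add: t_def power2_eq_square divide_simps) (simp add: algebra_simps)
    finally have "d\<^sup>2 * (n + 2) \<le> 0"
      using n by (simp add: field_simps zero_le_divide_iff split: if_splits)
    hence "d = 0" using n by (simp add: mult_le_0_iff)
    thus ?thesis by (simp add: d_def)
  qed
  have "f x = cinner x z" for x
  proof (rule complex_eqI)
    show "Re (f x) = Re (cinner x z)"
      using re[of x] by (simp add: inner_eq_Re_cinner)
    \<comment> \<open>The imaginary part is the real part at \<open>- \<i> *\<^sub>C x\<close>,
      since \<open>Re (- \<i> * w) = Im w\<close>.\<close>
    show "Im (f x) = Im (cinner x z)"
      using re[of "(- \<i>) *\<^sub>C x"] unfolding sc inner_eq_Re_cinner cinner_scaleC_left by simp
  qed
  thus ?thesis by blast
qed

text \<open>Discharges the description in \<open>adj\<close>: the Riesz vectors for the single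
  \<open>y\<close> depend on \<open>y\<close> linearly and boundedly, and inner products separate
  points, so no other operator fits.\<close>

lemma cinner_adj_right: "cinner (cblinfun_apply A x) y = cinner x (adj A y)"
proof -
  have "\<exists>z. \<forall>x. cinner (A x) y = cinner x z" for y
    by (rule Riesz_representation)
      (auto intro: bounded_linear_compose[OF cinner.bounded_linear_left bounded_linear_cblinfun_apply]
        simp: cinner_scaleC_left)
  then obtain B where B: "\<And>x y. cinner (A x) y = cinner x (B y)" by metis
  have "\<exists>C. cblinfun_apply C = B"
  proof (rule ex_cblinfun)
    show "B (x + y) = B x + B y" for x y
      by (rule cinner_eqI') (simp add: B[symmetric] cinner_add_right)
    show "B (c *\<^sub>C x) = c *\<^sub>C B x" for c x
      by (rule cinner_eqI') (simp add: B[symmetric] cinner_scaleC_right)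
    show "norm (B y) \<le> norm y * norm A" for y
    proof (rule norm_le_cinnerI)
      fix z
      have "cmod (cinner (B y) z) = cmod (cinner (A z) y)"
        by (metis B cinner_commute complex_mod_cnj)
      also have "\<dots> \<le> norm (A z) * norm y" by (rule cinner_cauchy_schwarz)
      also have "\<dots> \<le> (norm A * norm z) * norm y" by (intro mult_right_mono norm_cblinfun) auto
      finally show "cmod (cinner (B y) z) \<le> norm y * norm A * norm z" by (simp add: ac_simps)
    qed simp
  qed
  then obtain C where C: "cblinfun_apply C = B" by blast
  have "adj A = C"
    unfolding adj_def
  proof (rule the_equality)
    show "\<forall>x y. cinner (A x) y = cinner x (C y)" by (simp add: B C)
    fix D assume "\<forall>x y. cinner (A x) y = cinner x (cblinfun_apply D y)"
    hence "cinner x (D y) = cinner x (C y)" for x y by (metis B C)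
    thus "D = C" by (metis (no_types) cblinfun_eqI cinner_eqI')
  qed
  thus ?thesis by (simp add: B C)
qed

lemma cinner_adj_left: "cinner (adj A x) y = cinner x (cblinfun_apply A y)"
  by (metis cinner_adj_right cinner_commute)

lemma adj_eqI: "(\<And>x y. cinner (cblinfun_apply A x) y = cinner x (cblinfun_apply B y)) \<Longrightarrow> adj A = B"
  by (metis cblinfun_eqI cinner_eqI' cinner_adj_right)

lemma norm_adj_le: "norm (adj A) \<le> norm A"
proof (rule norm_cblinfun_bound)
  show "norm (adj A x) \<le> norm A * norm x" for x
  proof (rule norm_le_cinnerI)
    fix y
    have "cmod (cinner (adj A x) y) \<le> norm x * norm (A y)"
      unfolding cinner_adj_left by (rule cinner_cauchy_schwarz)
    also have "\<dots> \<le> norm x * (norm A * norm y)" by (intro mult_left_mono norm_cblinfun) auto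
    finally show "cmod (cinner (adj A x) y) \<le> norm A * norm x * norm y" by (simp add: ac_simps)
  qed simp
qed simp

text \<open>Baire: the closed sets \<open>C n\<close> on which all maps are bounded by
  \<open>n\<close> cover the space, so one of them contains a ball.\<close>

lemma uniform_boundedness:
  fixes f :: "'i \<Rightarrow> 'a::banach \<Rightarrow> 'b::real_normed_vector"
  assumes bl: "\<And>i. bounded_linear (f i)" and pw: "\<And>x. \<exists>B. \<forall>i. norm (f i x) \<le> B"
  shows "\<exists>K\<ge>0. \<forall>i x. norm (f i x) \<le> K * norm x"
proof -
  define C where "C n = {x. \<forall>i. norm (f i x) \<le> real n}" for n
  have closed: "closed (C n)" for n
    unfolding C_def by (intro closed_Collect_all closed_Collect_le continuous_intros
        linear_continuous_on bl)
  have cover: "\<Union>(range C) = UNIV"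
  proof -
    have "\<exists>n. x \<in> C n" for x
    proof -
      obtain B where B: "\<forall>i. norm (f i x) \<le> B" using pw by blast
      obtain n where "B \<le> real n" using real_arch_simple by blast
      with B have "x \<in> C n" unfolding C_def using order_trans by blast
      thus ?thesis ..
    qed
    thus ?thesis by blast
  qed
  have "\<exists>n. euclidean interior_of (C n) \<noteq> {}"
  proof (rule ccontr)
    assume "\<nexists>n. euclidean interior_of (C n) \<noteq> {}"
    hence "Met_TC.mtopology interior_of \<Union>(range C) = ({} :: 'a set)"
      using closed by (intro Met_TC.metric_Baire_category_alt) (auto simp: complete_UNIV)
    thus False unfolding cover by (metis UNIV_not_empty interior_of_topspace mtopology_is_euclidean topspace_euclidean)
  qed
  then obtain n x0 where "x0 \<in> euclidean interior_of (C n)" by blast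
  then obtain U where "open U" "x0 \<in> U" "U \<subseteq> C n"
    unfolding interior_of_def by auto
  then obtain e where e: "e > 0" and sub: "cball x0 e \<subseteq> C n"
    by (meson open_contains_cball subset_trans)
  \<comment> \<open>Both \<open>x0\<close> and \<open>x0 + t *\<^sub>R x\<close> with
    \<open>t = e / norm x\<close> lie in the ball. Two values bounded by \<open>n\<close> differ by
    at most \<open>2 * n\<close>, and division by \<open>t\<close> gives the constant.\<close>
  have "norm (f i x) \<le> 2 * real n / e * norm x" for i x
  proof (cases "x = 0")
    case True
    thus ?thesis using linear_simps(3)[OF bl[of i]] by simp
  next
    case False
    interpret fi: bounded_linear "f i" by (rule bl)
    define t where "t = e / norm x"
    have t: "t > 0" using e False by (simp add: t_def)
    have "x0 + t *\<^sub>R x \<in> cball x0 e" "x0 \<in> cball x0 e"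
      using False e by (auto simp: dist_norm t_def)
    hence "norm (f i (x0 + t *\<^sub>R x)) \<le> n" "norm (f i x0) \<le> n"
      using sub unfolding C_def by (blast+)
    hence "norm (f i (x0 + t *\<^sub>R x) - f i x0) \<le> 2 * n"
      using norm_triangle_ineq4[of "f i (x0 + t *\<^sub>R x)" "f i x0"] by linarith
    hence "t * norm (f i x) \<le> 2 * n"
      using t by (simp add: fi.add fi.scaleR)
    thus ?thesis using False e by (simp add: t_def field_simps)
  qed
  thus ?thesis using e by (intro exI[of _ "2 * real n / e"]) auto
qed

text \<open>Formulated for real linear maps and the real span, so that it also covers
  conjugate-linear functionals such as \<open>\<lambda>y. cinner x y\<close>. It reduces limits on
  square-summable families to elementary tensors.\<close>

lemma tendsto_total_set:
  fixes f :: "'i \<Rightarrow> 'a::real_normed_vector \<Rightarrow> 'b::real_normed_vector"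
  assumes lin: "\<And>i. linear (f i)" and bd: "\<And>i x. norm (f i x) \<le> K * norm x"
    and g: "bounded_linear g" and S: "\<And>s. s \<in> S \<Longrightarrow> ((\<lambda>i. f i s) \<longlongrightarrow> g s) F"
    and x: "x \<in> closure (span S)"
  shows "((\<lambda>i. f i x) \<longlongrightarrow> g x) F"
proof -
  interpret g: bounded_linear g by (rule g)
  have span: "((\<lambda>i. f i s) \<longlongrightarrow> g s) F" if "s \<in> span S" for s
    using that
  proof (induction rule: span_induct_alt)
    case base
    show ?case by (simp add: linear_0[OF lin])
  next
    case (step c s y)
    thus ?case
      by (simp add: linear_add[OF lin] linear_cmul[OF lin] g.add g.scaleR tendsto_add tendsto_scaleR S)
  qed
  obtain B where B: "\<And>x. norm (g x) \<le> norm x * B" using g.bounded by blast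
  \<comment> \<open>\<open>K\<close> and \<open>B\<close> carry no sign condition, hence the
    absolute values; the 1 makes \<open>M\<close> positive.\<close>
  define M where "M = \<bar>K\<bar> + \<bar>B\<bar> + 1"
  show ?thesis
  proof (rule tendstoI)
    fix e :: real assume e: "e > 0"
    have M: "M > 0" by (simp add: M_def)
    obtain s where s: "s \<in> span S" "dist s x < e / (2 * M)"
      using x e M by (meson closure_approachable divide_pos_pos mult_pos_pos zero_less_numeral)
    have "\<forall>\<^sub>F i in F. dist (f i s) (g s) < e / 2"
      using span[OF s(1)] e by (intro tendstoD) auto
    thus "\<forall>\<^sub>F i in F. dist (f i x) (g x) < e"
    proof eventually_elim
      case (elim i)
      have "norm (f i x - f i s) \<le> \<bar>K\<bar> * norm (x - s)"
        using bd[of i "x - s"] by (simp add: linear_diff[OF lin]) (smt (verit) mult_right_mono norm_ge_zero)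
      moreover have "norm (g s - g x) \<le> \<bar>B\<bar> * norm (x - s)"
        using B[of "s - x"] by (simp add: g.diff norm_minus_commute) (smt (verit) mult.commute mult_right_mono norm_ge_zero)
      moreover have "norm (f i x - g x) \<le> norm (f i x - f i s) + norm (f i s - g s) + norm (g s - g x)"
        using norm_triangle_ineq[of "f i x - f i s" "f i s - g x"] norm_triangle_ineq[of "f i s - g s" "g s - g x"]
        by simp
      ultimately have "norm (f i x - g x) \<le> M * norm (x - s) + norm (f i s - g s)"
        using norm_ge_zero[of "x - s"] unfolding M_def distrib_right by linarith
      moreover have "M * norm (x - s) < e / 2"
        using s(2) M by (simp add: dist_norm norm_minus_commute field_simps)
      ultimately show ?case using elim by (simp add: dist_norm)
    qed
  qed
qed

section \<open>Square roots of positive operators\<close>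

declare ccompose.zero_left [simp] ccompose.zero_right [simp] cinner.zero_left [simp] cinner.zero_right [simp]

lemma pos_op_cinner: "pos_op A \<Longrightarrow> cinner (A x) x = complex_of_real (inner (A x) x)"
  by (simp add: pos_op_def complex_nonneg_Reals_iff inner_eq_Re_cinner complex_eq_iff)

lemma pos_op_inner: "pos_op A \<Longrightarrow> 0 \<le> inner (A x) x"
  by (simp add: pos_op_def complex_nonneg_Reals_iff inner_eq_Re_cinner)

text \<open>The sesquilinear defect \<open>E\<close> vanishes on the diagonal. Inserting
  \<open>x + y\<close> makes it antisymmetric, inserting \<open>\<i> *\<^sub>C x\<close> makes it
  symmetric, so it is zero.\<close>

lemma pos_op_selfadjoint:
  assumes "pos_op A"
  shows "cinner (A x) y = cinner x (A y)"
proof -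
  define E where "E x y = cinner (A x) y - cinner x (A y)" for x y
  have diag: "E x x = 0" for x
    unfolding E_def using pos_op_cinner[OF assms, of x] cinner_commute[of x "A x"] by simp
  have "E (x + y) (x + y) = E x x + E x y + E y x + E y y" for x y
    by (simp add: E_def cinner.add_left cinner.add_right)
  hence 1: "E x y = - E y x" for x y
    using diag[of x] diag[of y] diag[of "x + y"] by (simp add: eq_neg_iff_add_eq_0)
  have "E (\<i> *\<^sub>C x) y = \<i> * E x y" "E y (\<i> *\<^sub>C x) = - \<i> * E y x"
    by (simp_all add: E_def cinner_scaleC_left cinner_scaleC_right algebra_simps)
  hence "E x y = E y x"
    using 1[of "\<i> *\<^sub>C x" y] by simp
  hence "E x y = 0"
    using 1[of x y] by simp
  thus ?thesis by (simp add: E_def)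
qed

lemma pos_opI:
  fixes A :: "'a::chilbert_space \<Rightarrow>\<^sub>B 'a"
  assumes "\<And>x y. cinner (A x) y = cinner x (A y)" "\<And>x. 0 \<le> inner (A x) x"
  shows "pos_op A"
proof -
  have "Im (cinner (A x) x) = 0" for x
    using assms(1)[of x x] cinner_commute[of x "A x"] by (metis Reals_cnj_iff complex_is_Real_iff)
  thus ?thesis
    using assms(2) by (simp add: pos_op_def complex_nonneg_Reals_iff inner_eq_Re_cinner)
qed

text \<open>Polarization expresses \<open>4 * inner (R x) y\<close> through the quadratic form at
  \<open>x + y\<close> and \<open>x - y\<close>; positivity allows dropping the second.\<close>

lemma norm_pos_op_le_one:
  fixes R :: "'a::chilbert_space \<Rightarrow>\<^sub>B 'a"
  assumes "pos_op R" "\<And>x. inner (R x) x \<le> (norm x)\<^sup>2"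
  shows "norm R \<le> 1"
proof (rule norm_cblinfun_bound)
  fix x
  show "norm (R x) \<le> 1 * norm x"
  proof (cases "R x = 0 \<or> x = 0")
    case False
    \<comment> \<open>\<open>y\<close> has the direction of \<open>R x\<close> and the length of
      \<open>x\<close>, so the polarized bound becomes
      \<open>4 * norm x * norm (R x) \<le> (2 * norm x)\<^sup>2\<close>.\<close>
    define y where "y = (norm x / norm (R x)) *\<^sub>R R x"
    have y: "norm y = norm x" "inner (R x) y = norm x * norm (R x)"
      using False by (simp_all add: y_def power2_norm_eq_inner[symmetric] power2_eq_square)
    have "inner (R y) x = inner (R x) y"
      using pos_op_selfadjoint[OF assms(1)] by (metis inner_commute inner_eq_Re_cinner)
    hence "4 * inner (R x) y = inner (R (x + y)) (x + y) - inner (R (x - y)) (x - y)"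
      by (simp add: inner_add_left inner_add_right inner_diff_left inner_diff_right)
    also have "\<dots> \<le> (norm (x + y))\<^sup>2"
      using assms(2)[of "x + y"] pos_op_inner[OF assms(1), of "x - y"] by linarith
    also have "\<dots> \<le> (norm x + norm y)\<^sup>2"
      by (intro power_mono norm_triangle_ineq) auto
    finally show ?thesis
      using False y by (simp add: power2_eq_square)
  qed auto
qed simp

text \<open>For a contraction \<open>R\<close> the iteration \<open>S \<mapsto> (R + S\<^sup>2) / 2\<close> converges to \<open>1 - sqrt (1 - R)\<close>; its
  increments are dominated by those of the scalar iteration with \<open>R = 1\<close>.\<close>

primrec sqrt_iter :: "('a::complex_inner \<Rightarrow>\<^sub>B 'a) \<Rightarrow> nat \<Rightarrow> ('a \<Rightarrow>\<^sub>B 'a)"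
  where "sqrt_iter R 0 = 0"
  | "sqrt_iter R (Suc n) = (1/2) *\<^sub>R (R + (sqrt_iter R n o\<^sub>C sqrt_iter R n))"

primrec sqrt_iter_bound :: "nat \<Rightarrow> real"
  where "sqrt_iter_bound 0 = 0"
  | "sqrt_iter_bound (Suc n) = (1 + (sqrt_iter_bound n)\<^sup>2) / 2"

lemma sqrt_iter_bound: "0 \<le> sqrt_iter_bound n" "sqrt_iter_bound n \<le> 1"
  by (induction n) (auto simp: abs_square_le_1)

lemma sqrt_iter_bound_mono: "sqrt_iter_bound n \<le> sqrt_iter_bound (Suc n)"
proof -
  have "0 \<le> (1 - sqrt_iter_bound n)\<^sup>2" by simp
  thus ?thesis by (simp add: power2_diff)
qed

lemma sqrt_iter_commute:
  assumes "X o\<^sub>C R = R o\<^sub>C X"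
  shows "X o\<^sub>C sqrt_iter R n = sqrt_iter R n o\<^sub>C X"
proof (induction n)
  case (Suc n)
  have "X o\<^sub>C (sqrt_iter R n o\<^sub>C sqrt_iter R n) = sqrt_iter R n o\<^sub>C sqrt_iter R n o\<^sub>C X"
    by (metis Suc compose_assoc)
  thus ?case
    by (simp add: assms ccompose.add_left ccompose.add_right ccompose.scaleR_left ccompose.scaleR_right)
qed simp

lemma norm_sqrt_iter:
  assumes "norm R \<le> 1"
  shows "norm (sqrt_iter R n) \<le> sqrt_iter_bound n"
proof (induction n)
  case (Suc n)
  have "norm (R + (sqrt_iter R n o\<^sub>C sqrt_iter R n)) \<le> norm R + norm (sqrt_iter R n) * norm (sqrt_iter R n)"
    by (intro order_trans[OF norm_triangle_ineq] add_left_mono norm_cblinfun_compose)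
  also have "\<dots> \<le> 1 + sqrt_iter_bound n * sqrt_iter_bound n"
    by (intro add_mono mult_mono Suc assms) (auto simp: sqrt_iter_bound)
  finally show ?case by (simp add: power2_eq_square)
qed simp

text \<open>Iterates are polynomials in \<open>R\<close> and commute, so the difference of two
  squares factors; estimating the two factors reproduces the scalar recursion.\<close>

lemma norm_sqrt_iter_diff:
  assumes "norm R \<le> 1"
  shows "norm (sqrt_iter R (Suc n) - sqrt_iter R n) \<le> sqrt_iter_bound (Suc n) - sqrt_iter_bound n"
proof (induction n)
  case 0
  show ?case using assms by simp
next
  case (Suc n)
  let ?S = "sqrt_iter R n" and ?S' = "sqrt_iter R (Suc n)"
  let ?s = "sqrt_iter_bound n" and ?s' = "sqrt_iter_bound (Suc n)"
  have "?S o\<^sub>C ?S' = ?S' o\<^sub>C ?S"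
    by (intro sqrt_iter_commute sqrt_iter_commute[symmetric]) simp
  hence "sqrt_iter R (Suc (Suc n)) - ?S' = (1/2) *\<^sub>R ((?S' - ?S) o\<^sub>C (?S' + ?S))"
    by (simp add: ccompose.add_left ccompose.add_right ccompose.diff_left ccompose.diff_right
        algebra_simps del: sqrt_iter.simps(2)) (simp add: algebra_simps)
  also have "norm \<dots> \<le> (1/2) * (norm (?S' - ?S) * (norm ?S' + norm ?S))"
    unfolding norm_scaleR
    by (intro mult_mono order_trans[OF norm_cblinfun_compose] norm_triangle_ineq) auto
  also have "\<dots> \<le> (1/2) * ((?s' - ?s) * (?s' + ?s))"
    using Suc norm_sqrt_iter[OF assms] sqrt_iter_bound_mono
    by (intro mult_mono add_mono mult_nonneg_nonneg) (auto simp: sqrt_iter_bound simp del: sqrt_iter.simps sqrt_iter_bound.simps)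
  also have "\<dots> = sqrt_iter_bound (Suc (Suc n)) - ?s'"
    by (simp add: power2_eq_square field_simps)
  finally show ?case .
qed

text \<open>The limit of the iteration satisfies \<open>2 L = R + L\<^sup>2\<close>, that is
  \<open>(1 - L)\<^sup>2 = 1 - R\<close>. Commutation with all that commutes with \<open>R\<close>
  is recorded because uniqueness of the root depends on it.\<close>

lemma one_minus_sqrt_exists:
  fixes R :: "'a::chilbert_space \<Rightarrow>\<^sub>B 'a"
  assumes R: "pos_op R" "norm R \<le> 1"
  shows "\<exists>B. pos_op B \<and> B o\<^sub>C B = cblinfun_id - R \<and> (\<forall>X. X o\<^sub>C R = R o\<^sub>C X \<longrightarrow> X o\<^sub>C B = B o\<^sub>C X)"
proof -
  let ?S = "sqrt_iter R"
  have "convergent sqrt_iter_bound"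
    by (rule Bseq_mono_convergent[OF BseqI'[where K = 1]])
      (auto simp: sqrt_iter_bound intro!: lift_Suc_mono_le[of sqrt_iter_bound] sqrt_iter_bound_mono
        simp del: sqrt_iter_bound.simps)
  then obtain l where "sqrt_iter_bound \<longlonglongrightarrow> l"
    unfolding convergent_def by blast
  hence "summable (\<lambda>n. sqrt_iter_bound (Suc n) - sqrt_iter_bound n)"
    by (rule sums_summable[OF telescope_sums])
  hence "summable (\<lambda>n. ?S (Suc n) - ?S n)"
    by (rule summable_comparison_test'[where N = 0]) (rule norm_sqrt_iter_diff[OF R(2)])
  hence "(\<lambda>n. \<Sum>k<n. ?S (Suc k) - ?S k) \<longlonglongrightarrow> (\<Sum>n. ?S (Suc n) - ?S n)"
    by (rule summable_LIMSEQ)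
  then obtain L where L: "?S \<longlonglongrightarrow> L"
    unfolding sum_lessThan_telescope by auto
  have Lx: "(\<lambda>n. ?S n x) \<longlonglongrightarrow> L x" for x
    by (intro capply.tendsto L tendsto_const)
  have "(\<lambda>n. ?S (Suc n)) \<longlonglongrightarrow> (1/2) *\<^sub>R (R + (L o\<^sub>C L))"
    unfolding sqrt_iter.simps by (intro tendsto_intros ccompose.tendsto L)
  hence fix_eq: "L = (1/2) *\<^sub>R (R + (L o\<^sub>C L))"
    using LIMSEQ_Suc[OF L] LIMSEQ_unique by blast
  have norm_L: "norm L \<le> 1"
    using norm_sqrt_iter[OF R(2)] sqrt_iter_bound(2)
    by (intro LIMSEQ_le_const2[OF tendsto_norm[OF L]]) (meson order_trans)
  have comm: "X o\<^sub>C L = L o\<^sub>C X" if "X o\<^sub>C R = R o\<^sub>C X" for X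
  proof (rule LIMSEQ_unique)
    show "(\<lambda>n. X o\<^sub>C ?S n) \<longlonglongrightarrow> X o\<^sub>C L" by (intro ccompose.tendsto L tendsto_const)
    show "(\<lambda>n. X o\<^sub>C ?S n) \<longlonglongrightarrow> L o\<^sub>C X"
      unfolding sqrt_iter_commute[OF that] by (intro ccompose.tendsto L tendsto_const)
  qed
  have sa: "cinner (?S n x) y = cinner x (?S n y)" for n x y
    by (induction n arbitrary: x y)
      (simp_all add: cinner.add_left cinner.add_right cinner_scaleR_left cinner_scaleR_right
        cinner.zero_left cinner.zero_right pos_op_selfadjoint[OF R(1)])
  have saL: "cinner (L x) y = cinner x (L y)" for x y
  proof (rule LIMSEQ_unique)
    show "(\<lambda>n. cinner (?S n x) y) \<longlonglongrightarrow> cinner (L x) y" by (intro cinner.tendsto Lx tendsto_const)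
    show "(\<lambda>n. cinner (?S n x) y) \<longlonglongrightarrow> cinner x (L y)"
      unfolding sa by (intro cinner.tendsto Lx tendsto_const)
  qed
  define B where "B = cblinfun_id - L"
  have "pos_op B"
  proof (rule pos_opI)
    show "cinner (B x) y = cinner x (B y)" for x y
      by (simp add: B_def cinner.diff_left cinner.diff_right saL)
    fix x
    have "inner (L x) x \<le> norm (L x) * norm x" by (rule norm_cauchy_schwarz)
    also have "\<dots> \<le> norm x * norm x"
      using norm_cblinfun[of L x] norm_L mult_right_mono[OF norm_L, of "norm x"]
      by (intro mult_right_mono) auto
    finally show "0 \<le> inner (B x) x"
      by (simp add: B_def inner_diff_left power2_norm_eq_inner[symmetric] power2_eq_square)
  qed
  moreover have "B o\<^sub>C B = cblinfun_id - R"
  proof -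
    have "2 *\<^sub>R L = R + (L o\<^sub>C L)"
      by (subst fix_eq) simp
    thus ?thesis
      by (simp add: B_def ccompose.diff_left ccompose.diff_right algebra_simps scaleR_2)
  qed
  moreover have "X o\<^sub>C B = B o\<^sub>C X" if "X o\<^sub>C R = R o\<^sub>C X" for X
    using comm[OF that] by (simp add: B_def ccompose.diff_left ccompose.diff_right)
  ultimately show ?thesis by blast
qed

text \<open>For \<open>A \<noteq> 0\<close> the operator
  \<open>1 - A / \<parallel>A\<parallel>\<close> is a positive contraction, so
  \<open>one_minus_sqrt_exists\<close> applies to it; the factor \<open>sqrt n\<close> undoes the
  scaling.\<close>

lemma pos_sqrt_exists:
  assumes A: "pos_op A"
  shows "\<exists>B. pos_op B \<and> B o\<^sub>C B = A \<and> (\<forall>X. X o\<^sub>C A = A o\<^sub>C X \<longrightarrow> X o\<^sub>C B = B o\<^sub>C X)"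
proof (cases "A = 0")
  case True
  thus ?thesis using A by (intro exI[of _ 0]) (simp add: ccompose.zero_left ccompose.zero_right)
next
  case False
  define n where "n = norm A"
  have n: "n > 0" using False by (simp add: n_def)
  define R where "R = cblinfun_id - (1 / n) *\<^sub>R A"
  have "inner (A x) x \<le> n * (norm x)\<^sup>2" for x
  proof -
    have "inner (A x) x \<le> norm (A x) * norm x" by (rule norm_cauchy_schwarz)
    also have "\<dots> \<le> (n * norm x) * norm x"
      unfolding n_def by (intro mult_right_mono norm_cblinfun) auto
    finally show ?thesis by (simp add: power2_eq_square mult.assoc)
  qed
  hence "0 \<le> inner (R x) x" for x
    using n by (simp add: R_def inner_diff_left power2_norm_eq_inner[symmetric] field_simps)
  hence "pos_op R"
    by (intro pos_opI) (simp_all add: R_def cinner.diff_left cinner.diff_right cinner_scaleR_left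
        cinner_scaleR_right pos_op_selfadjoint[OF A])
  moreover have "norm R \<le> 1"
    using \<open>pos_op R\<close> n pos_op_inner[OF A]
    by (intro norm_pos_op_le_one) (simp_all add: R_def inner_diff_left power2_norm_eq_inner[symmetric])
  ultimately obtain B where B: "pos_op B" "B o\<^sub>C B = cblinfun_id - R"
    "\<And>X. X o\<^sub>C R = R o\<^sub>C X \<Longrightarrow> X o\<^sub>C B = B o\<^sub>C X"
    using one_minus_sqrt_exists by blast
  have sq: "sqrt n *\<^sub>R B o\<^sub>C sqrt n *\<^sub>R B = A"
    using n by (simp add: ccompose.scaleR_left ccompose.scaleR_right B(2) R_def)
  have pos: "pos_op (sqrt n *\<^sub>R B)"
    using B(1) n by (intro pos_opI) (simp_all add: cinner_scaleR_left cinner_scaleR_right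
        pos_op_selfadjoint pos_op_inner)
  have "X o\<^sub>C (sqrt n *\<^sub>R B) = sqrt n *\<^sub>R B o\<^sub>C X" if "X o\<^sub>C A = A o\<^sub>C X" for X
  proof -
    have "X o\<^sub>C R = R o\<^sub>C X"
      using that by (simp add: R_def ccompose.diff_left ccompose.diff_right ccompose.scaleR_left ccompose.scaleR_right)
    thus ?thesis by (simp add: B(3) ccompose.scaleR_left ccompose.scaleR_right)
  qed
  with sq pos show ?thesis by blast
qed

text \<open>The form at \<open>x\<close> is the squared norm of \<open>B x\<close> for a positive
  root \<open>B\<close> of \<open>A\<close>.\<close>

lemma pos_op_inner_eq_0:
  assumes "pos_op A" "inner (A x) x = 0"
  shows "A x = 0"
proof -
  obtain B where B: "pos_op B" "B o\<^sub>C B = A" using pos_sqrt_exists[OF assms(1)] by blast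
  have "inner (A x) x = inner (B x) (B x)"
    using pos_op_selfadjoint[OF B(1), of "B x" x] unfolding B(2)[symmetric] inner_eq_Re_cinner by simp
  hence "B x = 0" using assms(2) by simp
  thus ?thesis unfolding B(2)[symmetric] by simp
qed

text \<open>With \<open>y = B x - C x\<close>, commutation gives \<open>B y + C y = 0\<close>. Both
  forms are nonnegative, so \<open>B y = C y = 0\<close>, and then
  \<open>cinner y y = cinner (B y - C y) x\<close> vanishes.\<close>

lemma pos_sqrt_unique:
  assumes B: "pos_op B" "B o\<^sub>C B = A" and C: "pos_op C" "C o\<^sub>C C = A" and BC: "B o\<^sub>C C = C o\<^sub>C B"
  shows "B = C"
proof (rule cblinfun_eqI)
  fix x
  define y where "y = B x - C x"
  have "B (C z) = C (B z)" "B (B z) = C (C z)" for z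
    using BC B(2) C(2) by (metis cblinfun_compose.rep_eq)+
  hence "B y + C y = 0" by (simp add: y_def)
  hence "inner (B y) y + inner (C y) y = 0"
    by (metis inner_add_left inner_zero_left)
  hence "inner (B y) y = 0" "inner (C y) y = 0"
    using pos_op_inner[OF B(1), of y] pos_op_inner[OF C(1), of y] by linarith+
  hence "B y = 0" "C y = 0"
    using pos_op_inner_eq_0 B(1) C(1) by blast+
  moreover have "cinner y y = cinner (B y - C y) x"
    by (subst (2) y_def) (simp add: cinner.diff_left cinner.diff_right pos_op_selfadjoint B(1) C(1))
  ultimately have "cinner y y = 0" by (simp add: cinner.zero_left)
  thus "B x = C x" by (simp add: y_def cinner_self)
qed

text \<open>A competing root \<open>C\<close> commutes with its square \<open>A\<close>, hence with
  the constructed \<open>B\<close>; so the description in \<open>op_sqrt\<close> has exactly one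
  solution.\<close>

lemma op_sqrt:
  assumes "pos_op A"
  shows "pos_op (op_sqrt A)" "op_sqrt A o\<^sub>C op_sqrt A = A"
proof -
  obtain B where B: "pos_op B" "B o\<^sub>C B = A" "\<And>X. X o\<^sub>C A = A o\<^sub>C X \<Longrightarrow> X o\<^sub>C B = B o\<^sub>C X"
    using pos_sqrt_exists[OF assms] by blast
  have "op_sqrt A = B"
    unfolding op_sqrt_def
  proof (rule the_equality)
    fix C assume C: "pos_op C \<and> C o\<^sub>C C = A"
    hence "C o\<^sub>C A = A o\<^sub>C C" using compose_assoc[of C C C] by simp
    hence "C o\<^sub>C B = B o\<^sub>C C" by (rule B(3))
    with C B(1,2) show "C = B" by (intro pos_sqrt_unique[of C A B]) auto
  qed (simp add: B(1,2))
  with B(1,2) show "pos_op (op_sqrt A)" "op_sqrt A o\<^sub>C op_sqrt A = A" by simp_all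
qed

text \<open>The Schur product of two Gram matrices is positive: with \<open>C = (\<parallel>M\<parallel>\<^sup>2 - M\<^sup>* M)\<^sup>1\<^sup>/\<^sup>2\<close> the squared norms of
  \<open>\<Sum> M e\<^sub>p \<otimes> h\<^sub>p\<close> and \<open>\<Sum> C e\<^sub>p \<otimes> h\<^sub>p\<close> add up to the right-hand side.\<close>

lemma tensor_contraction:
  fixes M :: "'e::chilbert_space \<Rightarrow>\<^sub>B 'f::chilbert_space"
    and \<tau> :: "'e \<Rightarrow> 'h::complex_inner \<Rightarrow> 'g::complex_inner"
    and \<tau>' :: "'f \<Rightarrow> 'h \<Rightarrow> 'k::complex_inner"
  assumes \<tau>: "\<And>e h e' h'. cinner (\<tau> e h) (\<tau> e' h') = cinner e e' * cinner h h'"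
    and \<tau>': "\<And>e h e' h'. cinner (\<tau>' e h) (\<tau>' e' h') = cinner e e' * cinner h h'"
  shows "norm (\<Sum>p\<in>P. \<tau>' (M (e p)) (h p)) \<le> norm M * norm (\<Sum>p\<in>P. \<tau> (e p) (h p))"
proof -
  define D where "D = (norm M)\<^sup>2 *\<^sub>R cblinfun_id - (adj M o\<^sub>C M)"
  have D: "cinner (D x) y = (norm M)\<^sup>2 *\<^sub>R cinner x y - cinner (M x) (M y)" for x y
    by (simp add: D_def cinner.diff_left cinner_adj_left cinner_scaleR_left)
  have "pos_op D"
  proof (rule pos_opI)
    show "cinner (D x) y = cinner x (D y)" for x y
      unfolding D by (subst (3) cinner_commute)
        (simp add: D complex_cnj_diff cinner_commute[of x y] cinner_commute[of "M x" "M y"])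
    fix x
    have "(norm (M x))\<^sup>2 \<le> (norm M * norm x)\<^sup>2" by (intro power_mono norm_cblinfun) auto
    thus "0 \<le> inner (D x) x"
      by (simp add: inner_eq_Re_cinner D cinner_self power_mult_distrib Re_power_real)
  qed
  define C where "C = op_sqrt D"
  have C: "cinner (C x) (C y) = cinner (D x) y" for x y
    using op_sqrt[OF \<open>pos_op D\<close>] pos_op_selfadjoint[OF op_sqrt(1)[OF \<open>pos_op D\<close>], of "C x" y]
    unfolding C_def by (metis cblinfun_compose.rep_eq)
  let ?X = "\<Sum>p\<in>P. \<tau> (e p) (h p)" and ?Y = "\<Sum>p\<in>P. \<tau>' (M (e p)) (h p)" and ?Z = "\<Sum>p\<in>P. \<tau> (C (e p)) (h p)"
  have "cinner ?Y ?Y + cinner ?Z ?Z = (norm M)\<^sup>2 *\<^sub>R cinner ?X ?X"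
    by (simp add: cinner.sum_left cinner.sum_right \<tau> \<tau>' C D scaleR_sum_right sum.distrib[symmetric] algebra_simps)
  hence "complex_of_real ((norm ?Y)\<^sup>2 + (norm ?Z)\<^sup>2) = complex_of_real ((norm M * norm ?X)\<^sup>2)"
    by (simp add: cinner_self scaleR_conv_of_real power_mult_distrib)
  hence "(norm ?Y)\<^sup>2 + (norm ?Z)\<^sup>2 = (norm M * norm ?X)\<^sup>2"
    using of_real_eq_iff by blast
  hence "(norm ?Y)\<^sup>2 \<le> (norm M * norm ?X)\<^sup>2"
    using zero_le_power2[of "norm ?Z"] by linarith
  thus ?thesis by (rule power2_le_imp_le) simp
qed

section \<open>Square-summable families and ampliations\<close>

lemmas l2_nth_simps [simp] = zero_l2.rep_eq plus_l2.rep_eq uminus_l2.rep_eq minus_l2.rep_eq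
  scaleC_l2.rep_eq scaleR_l2.rep_eq tensor.rep_eq l2_basis.rep_eq

lemma l2_eqI: "(\<And>i. l2_nth f i = l2_nth g i) \<Longrightarrow> f = g"
  by (simp add: l2_nth_inject[symmetric] fun_eq_iff)

lemma bounded_linear_l2_nth: "bounded_linear (\<lambda>f. l2_nth f i)"
  by (rule bounded_linear_intro[where K = 1]) (auto simp: norm_l2_nth_le)

lemma l2_nth_sum [simp]: "l2_nth (\<Sum>k\<in>K. f k) i = (\<Sum>k\<in>K. l2_nth (f k) i)"
  by (induction K rule: infinite_finite_induct) auto

lemma cinner_tensor_right: "cinner F (tensor f h) = (\<Sum>\<^sub>\<infinity>i. cnj (l2_nth f i) * cinner (l2_nth F i) h)"
  by (simp add: cinner_l2_def cinner_scaleC_right)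

lemma cinner_tensor: "cinner (tensor f h) (tensor f' h') = cinner f f' * cinner h h'"
proof -
  have "cinner (tensor f h) (tensor f' h') = (\<Sum>\<^sub>\<infinity>i. cinner (l2_nth f i) (l2_nth f' i) * cinner h h')"
    by (simp add: cinner_l2_def cinner_scaleC_right cinner_scaleC_left cinner_complex_def ac_simps)
  also have "\<dots> = cinner f f' * cinner h h'"
    unfolding cinner_l2_def by (rule infsum_cmult_left') 
  finally show ?thesis .
qed

lemma norm_tensor: "norm (tensor f h) = norm f * norm h"
proof -
  have "complex_of_real ((norm (tensor f h))\<^sup>2) = complex_of_real ((norm f * norm h)\<^sup>2)"
    unfolding cinner_self[symmetric] cinner_tensor power_mult_distrib by (simp add: cinner_self)
  hence "(norm (tensor f h))\<^sup>2 = (norm f * norm h)\<^sup>2"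
    using of_real_eq_iff by blast
  thus ?thesis by (simp add: power2_eq_iff_nonneg)
qed

lemma bounded_bilinear_tensor: "bounded_bilinear (tensor :: ('i, complex) l2 \<Rightarrow> 'a::complex_inner \<Rightarrow> _)"
proof
  show "\<exists>K. \<forall>(f :: ('i, complex) l2) (h :: 'a). norm (tensor f h) \<le> norm f * norm h * K"
    by (intro exI[of _ 1]) (simp add: norm_tensor)
qed (auto intro!: l2_eqI simp: scaleC_add_left scaleC_add_right scaleC_scaleR_commute
      scaleR_scaleC scaleC_scaleC scaleC_complex_def ac_simps)

interpretation tensor: bounded_bilinear "tensor :: ('i, complex) l2 \<Rightarrow> 'a::complex_inner \<Rightarrow> _"
  by (rule bounded_bilinear_tensor)

lemma tensor_scaleC_left: "tensor (c *\<^sub>C f) h = c *\<^sub>C tensor f h"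
  and tensor_scaleC_right: "tensor f (c *\<^sub>C h) = c *\<^sub>C tensor f h"
  by (auto intro!: l2_eqI simp: scaleC_scaleC scaleC_complex_def ac_simps)

lemma tensor_complex: "tensor f c = c *\<^sub>C f"
  by (auto intro!: l2_eqI simp: scaleC_complex_def)

lemma cinner_tensor_basis: "cinner F (tensor (l2_basis i) h) = cinner (l2_nth F i) h"
proof -
  have "cinner F (tensor (l2_basis i) h) = (\<Sum>\<^sub>\<infinity>j\<in>{i}. cinner (l2_nth F j) h)"
    unfolding cinner_tensor_right by (rule infsum_cong_neutral) auto
  thus ?thesis by simp
qed

lemma cinner_l2_basis: "cinner f (l2_basis i) = l2_nth f i"
  using cinner_tensor_basis[of f i 1] by (simp add: tensor_complex cinner_complex_def)

lemma norm_sum_tensor_basis: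
  assumes "finite J"
  shows "(norm (\<Sum>j\<in>J. tensor (l2_basis j) (G j)))\<^sup>2 = (\<Sum>j\<in>J. (norm (G j))\<^sup>2)"
proof -
  let ?S = "\<Sum>j\<in>J. tensor (l2_basis j) (G j)"
  have nth: "l2_nth ?S i = (if i \<in> J then G i else 0)" for i
  proof -
    have "l2_nth ?S i = (\<Sum>j\<in>J. if j = i then G i else 0)"
      by (simp, rule sum.cong) auto
    thus ?thesis using assms by simp
  qed
  have "(norm ?S)\<^sup>2 = (\<Sum>\<^sub>\<infinity>j\<in>J. (norm (G j))\<^sup>2)"
    unfolding norm_l2_power2 by (rule infsum_cong_neutral) (auto simp: nth simp del: l2_nth_sum)
  thus ?thesis using assms by simp
qed

text \<open>By Pythagoras the squared error of a finite section is exactly the tail of the series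
  for \<open>\<parallel>F\<parallel>\<^sup>2\<close>.\<close>

lemma l2_has_sum_basis:
  fixes F :: "('i, 'a::complex_inner) l2"
  shows "((\<lambda>i. tensor (l2_basis i) (l2_nth F i)) has_sum F) UNIV"
proof -
  let ?S = "\<lambda>J. \<Sum>i\<in>J. tensor (l2_basis i) (l2_nth F i)"
  have eq: "(norm (?S J - F))\<^sup>2 = (norm F)\<^sup>2 - (\<Sum>i\<in>J. (norm (l2_nth F i))\<^sup>2)" if "finite J" for J
  proof -
    have "cinner F (?S J) = complex_of_real (\<Sum>i\<in>J. (norm (l2_nth F i))\<^sup>2)"
      by (simp add: cinner.sum_right cinner_tensor_basis cinner_self)
    hence "inner F (?S J) = (\<Sum>i\<in>J. (norm (l2_nth F i))\<^sup>2)"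
      by (simp add: inner_eq_Re_cinner)
    moreover have "(norm (?S J - F))\<^sup>2 = (norm (?S J))\<^sup>2 - 2 * inner F (?S J) + (norm F)\<^sup>2"
      unfolding power2_norm_eq_inner by (simp add: inner_diff_left inner_diff_right inner_commute)
    ultimately show ?thesis
      using that by (simp add: norm_sum_tensor_basis)
  qed
  have "((\<lambda>J. (norm F)\<^sup>2 - (\<Sum>i\<in>J. (norm (l2_nth F i))\<^sup>2)) \<longlongrightarrow> (norm F)\<^sup>2 - (norm F)\<^sup>2) (finite_subsets_at_top UNIV)"
    using has_sum_infsum[OF l2_summable[of F]] unfolding norm_l2_power2[symmetric] has_sum_def
    by (intro tendsto_intros)
  hence "((\<lambda>J. sqrt ((norm F)\<^sup>2 - (\<Sum>i\<in>J. (norm (l2_nth F i))\<^sup>2))) \<longlongrightarrow> 0) (finite_subsets_at_top UNIV)"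
    using tendsto_real_sqrt by fastforce
  hence "((\<lambda>J. norm (?S J - F)) \<longlongrightarrow> 0) (finite_subsets_at_top UNIV)"
    by (rule Lim_transform_eventually)
      (auto intro!: eventually_finite_subsets_at_top_weakI simp: eq[symmetric])
  thus ?thesis
    unfolding has_sum_def using Lim_null tendsto_norm_zero_iff by blast
qed

text \<open>As \<open>h\<close> ranges over a complex space, the real span of this set is already a
  complex subspace.\<close>

definition elementary_tensors :: "('i, 'a::complex_inner) l2 set"
  where "elementary_tensors = {tensor (l2_basis i) h |i h. True}"

lemma dense_elementary_tensors: "F \<in> closure (span elementary_tensors)"
proof (rule Lim_in_closed_set)
  show "((\<lambda>J. \<Sum>i\<in>J. tensor (l2_basis i) (l2_nth F i)) \<longlongrightarrow> F) (finite_subsets_at_top UNIV)"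
    using l2_has_sum_basis[of F] unfolding has_sum_def .
  have "(\<Sum>i\<in>J. tensor (l2_basis i) (l2_nth F i)) \<in> span elementary_tensors" for J
    by (intro span_sum span_base) (auto simp: elementary_tensors_def)
  thus "\<forall>\<^sub>F J in finite_subsets_at_top UNIV.
      (\<Sum>i\<in>J. tensor (l2_basis i) (l2_nth F i)) \<in> closure (span elementary_tensors)"
    by (intro always_eventually allI subsetD[OF closure_subset])
qed auto

lemma l2_tendsto:
  fixes f :: "'k \<Rightarrow> ('i, 'a::complex_inner) l2 \<Rightarrow> 'b::real_normed_vector"
  assumes "\<And>k. linear (f k)" "\<And>k x. norm (f k x) \<le> K * norm x" "bounded_linear g"
    and "\<And>i h. ((\<lambda>k. f k (tensor (l2_basis i) h)) \<longlongrightarrow> g (tensor (l2_basis i) h)) F"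
  shows "((\<lambda>k. f k x) \<longlongrightarrow> g x) F"
  by (rule tendsto_total_set[OF assms(1-3) _ dense_elementary_tensors])
    (use assms(4) in \<open>auto simp: elementary_tensors_def\<close>)

lemma l2_cblinfun_eqI:
  fixes A B :: "('i, 'a::complex_inner) l2 \<Rightarrow>\<^sub>B 'b::complex_inner"
  assumes "\<And>i h. cblinfun_apply A (tensor (l2_basis i) h) = cblinfun_apply B (tensor (l2_basis i) h)"
  shows "A = B"
proof (rule cblinfun_eqI)
  fix F
  show "A F = B F"
    using has_sum_bounded_linear[OF bounded_linear_cblinfun_apply[of A] l2_has_sum_basis[of F]]
      has_sum_bounded_linear[OF bounded_linear_cblinfun_apply[of B] l2_has_sum_basis[of F]]
    unfolding assms by (rule has_sum_unique)
qed

lemma fock_cblinfun_eqI: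
  fixes A B :: "('i, complex) l2 \<Rightarrow>\<^sub>B 'b::complex_inner"
  assumes "\<And>i. cblinfun_apply A (l2_basis i) = cblinfun_apply B (l2_basis i)"
  shows "A = B"
  by (rule l2_cblinfun_eqI) (simp add: tensor_complex assms)

text \<open>The bound is asked for on every finite set, hence on differences of finite sets, so the
  Cauchy property of the sums of \<open>g\<close> carries over to \<open>f\<close>. This extends
  operators from a basis: the expansion of a vector converges unconditionally but in general not
  absolutely.\<close>

lemma has_sum_dominated:
  fixes f :: "'i \<Rightarrow> 'a::banach" and g :: "'i \<Rightarrow> 'b::real_normed_vector"
  assumes le: "\<And>J. finite J \<Longrightarrow> norm (sum f J) \<le> K * norm (sum g J)" and g: "(g has_sum L) UNIV"
  shows "f summable_on UNIV" "norm (infsum f UNIV) \<le> K * norm L"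
proof -
  have "\<exists>P. eventually P (finite_subsets_at_top UNIV) \<and>
      (\<forall>F F'. P F \<and> P F' \<longrightarrow> dist (sum f F) (sum f F') < e)" if "e > 0" for e
  proof -
    \<comment> \<open>\<open>F - F'\<close> is the difference of \<open>F \<union> F'\<close> and
      \<open>F'\<close>, two sets beyond \<open>F0\<close>, which costs \<open>2 * d\<close>. Two
      such differences occur below, so each may take \<open>e / 2\<close>.\<close>
    define d where "d = e / (4 * (\<bar>K\<bar> + 1))"
    have d: "d > 0" using that by (simp add: d_def)
    have "\<forall>\<^sub>F F in finite_subsets_at_top UNIV. dist (sum g F) L < d"
      using g d unfolding has_sum_def by (rule tendstoD)
    then obtain F0 where F0: "finite F0" "\<And>F. finite F \<Longrightarrow> F0 \<subseteq> F \<Longrightarrow> dist (sum g F) L < d"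
      unfolding eventually_finite_subsets_at_top by auto
    have small: "norm (sum f (F - F')) < e / 2" if "finite F" "finite F'" "F0 \<subseteq> F'" for F F'
    proof -
      have "sum g (F - F') = sum g (F \<union> F') - sum g F'"
        using that by (simp add: sum_diff[symmetric] Un_Diff)
      hence "norm (sum g (F - F')) < 2 * d"
        using dist_triangle2[of "sum g (F \<union> F')" "sum g F'" L] F0(2)[of F'] F0(2)[of "F \<union> F'"] that
        by (simp add: dist_norm le_supI2)
      hence "(\<bar>K\<bar> + 1) * norm (sum g (F - F')) < (\<bar>K\<bar> + 1) * (2 * d)"
        by (intro mult_strict_left_mono) auto
      moreover have "K * norm (sum g (F - F')) \<le> (\<bar>K\<bar> + 1) * norm (sum g (F - F'))"
        by (intro mult_right_mono) auto
      moreover have "(\<bar>K\<bar> + 1) * (2 * d) = e / 2"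
        by (simp add: d_def field_simps)
      ultimately show ?thesis
        using le[of "F - F'"] that by simp
    qed
    show ?thesis
    proof (intro exI conjI allI impI)
      show "\<forall>\<^sub>F F in finite_subsets_at_top UNIV. finite F \<and> F0 \<subseteq> F"
        unfolding eventually_finite_subsets_at_top using F0(1) by blast
      fix F F' assume FF: "(finite F \<and> F0 \<subseteq> F) \<and> (finite F' \<and> F0 \<subseteq> F')"
      have "sum f F - sum f F' = sum f (F - F') - sum f (F' - F)"
        using sum.Int_Diff[of F f F'] sum.Int_Diff[of F' f F] FF by (simp add: Int_commute)
      hence "norm (sum f F - sum f F') \<le> norm (sum f (F - F')) + norm (sum f (F' - F))"
        by (metis norm_triangle_ineq4)
      also have "\<dots> < e / 2 + e / 2"
        using FF by (intro add_strict_mono small) auto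
      finally show "dist (sum f F) (sum f F') < e"
        by (simp add: dist_norm)
    qed
  qed
  hence "cauchy_filter (filtermap (sum f) (finite_subsets_at_top UNIV))"
    by (simp add: cauchy_filter_metric_filtermap)
  moreover have "complete (UNIV::'a set)"
    by (rule complete_UNIV)
  ultimately obtain S where S: "(sum f \<longlongrightarrow> S) (finite_subsets_at_top UNIV)"
    using complete_uniform[where S=UNIV] by (force simp add: filterlim_def)
  thus "f summable_on UNIV"
    unfolding summable_on_def has_sum_def by blast
  have "infsum f UNIV = S"
    using S by (intro infsumI) (simp add: has_sum_def)
  moreover have "norm S \<le> K * norm L"
    using S g unfolding has_sum_def
    by (intro tendsto_le[OF _ tendsto_mult[OF tendsto_const tendsto_norm] tendsto_norm])
      (auto intro!: eventually_finite_subsets_at_top_weakI le)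
  ultimately show "norm (infsum f UNIV) \<le> K * norm L" by simp
qed

text \<open>The values on \<open>tensor (l2_basis j) h\<close> force the formula for
  \<open>b\<close>. Its finite sums are controlled by \<open>tensor_contraction\<close>, with
  \<open>tensor\<close> in both roles, and \<open>has_sum_dominated\<close> passes to the limit with
  the same constant.\<close>

lemma ampliation_exists:
  fixes A :: "('i, complex) l2 \<Rightarrow>\<^sub>B ('i, complex) l2"
  shows "\<exists>B :: ('i, 'a::chilbert_space) l2 \<Rightarrow>\<^sub>B ('i, 'a) l2.
    (\<forall>f h. cblinfun_apply B (tensor f h) = tensor (A f) h) \<and> norm B \<le> norm A"
proof -
  define b where "b F = (\<Sum>\<^sub>\<infinity>j. tensor (A (l2_basis j)) (l2_nth F j))" for F :: "('i, 'a) l2"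
  have le: "norm (\<Sum>j\<in>J. tensor (A (l2_basis j)) (l2_nth F j)) \<le>
      norm A * norm (\<Sum>j\<in>J. tensor (l2_basis j) (l2_nth F j))" if "finite J" for J and F :: "('i, 'a) l2"
    by (rule tensor_contraction) (rule cinner_tensor)+
  note dom = has_sum_dominated[OF le l2_has_sum_basis]
  have "\<exists>B. cblinfun_apply B = b"
  proof (rule ex_cblinfun)
    show "b (F + G) = b F + b G" for F G
      unfolding b_def by (simp add: tensor.add_right infsum_add dom(1))
    show "b (c *\<^sub>C F) = c *\<^sub>C b F" for c F
      unfolding b_def l2_nth_simps tensor_scaleC_right
      by (intro infsumI has_sum_bounded_linear[OF bounded_linear_scaleC] has_sum_infsum dom(1))
    show "norm (b F) \<le> norm F * norm A" for F
      using dom(2)[of F] by (simp add: b_def mult.commute)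
  qed
  then obtain B where B: "cblinfun_apply B = b" by blast
  have "B (tensor f h) = tensor (A f) h" for f h
  proof -
    have "((\<lambda>j. l2_nth f j *\<^sub>C l2_basis j) has_sum f) UNIV"
      using l2_has_sum_basis[of f] by (simp add: tensor_complex)
    hence "((\<lambda>j. tensor (A (l2_nth f j *\<^sub>C l2_basis j)) h) has_sum tensor (A f) h) UNIV"
      by (rule has_sum_bounded_linear[OF bounded_linear_compose[OF tensor.bounded_linear_left bounded_linear_cblinfun_apply]])
    thus ?thesis
      unfolding B b_def by (intro infsumI) (simp add: tensor_scaleC_left tensor_scaleC_right)
  qed
  moreover have "norm B \<le> norm A"
    using dom(2) by (intro norm_cblinfun_bound) (auto simp: B b_def)
  ultimately show ?thesis by blast
qed

lemma ampliation:
  fixes h :: "'a::chilbert_space"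
  shows ampliation_tensor [simp]: "ampliation A (tensor f h) = tensor (A f) h"
    and norm_ampliation: "norm (ampliation A :: ('i, 'a) l2 \<Rightarrow>\<^sub>B _) \<le> norm A"
proof -
  obtain B :: "('i, 'a) l2 \<Rightarrow>\<^sub>B ('i, 'a) l2"
    where B: "\<And>f h. cblinfun_apply B (tensor f h) = tensor (A f) h" "norm B \<le> norm A"
    using ampliation_exists[of A] by blast
  have "(ampliation A :: ('i, 'a) l2 \<Rightarrow>\<^sub>B ('i, 'a) l2) = B"
    unfolding ampliation_def
  proof (rule the_equality)
    fix C :: "('i, 'a) l2 \<Rightarrow>\<^sub>B ('i, 'a) l2"
    assume "\<forall>f h. cblinfun_apply C (tensor f h) = tensor (A f) h"
    thus "C = B" by (intro l2_cblinfun_eqI) (simp add: B)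
  qed (simp add: B)
  with B show "ampliation A (tensor f h) = tensor (A f) h"
    "norm (ampliation A :: ('i, 'a) l2 \<Rightarrow>\<^sub>B _) \<le> norm A" by simp_all
qed

lemma ampliation_add: "ampliation (A + B) = ampliation A + ampliation B"
  and ampliation_scaleC: "ampliation (c *\<^sub>C A) = c *\<^sub>C ampliation A"
  and ampliation_scaleR: "ampliation (r *\<^sub>R A) = r *\<^sub>R ampliation A"
  and ampliation_compose: "ampliation (A o\<^sub>C B) = ampliation A o\<^sub>C ampliation B"
  and ampliation_id [simp]: "ampliation cblinfun_id = cblinfun_id"
  by (rule l2_cblinfun_eqI; simp add: tensor.add_left tensor_scaleC_left tensor.scaleR_left)+

lemma ampliation_tendsto:
  fixes A :: "'k \<Rightarrow> (('i, complex) l2 \<Rightarrow>\<^sub>B ('i, complex) l2)"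
  assumes bd: "\<And>k. norm (A k) \<le> K" and lim: "\<And>i. ((\<lambda>k. A k (l2_basis i)) \<longlongrightarrow> cblinfun_apply B (l2_basis i)) F"
  shows "((\<lambda>k. ampliation (A k) x) \<longlongrightarrow> ampliation B x) F"
proof (rule l2_tendsto[of "\<lambda>k. cblinfun_apply (ampliation (A k))" K])
  show "linear (cblinfun_apply (ampliation (A k)))" for k
    by (rule bounded_linear.linear[OF bounded_linear_cblinfun_apply])
  show "norm (ampliation (A k) x) \<le> K * norm x" for k x
    using norm_cblinfun order_trans[OF norm_ampliation bd] by (meson mult_right_mono norm_ge_zero order_trans)
  show "bounded_linear (cblinfun_apply (ampliation B))"
    by (rule bounded_linear_cblinfun_apply)
  show "((\<lambda>k. ampliation (A k) (tensor (l2_basis i) h)) \<longlongrightarrow> ampliation B (tensor (l2_basis i) h)) F" for i h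
    by (simp, intro tensor.tendsto lim tendsto_const)
qed

text \<open>Density is used in one variable at a time, first \<open>y\<close>, then
  \<open>x\<close>; on two elementary tensors the form splits into a form of \<open>A k\<close> and
  a constant factor.\<close>

lemma ampliation_wot_tendsto:
  fixes A :: "'k \<Rightarrow> (('i, complex) l2 \<Rightarrow>\<^sub>B ('i, complex) l2)"
  assumes bd: "\<And>k. norm (A k) \<le> K" and lim: "wot_tendsto A B F"
  shows "wot_tendsto (\<lambda>k. ampliation (A k) :: ('i, 'a::chilbert_space) l2 \<Rightarrow>\<^sub>B _) (ampliation B) F"
  unfolding wot_tendsto_def
proof (intro allI)
  fix x y :: "('i, 'a) l2"
  have le: "cmod (cinner (ampliation (A k) x) y) \<le> K * (norm x * norm y)" for k and x y :: "('i, 'a) l2"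
  proof -
    have "cmod (cinner (ampliation (A k) x) y) \<le> norm (ampliation (A k) x) * norm y"
      by (rule cinner_cauchy_schwarz)
    also have "\<dots> \<le> (norm (ampliation (A k) :: ('i, 'a) l2 \<Rightarrow>\<^sub>B _) * norm x) * norm y"
      by (intro mult_right_mono norm_cblinfun) auto
    also have "\<dots> \<le> (K * norm x) * norm y"
      by (intro mult_right_mono order_trans[OF norm_ampliation bd]) auto
    finally show ?thesis by (simp add: mult.assoc)
  qed
  have right: "((\<lambda>k. cinner (ampliation (A k) (tensor f h)) y) \<longlongrightarrow> cinner (ampliation B (tensor f h)) y) F" for f and h :: 'a and y
  proof (rule l2_tendsto[of "\<lambda>k y. cinner (ampliation (A k) (tensor f h)) y" "K * norm (tensor f h)"])
    show "linear (\<lambda>y. cinner (ampliation (A k) (tensor f h)) y)" for k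
      by (rule bounded_linear.linear[OF cinner.bounded_linear_right])
    show "cmod (cinner (ampliation (A k) (tensor f h)) y) \<le> K * norm (tensor f h) * norm y" for k y
      using le by (simp only: mult.assoc)
    show "bounded_linear (\<lambda>y. cinner (ampliation B (tensor f h)) y)"
      by (rule cinner.bounded_linear_right)
    show "((\<lambda>k. cinner (ampliation (A k) (tensor f h)) (tensor (l2_basis i) h')) \<longlongrightarrow>
        cinner (ampliation B (tensor f h)) (tensor (l2_basis i) h')) F" for i h'
      using lim unfolding wot_tendsto_def by (simp add: cinner_tensor) (intro tendsto_intros; blast)
  qed
  show "((\<lambda>k. cinner (ampliation (A k) x) y) \<longlongrightarrow> cinner (ampliation B x) y) F"
  proof (rule l2_tendsto[of "\<lambda>k x. cinner (ampliation (A k) x) y" "K * norm y"])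
    show "linear (\<lambda>x. cinner (ampliation (A k) x) y)" for k
      by (intro bounded_linear.linear bounded_linear_compose[OF cinner.bounded_linear_left bounded_linear_cblinfun_apply])
    show "cmod (cinner (ampliation (A k) x) y) \<le> K * norm y * norm x" for k x
      using le[of k x y] by (simp only: ac_simps)
    show "bounded_linear (\<lambda>x. cinner (ampliation B x) y)"
      by (rule bounded_linear_compose[OF cinner.bounded_linear_left bounded_linear_cblinfun_apply])
  qed (rule right)
qed

section \<open>The universal model and the Berezin kernel\<close>

text \<open>Distinct basis vectors go to orthogonal vectors, so only the largest weight counts. Two
  instances matter: prefixing a letter gives the weighted shifts, the identity gives diagonal
  operators.\<close>

lemma ex_weighted_injection:
  fixes \<pi> :: "'i \<Rightarrow> 'j" and w :: "'i \<Rightarrow> real"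
  assumes inj: "inj \<pi>" and w: "\<And>i. \<bar>w i\<bar> \<le> C"
  shows "\<exists>A :: ('i, 'a::chilbert_space) l2 \<Rightarrow>\<^sub>B ('j, 'a) l2.
    (\<forall>i h. cblinfun_apply A (tensor (l2_basis i) h) = w i *\<^sub>R tensor (l2_basis (\<pi> i)) h) \<and> norm A \<le> C"
proof -
  define a where "a F = (\<Sum>\<^sub>\<infinity>i. w i *\<^sub>R tensor (l2_basis (\<pi> i)) (l2_nth F i))" for F :: "('i, 'a) l2"
  have C: "C \<ge> 0" using w by (meson abs_ge_zero order_trans)
  have le: "norm (\<Sum>i\<in>J. w i *\<^sub>R tensor (l2_basis (\<pi> i)) (l2_nth F i)) \<le>
      C * norm (\<Sum>i\<in>J. tensor (l2_basis i) (l2_nth F i))" if J: "finite J" for J and F :: "('i, 'a) l2"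
  proof -
    have "(\<Sum>i\<in>J. w i *\<^sub>R tensor (l2_basis (\<pi> i)) (l2_nth F i)) =
        (\<Sum>j\<in>\<pi> ` J. tensor (l2_basis j) (w (inv \<pi> j) *\<^sub>R l2_nth F (inv \<pi> j)))"
      using inj by (subst sum.reindex) (auto simp: inj_on_def tensor.scaleR_right)
    hence "(norm (\<Sum>i\<in>J. w i *\<^sub>R tensor (l2_basis (\<pi> i)) (l2_nth F i)))\<^sup>2 =
        (\<Sum>j\<in>\<pi> ` J. (norm (w (inv \<pi> j) *\<^sub>R l2_nth F (inv \<pi> j)))\<^sup>2)"
      using J by (simp only: norm_sum_tensor_basis finite_imageI)
    also have "\<dots> = (\<Sum>i\<in>J. (w i)\<^sup>2 * (norm (l2_nth F i))\<^sup>2)"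
      using inj by (subst sum.reindex) (auto simp: inj_on_def power_mult_distrib)
    also have "\<dots> \<le> (\<Sum>i\<in>J. C\<^sup>2 * (norm (l2_nth F i))\<^sup>2)"
      using w C by (intro sum_mono mult_right_mono) (auto simp: abs_le_square_iff[symmetric])
    also have "\<dots> = (C * norm (\<Sum>i\<in>J. tensor (l2_basis i) (l2_nth F i)))\<^sup>2"
      using J by (simp add: power_mult_distrib norm_sum_tensor_basis sum_distrib_left)
    finally show ?thesis
      by (rule power2_le_imp_le) (use C in simp)
  qed
  note dom = has_sum_dominated[OF le l2_has_sum_basis]
  have "\<exists>A. cblinfun_apply A = a"
  proof (rule ex_cblinfun)
    show "a (F + G) = a F + a G" for F G
      using infsum_add[OF dom(1)[of F] dom(1)[of G]]
      by (simp add: a_def tensor.add_right scaleR_add_right)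
    show "a (c *\<^sub>C F) = c *\<^sub>C a F" for c F
      unfolding a_def l2_nth_simps tensor_scaleC_right scaleC_scaleR_commute[symmetric]
      by (intro infsumI has_sum_bounded_linear[OF bounded_linear_scaleC] has_sum_infsum dom(1))
    show "norm (a F) \<le> norm F * C" for F
      using dom(2)[of F] by (simp add: a_def mult.commute)
  qed
  then obtain A where A: "cblinfun_apply A = a" by blast
  have "a (tensor (l2_basis i) h) = w i *\<^sub>R tensor (l2_basis (\<pi> i)) h" for i h
  proof -
    have "a (tensor (l2_basis i) h) = (\<Sum>\<^sub>\<infinity>j\<in>{i}. w j *\<^sub>R tensor (l2_basis (\<pi> j)) h)"
      unfolding a_def by (rule infsum_cong_neutral) (auto simp: tensor.zero_right)
    thus ?thesis by simp
  qed
  moreover have "norm A \<le> C"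
    using dom(2) C by (intro norm_cblinfun_bound) (auto simp: A a_def)
  ultimately show ?thesis using A by (intro exI[of _ A]) simp
qed

lemma word_op_append: "word_op X (\<alpha> @ \<beta>) = word_op X \<alpha> o\<^sub>C word_op X \<beta>"
  by (induction \<alpha>) (auto simp: compose_assoc)

text \<open>The part of admissibility that makes the weighted shifts well defined and
  bounded.\<close>

locale weights =
  fixes b :: "'n::finite list \<Rightarrow> real"
  assumes b_pos: "b \<alpha> > 0"
    and b_bdd: "bdd_above (range (\<lambda>\<alpha>. b \<alpha> / b (i # \<alpha>)))"
begin

abbreviation W :: "'n list \<Rightarrow> ('n fock \<Rightarrow>\<^sub>B 'n fock)"
  where "W \<equiv> word_op (weighted_shift b)"

lemma weighted_shift_basis:
  "weighted_shift b i (l2_basis \<alpha>) = sqrt (b \<alpha> / b (i # \<alpha>)) *\<^sub>R l2_basis (i # \<alpha>)"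
proof -
  obtain C where C: "\<And>\<alpha>. b \<alpha> / b (i # \<alpha>) \<le> C"
    using b_bdd[of i] by (auto simp: bdd_above_def)
  obtain A :: "'n fock \<Rightarrow>\<^sub>B 'n fock" where
    "\<And>\<alpha> h. cblinfun_apply A (tensor (l2_basis \<alpha>) h) = sqrt (b \<alpha> / b (i # \<alpha>)) *\<^sub>R tensor (l2_basis (i # \<alpha>)) h"
    using ex_weighted_injection[of "(#) i" "\<lambda>\<alpha>. sqrt (b \<alpha> / b (i # \<alpha>))" "sqrt C"] C b_pos
    by (auto simp: inj_def less_imp_le)
  from this[of _ 1] have A: "cblinfun_apply A (l2_basis \<alpha>) = sqrt (b \<alpha> / b (i # \<alpha>)) *\<^sub>R l2_basis (i # \<alpha>)" for \<alpha>
    by (simp add: tensor_complex)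
  have "weighted_shift b i = A"
    unfolding weighted_shift_def
    by (rule the_equality) (auto simp: A intro!: fock_cblinfun_eqI)
  thus ?thesis by (simp add: A)
qed

text \<open>The ratios telescope along the word.\<close>

lemma W_basis: "W \<beta> (l2_basis \<gamma>) = sqrt (b \<gamma> / b (\<beta> @ \<gamma>)) *\<^sub>R l2_basis (\<beta> @ \<gamma>)"
proof (induction \<beta>)
  case (Cons i \<beta>)
  have "sqrt (b \<gamma> / b (\<beta> @ \<gamma>)) * sqrt (b (\<beta> @ \<gamma>) / b (i # \<beta> @ \<gamma>)) = sqrt (b \<gamma> / b (i # \<beta> @ \<gamma>))"
    using b_pos[of "\<beta> @ \<gamma>"] by (simp add: real_sqrt_mult[symmetric])
  thus ?case by (simp add: Cons weighted_shift_basis)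
qed (use b_pos[of \<gamma>] in simp)

end

section \<open>The Berezin kernel of a pure tuple and the induced map\<close>

locale pure_model = weights b
  for b :: "'n::finite list \<Rightarrow> real" +
  fixes T :: "'n \<Rightarrow> ('h::chilbert_space \<Rightarrow>\<^sub>B 'h)"
  assumes pure: "pure_tuple b T"
begin

abbreviation K :: "'h \<Rightarrow>\<^sub>B ('n list, 'h) l2"
  where "K \<equiv> berezin_kernel b T"

abbreviation Q :: "'h \<Rightarrow>\<^sub>B 'h"
  where "Q \<equiv> op_sqrt (defect b T)"

abbreviation \<Psi> :: "('n fock \<Rightarrow>\<^sub>B 'n fock) \<Rightarrow> ('h \<Rightarrow>\<^sub>B 'h)"
  where "\<Psi> \<equiv> hardy_calculus b T"

lemma pos_defect: "pos_op (defect b T)"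
  using pure by (simp add: pure_tuple_def nc_domain_def)

lemma Q: "pos_op Q" "Q (Q x) = defect b T x"
  using op_sqrt(1)[OF pos_defect] arg_cong[OF op_sqrt(2)[OF pos_defect], of "\<lambda>A. A x"] by simp_all

text \<open>This is purity tested on the pair \<open>h\<close>, \<open>h\<close>: since the defect
  is \<open>Q\<close> squared, each term of the series is a squared norm. It shows that the
  coordinates prescribed for the Berezin kernel form a square-summable family, and that the kernel
  is isometric.\<close>

lemma kernel_has_sum: "((\<lambda>\<alpha>. (norm (sqrt (b \<alpha>) *\<^sub>R Q (adj (word_op T \<alpha>) h)))\<^sup>2) has_sum (norm h)\<^sup>2) UNIV"
proof -
  let ?S = "\<lambda>F. \<Sum>\<alpha>\<in>F. b \<alpha> *\<^sub>R (word_op T \<alpha> o\<^sub>C defect b T o\<^sub>C adj (word_op T \<alpha>))"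
  have sum_apply: "cblinfun_apply (\<Sum>\<alpha>\<in>F. X \<alpha>) h = (\<Sum>\<alpha>\<in>F. X \<alpha> h)" for F and X :: "'n list \<Rightarrow> 'h \<Rightarrow>\<^sub>B 'h"
    by (rule capply.sum_left)
  have Q_sq: "cinner (Q x) (Q x) = cinner (defect b T x) x" for x
    using pos_op_selfadjoint[OF Q(1), of "Q x" x] by (simp add: Q(2))
  have eq: "Re (cinner (?S F h) h) = (\<Sum>\<alpha>\<in>F. (norm (sqrt (b \<alpha>) *\<^sub>R Q (adj (word_op T \<alpha>) h)))\<^sup>2)" for F
  proof -
    have "Re (cinner (?S F h) h) = (\<Sum>\<alpha>\<in>F. b \<alpha> * Re (cinner (defect b T (adj (word_op T \<alpha>) h)) (adj (word_op T \<alpha>) h)))"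
      by (simp add: sum_apply cinner.sum_left cinner_scaleR_left cinner_adj_right)
    also have "\<dots> = (\<Sum>\<alpha>\<in>F. b \<alpha> * (norm (Q (adj (word_op T \<alpha>) h)))\<^sup>2)"
      unfolding Q_sq[symmetric] cinner_self by simp
    also have "\<dots> = (\<Sum>\<alpha>\<in>F. (norm (sqrt (b \<alpha>) *\<^sub>R Q (adj (word_op T \<alpha>) h)))\<^sup>2)"
      using b_pos by (simp add: power_mult_distrib less_imp_le)
    finally show ?thesis .
  qed
  have "((\<lambda>F. cinner (?S F h) h) \<longlongrightarrow> cinner h h) (finite_subsets_at_top UNIV)"
    using pure by (simp add: pure_tuple_def wot_sums_defect_def wot_tendsto_def)
  from tendsto_Re[OF this] show ?thesis
    unfolding has_sum_def eq by (simp add: cinner_self)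
qed

lemma kernel:
  shows K_nth: "l2_nth (K h) \<alpha> = sqrt (b \<alpha>) *\<^sub>R Q (adj (word_op T \<alpha>) h)"
    and norm_K_apply: "norm (K h) = norm h"
proof -
  define k where "k h = Abs_l2 (\<lambda>\<alpha>. sqrt (b \<alpha>) *\<^sub>R Q (adj (word_op T \<alpha>) h))" for h
  have nth: "l2_nth (k h) = (\<lambda>\<alpha>. sqrt (b \<alpha>) *\<^sub>R Q (adj (word_op T \<alpha>) h))" for h
    unfolding k_def using has_sum_imp_summable[OF kernel_has_sum[of h]] by (simp add: Abs_l2_inverse)
  have norm_k: "norm (k h) = norm h" for h
  proof -
    have "(norm (k h))\<^sup>2 = (norm h)\<^sup>2"
      unfolding norm_l2_power2 nth using kernel_has_sum by (rule infsumI)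
    thus ?thesis by (simp add: power2_eq_iff_nonneg)
  qed
  have "\<exists>A. cblinfun_apply A = k"
    by (rule ex_cblinfun[where K = 1])
      (auto intro!: l2_eqI simp: nth norm_k scaleR_add_right scaleC_scaleR_commute)
  then obtain A where A: "cblinfun_apply A = k" by blast
  have sums: "((\<lambda>\<alpha>. sqrt (b \<alpha>) *\<^sub>R tensor (l2_basis \<alpha>) (Q (adj (word_op T \<alpha>) h))) has_sum A h) UNIV" for h
    using l2_has_sum_basis[of "k h"] by (simp add: A nth tensor.scaleR_right)
  have "K = A"
    unfolding berezin_kernel_def
  proof (rule the_equality)
    fix B :: "'h \<Rightarrow>\<^sub>B ('n list, 'h) l2"
    assume "\<forall>h. ((\<lambda>\<alpha>. sqrt (b \<alpha>) *\<^sub>R tensor (l2_basis \<alpha>) (Q (adj (word_op T \<alpha>) h))) has_sum cblinfun_apply B h) UNIV"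
    thus "B = A" using sums by (intro cblinfun_eqI has_sum_unique) auto
  qed (use sums in blast)
  thus "l2_nth (K h) \<alpha> = sqrt (b \<alpha>) *\<^sub>R Q (adj (word_op T \<alpha>) h)" "norm (K h) = norm h"
    by (simp_all add: A nth norm_k)
qed

lemma norm_K: "norm K \<le> 1" and norm_adj_K: "norm (adj K) \<le> 1"
proof -
  show "norm K \<le> 1" by (rule norm_cblinfun_bound) (auto simp: norm_K_apply)
  thus "norm (adj K) \<le> 1" using norm_adj_le[of K] by linarith
qed

text \<open>Norm preservation says that the quadratic form of the self-adjoint operator
  \<open>E\<close> is zero. Hence \<open>E\<close> is positive, and a positive operator vanishes
  where its form does.\<close>

lemma adj_K_K [simp]: "adj K o\<^sub>C K = cblinfun_id"
proof -
  define E where "E = (adj K o\<^sub>C K) - cblinfun_id"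
  have E: "cinner (E x) y = cinner (K x) (K y) - cinner x y" for x y
    by (simp add: E_def cinner.diff_left cinner_adj_left)
  have zero: "inner (E x) x = 0" for x
    by (simp add: inner_eq_Re_cinner E cinner_self norm_K_apply)
  have "pos_op E"
  proof (rule pos_opI)
    show "cinner (E x) y = cinner x (E y)" for x y
      unfolding E by (subst (3) cinner_commute)
        (simp add: E complex_cnj_diff cinner_commute[of x y] cinner_commute[of "K x" "K y"])
  qed (simp add: zero)
  hence "E = 0"
    using zero by (intro cblinfun_eqI) (simp add: pos_op_inner_eq_0)
  thus ?thesis by (simp add: E_def)
qed

lemma adj_K_basis: "adj K (tensor (l2_basis \<gamma>) h) = sqrt (b \<gamma>) *\<^sub>R word_op T \<gamma> (Q h)"
proof (rule cinner_eqI')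
  fix z
  have "cinner z (adj K (tensor (l2_basis \<gamma>) h)) = cinner (sqrt (b \<gamma>) *\<^sub>R Q (adj (word_op T \<gamma>) z)) h"
    by (simp add: cinner_adj_right[symmetric] cinner_tensor_basis K_nth)
  also have "\<dots> = cinner z (sqrt (b \<gamma>) *\<^sub>R word_op T \<gamma> (Q h))"
    by (simp add: cinner_scaleR_left cinner_scaleR_right pos_op_selfadjoint[OF Q(1)] cinner_adj_left)
  finally show "cinner z (adj K (tensor (l2_basis \<gamma>) h)) = cinner z (sqrt (b \<gamma>) *\<^sub>R word_op T \<gamma> (Q h))" .
qed

text \<open>On an elementary tensor the shift contributes
  \<open>sqrt (b \<gamma> / b (\<beta> @ \<gamma>))\<close> and \<open>adj K\<close> contributes
  \<open>sqrt (b (\<beta> @ \<gamma>))\<close>; the product is the \<open>sqrt (b \<gamma>)\<close>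
  of the other side.\<close>

lemma adj_K_W: "adj K o\<^sub>C ampliation (W \<beta>) = word_op T \<beta> o\<^sub>C adj K"
proof (rule l2_cblinfun_eqI)
  fix \<gamma> h
  have "sqrt (b \<gamma> / b (\<beta> @ \<gamma>)) * sqrt (b (\<beta> @ \<gamma>)) = sqrt (b \<gamma>)"
    using b_pos[of "\<beta> @ \<gamma>"] by (simp add: real_sqrt_mult[symmetric])
  thus "(adj K o\<^sub>C ampliation (W \<beta>)) (tensor (l2_basis \<gamma>) h) = (word_op T \<beta> o\<^sub>C adj K) (tensor (l2_basis \<gamma>) h)"
    by (simp add: W_basis tensor.scaleR_left adj_K_basis word_op_append)
qed

lemma \<Psi>_apply: "\<Psi> A x = adj K (ampliation A (K x))"
  by (simp add: hardy_calculus_def)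

lemma \<Psi>_add: "\<Psi> (A + B) = \<Psi> A + \<Psi> B"
  and \<Psi>_scaleC: "\<Psi> (c *\<^sub>C A) = c *\<^sub>C \<Psi> A"
  and \<Psi>_scaleR: "\<Psi> (r *\<^sub>R A) = r *\<^sub>R \<Psi> A"
  by (auto intro!: cblinfun_eqI simp: \<Psi>_apply ampliation_add ampliation_scaleC ampliation_scaleR)

lemma norm_\<Psi>: "norm (\<Psi> A) \<le> norm A"
proof -
  have "norm (\<Psi> A) \<le> norm (adj K) * norm (ampliation A :: ('n list, 'h) l2 \<Rightarrow>\<^sub>B _) * norm K"
    unfolding hardy_calculus_def
    by (intro order_trans[OF norm_cblinfun_compose] mult_right_mono norm_cblinfun_compose) auto
  also have "\<dots> \<le> 1 * norm A * 1"
    by (intro mult_mono norm_K norm_adj_K norm_ampliation) auto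
  finally show ?thesis by simp
qed

lemma bounded_linear_\<Psi>: "bounded_linear \<Psi>"
  by (rule bounded_linear_intro[where K = 1]) (simp_all add: \<Psi>_add \<Psi>_scaleR norm_\<Psi>)

lemma \<Psi>_sum: "\<Psi> (\<Sum>i\<in>I. A i) = (\<Sum>i\<in>I. \<Psi> (A i))"
  by (rule linear_sum[OF bounded_linear.linear[OF bounded_linear_\<Psi>]])

lemma \<Psi>_id: "\<Psi> cblinfun_id = cblinfun_id"
  by (simp add: hardy_calculus_def)

lemma \<Psi>_W: "\<Psi> (W \<beta>) = word_op T \<beta>"
  unfolding hardy_calculus_def adj_K_W by (simp add: compose_assoc)

text \<open>The range of \<open>K\<close> is invariant under the adjoint of \<open>A \<otimes> I\<close>.\<close>

definition coinvariant :: "('n fock \<Rightarrow>\<^sub>B 'n fock) \<Rightarrow> bool"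
  where "coinvariant A \<longleftrightarrow> adj K o\<^sub>C ampliation A = \<Psi> A o\<^sub>C adj K"

lemma coinvariant_W: "coinvariant (W \<beta>)"
  by (simp add: coinvariant_def adj_K_W \<Psi>_W)

text \<open>The left factor is moved across \<open>adj K\<close>, where it becomes
  \<open>\<Psi> A\<close>; what remains is \<open>\<Psi> B\<close>.\<close>

lemma coinvariant_compose: "coinvariant A \<Longrightarrow> \<Psi> (A o\<^sub>C B) = \<Psi> A o\<^sub>C \<Psi> B"
  unfolding coinvariant_def
  by (metis (no_types, lifting) ampliation_compose compose_assoc hardy_calculus_def)



lemma coinvariant_add: "coinvariant A \<Longrightarrow> coinvariant B \<Longrightarrow> coinvariant (A + B)"
  by (simp add: coinvariant_def ampliation_add \<Psi>_add ccompose.add_left ccompose.add_right)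

lemma coinvariant_scaleC: "coinvariant A \<Longrightarrow> coinvariant (c *\<^sub>C A)"
  by (simp add: coinvariant_def ampliation_scaleC \<Psi>_scaleC compose_scaleC_left compose_scaleC_right)

lemma coinvariant_0: "coinvariant 0"
  using coinvariant_scaleC[OF coinvariant_W, of 0] by simp

lemma coinvariant_sum: "(\<And>i. i \<in> I \<Longrightarrow> coinvariant (A i)) \<Longrightarrow> coinvariant (\<Sum>i\<in>I. A i)"
  by (induction I rule: infinite_finite_induct) (auto intro: coinvariant_0 coinvariant_add)

lemma \<Psi>_tendsto:
  assumes "\<And>k. norm (A k) \<le> C" "\<And>\<gamma>. ((\<lambda>k. cblinfun_apply (A k) (l2_basis \<gamma>)) \<longlongrightarrow> cblinfun_apply B (l2_basis \<gamma>)) F"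
  shows "((\<lambda>k. \<Psi> (A k) x) \<longlongrightarrow> \<Psi> B x) F"
  unfolding \<Psi>_apply
  by (intro bounded_linear.tendsto[OF bounded_linear_cblinfun_apply] ampliation_tendsto[where K = C] assms)

text \<open>Both sides of the intertwining relation are strong limits. The filter is general because
  the lemma is applied to partial sums of an Abel series and then to the Abel means as
  \<open>r\<close> tends to 1.\<close>

lemma coinvariant_limit:
  assumes F: "F \<noteq> bot" and co: "\<And>k. coinvariant (A k)"
    and lim: "\<And>k. norm (A k) \<le> C" "\<And>\<gamma>. ((\<lambda>k. cblinfun_apply (A k) (l2_basis \<gamma>)) \<longlongrightarrow> cblinfun_apply B (l2_basis \<gamma>)) F"
  shows "coinvariant B"
  unfolding coinvariant_def
proof (rule cblinfun_eqI)
  fix x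
  have "((\<lambda>k. \<Psi> (A k) (adj K x)) \<longlongrightarrow> \<Psi> B (adj K x)) F"
    by (intro \<Psi>_tendsto[where C = C] lim)
  moreover have "\<Psi> (A k) (adj K x) = adj K (ampliation (A k) x)" for k
    using co[of k] unfolding coinvariant_def by (metis cblinfun_compose.rep_eq)
  moreover have "((\<lambda>k. adj K (ampliation (A k) x)) \<longlongrightarrow> adj K (ampliation B x)) F"
    by (intro bounded_linear.tendsto[OF bounded_linear_cblinfun_apply] ampliation_tendsto[where K = C] lim)
  ultimately show "(adj K o\<^sub>C ampliation B) x = (\<Psi> B o\<^sub>C adj K) x"
    using tendsto_unique[OF F] by auto
qed

end

section \<open>Homogeneous parts and Abel means\<close>

text \<open>It is enough to factor the finite sections of the multiplier, because finitely supported vectors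
  are dense; the factorization may depend on the section.\<close>

lemma Schur_multiplier_bound:
  fixes A B :: "('i, complex) l2 \<Rightarrow>\<^sub>B ('i, complex) l2" and d :: "'i \<Rightarrow> nat"
  assumes fac: "\<And>L. \<exists>(M :: nat set) u v. finite M \<and>
      (\<forall>i j. d i \<le> L \<longrightarrow> d j \<le> L \<longrightarrow> l2_nth (cblinfun_apply B (l2_basis j)) i =
        complex_of_real (\<Sum>m\<in>M. u m (d i) * v m (d j)) * l2_nth (cblinfun_apply A (l2_basis j)) i) \<and>
      (\<forall>i. d i \<le> L \<longrightarrow> (\<Sum>m\<in>M. (u m (d i))\<^sup>2) \<le> 1 \<and> (\<Sum>m\<in>M. (v m (d i))\<^sup>2) \<le> 1)"
  shows "norm B \<le> norm A"
proof -
  let ?P = "\<lambda>J x. \<Sum>j\<in>J. l2_nth x j *\<^sub>C l2_basis j"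
  have fin: "cmod (cinner (B (?P J x)) (?P J y)) \<le> norm A * (norm (?P J x) * norm (?P J y))"
    if J: "finite J" for J x y
  proof -
    have d_le: "d i \<le> Max (d ` J)" if "i \<in> J" for i
      using J that by simp
    obtain M :: "nat set" and u v where M: "finite M"
      and fac': "\<forall>i j. d i \<le> Max (d ` J) \<longrightarrow> d j \<le> Max (d ` J) \<longrightarrow> l2_nth (B (l2_basis j)) i =
        complex_of_real (\<Sum>m\<in>M. u m (d i) * v m (d j)) * l2_nth (A (l2_basis j)) i"
        "\<forall>i. d i \<le> Max (d ` J) \<longrightarrow> (\<Sum>m\<in>M. (u m (d i))\<^sup>2) \<le> 1 \<and> (\<Sum>m\<in>M. (v m (d i))\<^sup>2) \<le> 1"
      using fac[of "Max (d ` J)"] by blast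
    have entry: "l2_nth (B (l2_basis j)) i =
        complex_of_real (\<Sum>m\<in>M. u m (d i) * v m (d j)) * l2_nth (A (l2_basis j)) i" if "i \<in> J" "j \<in> J" for i j
      using fac'(1) d_le that by blast
    have u: "(\<Sum>m\<in>M. (u m (d i))\<^sup>2) \<le> 1" and v: "(\<Sum>m\<in>M. (v m (d i))\<^sup>2) \<le> 1" if "i \<in> J" for i
      using fac'(2) d_le[OF that] by blast+
    \<comment> \<open>\<open>D w\<close> cuts off to \<open>J\<close> and multiplies by
      \<open>w\<close> in the degrees. The factorization says that the section of \<open>B\<close>
      is the sum over \<open>m\<close> of the products of \<open>D (u m)\<close>, \<open>A\<close>
      and \<open>D (v m)\<close>.\<close>
    define D where "D w z = (\<Sum>j\<in>J. (complex_of_real (w (d j)) * l2_nth z j) *\<^sub>C l2_basis j)"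
      for w :: "nat \<Rightarrow> real" and z :: "('i, complex) l2"
    have sq: "(\<Sum>m\<in>M. (norm (D (w m) z))\<^sup>2) \<le> (norm (?P J z))\<^sup>2"
      if w: "\<And>i. i \<in> J \<Longrightarrow> (\<Sum>m\<in>M. (w m (d i))\<^sup>2) \<le> 1" for w :: "nat \<Rightarrow> nat \<Rightarrow> real" and z
    proof -
      have "(norm (D w z))\<^sup>2 = (\<Sum>j\<in>J. (w (d j))\<^sup>2 * (cmod (l2_nth z j))\<^sup>2)" for w
        using norm_sum_tensor_basis[OF J, of "\<lambda>j. complex_of_real (w (d j)) * l2_nth z j"]
        by (simp add: D_def tensor_complex norm_mult power_mult_distrib)
      hence "(\<Sum>m\<in>M. (norm (D (w m) z))\<^sup>2) = (\<Sum>j\<in>J. (\<Sum>m\<in>M. (w m (d j))\<^sup>2) * (cmod (l2_nth z j))\<^sup>2)"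
        by (simp add: sum_distrib_right) (rule sum.swap)
      also have "\<dots> \<le> (\<Sum>j\<in>J. 1 * (cmod (l2_nth z j))\<^sup>2)"
        by (intro sum_mono mult_right_mono w) auto
      also have "\<dots> = (norm (?P J z))\<^sup>2"
        using norm_sum_tensor_basis[OF J, of "l2_nth z"] by (simp add: tensor_complex)
      finally show ?thesis .
    qed
    have expand: "cinner (C (\<Sum>j\<in>J. f j *\<^sub>C l2_basis j)) (\<Sum>i\<in>J. g i *\<^sub>C l2_basis i) =
        (\<Sum>j\<in>J. \<Sum>i\<in>J. f j * cnj (g i) * l2_nth (C (l2_basis j)) i)"
      for C :: "('i, complex) l2 \<Rightarrow>\<^sub>B ('i, complex) l2" and f g
      by (simp add: capply.sum_right cinner.sum_left cinner.sum_right cinner_scaleC_left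
          cinner_scaleC_right cinner_l2_basis sum_distrib_left scaleC_complex_def ac_simps)
        (rule sum.swap)
    have "cinner (B (?P J x)) (?P J y) =
        (\<Sum>j\<in>J. \<Sum>i\<in>J. \<Sum>m\<in>M. (complex_of_real (v m (d j)) * l2_nth x j) * cnj (complex_of_real (u m (d i)) * l2_nth y i) * l2_nth (A (l2_basis j)) i)"
      unfolding expand
      by (intro sum.cong refl) (simp add: entry sum_distrib_left sum_distrib_right ac_simps)
    also have "\<dots> = (\<Sum>j\<in>J. \<Sum>m\<in>M. \<Sum>i\<in>J. (complex_of_real (v m (d j)) * l2_nth x j) * cnj (complex_of_real (u m (d i)) * l2_nth y i) * l2_nth (A (l2_basis j)) i)"
      by (intro sum.cong refl) (rule sum.swap)
    also have "\<dots> = (\<Sum>m\<in>M. cinner (A (D (v m) x)) (D (u m) y))"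
      unfolding D_def expand by (rule sum.swap)
    finally have eq: "cinner (B (?P J x)) (?P J y) = (\<Sum>m\<in>M. cinner (A (D (v m) x)) (D (u m) y))" .
    have "cmod (cinner (A (D (v m) x)) (D (u m) y)) \<le> norm A * (norm (D (v m) x) * norm (D (u m) y))" for m
    proof -
      have "cmod (cinner (A (D (v m) x)) (D (u m) y)) \<le> norm (A (D (v m) x)) * norm (D (u m) y)"
        by (rule cinner_cauchy_schwarz)
      also have "\<dots> \<le> (norm A * norm (D (v m) x)) * norm (D (u m) y)"
        by (intro mult_right_mono norm_cblinfun) auto
      finally show ?thesis by (simp add: mult.assoc)
    qed
    \<comment> \<open>Cauchy--Schwarz in \<open>m\<close>; by \<open>sq\<close> the normalizations
      of \<open>u\<close> and \<open>v\<close> keep both factors below the norms of the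
      sections.\<close>
    hence "cmod (cinner (B (?P J x)) (?P J y)) \<le> norm A * (\<Sum>m\<in>M. \<bar>norm (D (v m) x)\<bar> * \<bar>norm (D (u m) y)\<bar>)"
      unfolding eq sum_distrib_left by (intro sum_norm_le) auto
    also have "\<dots> \<le> norm A * (L2_set (\<lambda>m. norm (D (v m) x)) M * L2_set (\<lambda>m. norm (D (u m) y)) M)"
      by (intro mult_left_mono L2_set_mult_ineq) auto
    also have "\<dots> \<le> norm A * (norm (?P J x) * norm (?P J y))"
      unfolding L2_set_def
      by (intro mult_left_mono mult_mono real_le_lsqrt sq u v) (auto intro: sum_nonneg)
    finally show ?thesis .
  qed
  have P: "((\<lambda>J. ?P J x) \<longlongrightarrow> x) (finite_subsets_at_top UNIV)" for x :: "('i, complex) l2"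
    using l2_has_sum_basis[of x] by (simp add: has_sum_def tensor_complex)
  have le: "cmod (cinner (B x) y) \<le> norm A * (norm x * norm y)" for x y
  proof (rule tendsto_le)
    show "((\<lambda>J. cmod (cinner (B (?P J x)) (?P J y))) \<longlongrightarrow> cmod (cinner (B x) y)) (finite_subsets_at_top UNIV)"
      by (intro tendsto_norm cinner.tendsto capply.tendsto P tendsto_const)
    show "((\<lambda>J. norm A * (norm (?P J x) * norm (?P J y))) \<longlongrightarrow> norm A * (norm x * norm y)) (finite_subsets_at_top UNIV)"
      by (intro tendsto_intros P)
  qed (auto intro!: eventually_finite_subsets_at_top_weakI fin)
  show ?thesis
  proof (rule norm_cblinfun_bound)
    show "norm (B x) \<le> norm A * norm x" for x
      by (rule norm_le_cinnerI) (use le in \<open>simp_all add: mult.assoc\<close>)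
  qed simp
qed

text \<open>The Poisson kernel factors as \<open>r\<^bsup>i - j\<^esup> = \<Sum>m\<le>j. v\<^sub>m(i) v\<^sub>m(j)\<close> for \<open>j \<le> i\<close>.\<close>

definition poisson_factor :: "real \<Rightarrow> nat \<Rightarrow> nat \<Rightarrow> real"
  where "poisson_factor r m i = (if m = 0 then r ^ i else if m \<le> i then sqrt (1 - r\<^sup>2) * r ^ (i - m) else 0)"

text \<open>The terms with \<open>m \<ge> 1\<close> form a geometric sum, equal to
  \<open>r ^ k * (1 - r ^ (2 * j))\<close>, and \<open>m = 0\<close> supplies the missing
  \<open>r ^ (k + 2 * j)\<close>. Terms with \<open>m > j\<close> vanish, so the cut-off
  \<open>L\<close> is harmless. The case \<open>k = 0\<close> is the normalization in the Schur
  bound.\<close>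

lemma poisson_factor_sum:
  assumes r: "0 \<le> r" "r < 1" and j: "j \<le> L"
  shows "(\<Sum>m\<le>L. poisson_factor r m (j + k) * poisson_factor r m j) = r ^ k"
proof -
  have r2: "0 \<le> 1 - r\<^sup>2" using r by (simp add: power_le_one)
  have geo: "(\<Sum>m=1..j. (1 - r\<^sup>2) * (r\<^sup>2) ^ (j - m)) = 1 - (r\<^sup>2) ^ j"
  proof (induction j)
    case (Suc j)
    have "(\<Sum>m=1..Suc j. (1 - r\<^sup>2) * (r\<^sup>2) ^ (Suc j - m)) =
        r\<^sup>2 * (\<Sum>m=1..j. (1 - r\<^sup>2) * (r\<^sup>2) ^ (j - m)) + (1 - r\<^sup>2)"
      by (simp add: sum_distrib_left Suc_diff_le ac_simps)
    thus ?case unfolding Suc by (simp add: algebra_simps)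
  qed simp
  have "(\<Sum>m\<le>L. poisson_factor r m (j + k) * poisson_factor r m j) =
      (\<Sum>m\<le>j. poisson_factor r m (j + k) * poisson_factor r m j)"
    using j by (intro sum.mono_neutral_right) (auto simp: poisson_factor_def)
  also have "\<dots> = r ^ (j + k) * r ^ j + (\<Sum>m=1..j. poisson_factor r m (j + k) * poisson_factor r m j)"
    by (simp add: sum.atMost_shift sum.atLeast1_atMost_eq poisson_factor_def lessThan_Suc_atMost)
  also have "(\<Sum>m=1..j. poisson_factor r m (j + k) * poisson_factor r m j) =
      r ^ k * (\<Sum>m=1..j. (1 - r\<^sup>2) * (r\<^sup>2) ^ (j - m))"
    unfolding sum_distrib_left
  proof (intro sum.cong refl)
    fix m assume m: "m \<in> {1..j}"
    hence "j + k - m = k + (j - m)" by simp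
    hence "r ^ (j + k - m) = r ^ k * r ^ (j - m)"
      by (simp only: power_add)
    thus "poisson_factor r m (j + k) * poisson_factor r m j = r ^ k * ((1 - r\<^sup>2) * (r\<^sup>2) ^ (j - m))"
      using m r2 by (simp add: poisson_factor_def power_mult[symmetric] power_mult power2_eq_square power_mult_distrib)
  qed
  also have "r ^ (j + k) * r ^ j + r ^ k * (\<Sum>m=1..j. (1 - r\<^sup>2) * (r\<^sup>2) ^ (j - m)) = r ^ k"
    unfolding geo by (simp add: power_add power2_eq_square power_mult_distrib algebra_simps)
  finally show ?thesis .
qed

lemma finite_words: "finite {\<alpha> :: 'n::finite list. length \<alpha> = k}"
  using finite_lists_length_eq[of "UNIV :: 'n set" k] by simp

lemma radial_term_scale: "radial_term c T r k = (r ^ k) *\<^sub>R radial_term c T 1 k"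
  unfolding radial_term_def scaleR_sum_right by (intro sum.cong refl) (simp add: scaleR_scaleC scaleC_scaleC)

section \<open>Matrix entries of an operator with a given Fourier series\<close>

context weights
begin

context
  fixes c and A :: "'n fock \<Rightarrow>\<^sub>B 'n fock"
  assumes rep: "fourier_rep b c A"
begin

text \<open>For given words at most one \<open>\<beta>\<close> satisfies
  \<open>\<delta> = \<beta> @ \<gamma>\<close>, so each matrix entry of \<open>A\<close> is a single
  Fourier coefficient with its weight, or zero.\<close>

lemma entry_has_sum:
  "((\<lambda>\<beta>. c \<beta> * (if \<delta> = \<beta> @ \<gamma> then sqrt (b \<gamma> / b \<delta>) else 0)) has_sum l2_nth (A (l2_basis \<gamma>)) \<delta>) UNIV"
proof -
  have "l2_basis \<gamma> \<in> fock_polys"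
    unfolding fock_polys_def by (intro complex_vector.span_base) simp
  hence "((\<lambda>\<beta>. c \<beta> *\<^sub>C W \<beta> (l2_basis \<gamma>)) has_sum A (l2_basis \<gamma>)) UNIV"
    using rep by (simp add: fourier_rep_def)
  hence "((\<lambda>\<beta>. l2_nth (c \<beta> *\<^sub>C W \<beta> (l2_basis \<gamma>)) \<delta>) has_sum l2_nth (A (l2_basis \<gamma>)) \<delta>) UNIV"
    by (rule has_sum_bounded_linear[OF bounded_linear_l2_nth])
  also have "(\<lambda>\<beta>. l2_nth (c \<beta> *\<^sub>C W \<beta> (l2_basis \<gamma>)) \<delta>) =
      (\<lambda>\<beta>. c \<beta> * (if \<delta> = \<beta> @ \<gamma> then sqrt (b \<gamma> / b \<delta>) else 0))"
    by (auto simp: W_basis scaleC_complex_def scaleR_conv_of_real)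
  finally show ?thesis .
qed

lemma entry_append: "l2_nth (A (l2_basis \<gamma>)) (\<beta> @ \<gamma>) = c \<beta> * sqrt (b \<gamma> / b (\<beta> @ \<gamma>))"
  by (rule has_sum_unique[OF entry_has_sum has_sum_finite_neutralI[of "{\<beta>}"]]) auto

lemma entry_other:
  assumes "\<And>\<beta>. \<delta> \<noteq> \<beta> @ \<gamma>"
  shows "l2_nth (A (l2_basis \<gamma>)) \<delta> = 0"
  by (rule has_sum_unique[OF entry_has_sum]) (simp add: assms)

text \<open>\<open>A\<close> never lowers the degree. This makes one-sided Abel weights agree with
  the symmetric Poisson kernel on all nonzero entries.\<close>

lemma entry_short: "length \<delta> < length \<gamma> \<Longrightarrow> l2_nth (A (l2_basis \<gamma>)) \<delta> = 0"
  by (rule entry_other) auto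

abbreviation hom_part :: "nat \<Rightarrow> ('n fock \<Rightarrow>\<^sub>B 'n fock)"
  where "hom_part k \<equiv> radial_term c (weighted_shift b) 1 k"

lemma entry_hom_part:
  "l2_nth (hom_part k (l2_basis \<gamma>)) \<delta> =
    (if length \<delta> = length \<gamma> + k then l2_nth (A (l2_basis \<gamma>)) \<delta> else 0)"
proof -
  have eq: "l2_nth (hom_part k (l2_basis \<gamma>)) \<delta> =
      (\<Sum>\<alpha> | length \<alpha> = k. c \<alpha> * (if \<delta> = \<alpha> @ \<gamma> then sqrt (b \<gamma> / b \<delta>) else 0))"
    unfolding radial_term_def
    by (simp add: capply.sum_left W_basis scaleC_complex_def scaleR_conv_of_real)
      (intro sum.cong refl, auto)
  show ?thesis
  proof (cases "\<exists>\<beta>. \<delta> = \<beta> @ \<gamma>")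
    case True
    then obtain \<beta> where \<beta>: "\<delta> = \<beta> @ \<gamma>" by blast
    have "l2_nth (hom_part k (l2_basis \<gamma>)) \<delta> =
        (\<Sum>\<alpha> | length \<alpha> = k. if \<alpha> = \<beta> then c \<beta> * sqrt (b \<gamma> / b \<delta>) else 0)"
      unfolding eq by (intro sum.cong refl) (auto simp: \<beta>)
    thus ?thesis
      by (simp add: \<beta> finite_words entry_append sum.delta)
  next
    case False
    thus ?thesis unfolding eq by (simp add: entry_other)
  qed
qed

text \<open>The multiplier is the indicator of \<open>i = j + k\<close>, factored over
  \<open>m\<close> into the indicators of \<open>i = m + k\<close> and \<open>j = m\<close>; each
  degree meets at most one \<open>m\<close>. The bound gives the Abel series a geometric
  majorant.\<close>

lemma norm_hom_part: "norm (hom_part k) \<le> norm A"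
proof (rule Schur_multiplier_bound[where d = length], intro exI conjI allI impI)
  fix L and \<delta> \<gamma> :: "'n list" assume L: "length \<delta> \<le> L" "length \<gamma> \<le> L"
  have "(\<Sum>m\<in>{..L}. of_bool (length \<delta> = m + k) * of_bool (length \<gamma> = m)) = (of_bool (length \<delta> = length \<gamma> + k) :: real)"
  proof -
    have "(\<Sum>m\<in>{..L}. of_bool (length \<delta> = m + k) * of_bool (length \<gamma> = m)) =
        (\<Sum>m\<in>{..L}. if m = length \<gamma> then of_bool (length \<delta> = length \<gamma> + k) else 0 :: real)"
      by (intro sum.cong) auto
    thus ?thesis using L by simp
  qed
  thus "l2_nth (hom_part k (l2_basis \<gamma>)) \<delta> =
      complex_of_real (\<Sum>m\<in>{..L}. of_bool (length \<delta> = m + k) * of_bool (length \<gamma> = m)) * l2_nth (A (l2_basis \<gamma>)) \<delta>"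
    by (simp add: entry_hom_part)
next
  fix L and \<delta> :: "'n list"
  have "(\<Sum>m\<in>{..L}. (of_bool (length \<delta> = m + j))\<^sup>2) \<le> (1::real)" for j
  proof -
    \<comment> \<open>Only an inequality: for words shorter than \<open>j\<close> the truncated
      difference is 0, while the left side has no nonzero term.\<close>
    have "(\<Sum>m\<in>{..L}. (of_bool (length \<delta> = m + j))\<^sup>2) \<le> (\<Sum>m\<in>{..L}. if m = length \<delta> - j then 1 else 0 :: real)"
      by (intro sum_mono) auto
    also have "\<dots> \<le> 1" by simp
    finally show ?thesis .
  qed
  from this[of k] this[of 0] show "(\<Sum>m\<in>{..L}. (of_bool (length \<delta> = m + k))\<^sup>2) \<le> (1::real)"
    "(\<Sum>m\<in>{..L}. (of_bool (length \<delta> = m))\<^sup>2) \<le> (1::real)" by simp_all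
qed simp

lemma summable_radial_term:
  assumes "0 \<le> r" "r < 1"
  shows "summable (radial_term c (weighted_shift b) r)"
proof (rule summable_comparison_test'[where N = 0])
  show "summable (\<lambda>k. r ^ k * norm A)"
    using assms by (intro summable_mult2 summable_geometric) auto
  show "norm (radial_term c (weighted_shift b) r k) \<le> r ^ k * norm A" for k
    using assms norm_hom_part[of k] by (subst radial_term_scale) (simp add: mult_left_mono)
qed

text \<open>The value 0 outside \<open>0 \<le> r < 1\<close> makes the norm bound and coinvariance
  hold for every \<open>r\<close>, as \<open>coinvariant_limit\<close> demands of the whole
  family.\<close>

definition abel_mean :: "real \<Rightarrow> ('n fock \<Rightarrow>\<^sub>B 'n fock)"
  where "abel_mean r = (if 0 \<le> r \<and> r < 1 then \<Sum>k. radial_term c (weighted_shift b) r k else 0)"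

lemma entry_abel_mean:
  assumes r: "0 \<le> r" "r < 1"
  shows "l2_nth (abel_mean r (l2_basis \<gamma>)) \<delta> = complex_of_real (r ^ (length \<delta> - length \<gamma>)) * l2_nth (A (l2_basis \<gamma>)) \<delta>"
proof -
  have "(\<lambda>k. l2_nth (radial_term c (weighted_shift b) r k (l2_basis \<gamma>)) \<delta>) sums l2_nth (abel_mean r (l2_basis \<gamma>)) \<delta>"
    using summable_sums[OF summable_radial_term[OF r]] r
    by (intro bounded_linear.sums[OF bounded_linear_l2_nth] bounded_linear.sums[OF capply.bounded_linear_left])
      (simp add: abel_mean_def)
  \<comment> \<open>For \<open>\<delta>\<close> shorter than \<open>\<gamma>\<close> the truncated
    exponent is 0, but the entry vanishes as well.\<close>
  moreover have "(\<lambda>k. l2_nth (radial_term c (weighted_shift b) r k (l2_basis \<gamma>)) \<delta>) =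
      (\<lambda>k. if k = length \<delta> - length \<gamma> then complex_of_real (r ^ k) * l2_nth (A (l2_basis \<gamma>)) \<delta> else 0)"
    using entry_short[of \<delta> \<gamma>]
    by (intro ext, subst radial_term_scale) (auto simp: entry_hom_part scaleR_conv_of_real not_less)
  ultimately show ?thesis
    using sums_single[of "length \<delta> - length \<gamma>" "\<lambda>k. complex_of_real (r ^ k) * l2_nth (A (l2_basis \<gamma>)) \<delta>"]
    by (simp add: sums_iff)
qed

text \<open>The same \<open>poisson_factor\<close> serves rows and columns. It produces the right
  weight where \<open>length \<delta> \<ge> length \<gamma>\<close>; all other entries are
  zero.\<close>

lemma norm_abel_mean: "norm (abel_mean r) \<le> norm A"
proof (cases "0 \<le> r \<and> r < 1")
  case True
  hence r: "0 \<le> r" "r < 1" by auto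
  show ?thesis
  proof (rule Schur_multiplier_bound[where d = length], intro exI conjI allI impI)
    fix L and \<delta> \<gamma> :: "'n list" assume L: "length \<delta> \<le> L" "length \<gamma> \<le> L"
    show "l2_nth (abel_mean r (l2_basis \<gamma>)) \<delta> =
        complex_of_real (\<Sum>m\<in>{..L}. poisson_factor r m (length \<delta>) * poisson_factor r m (length \<gamma>)) * l2_nth (A (l2_basis \<gamma>)) \<delta>"
    proof (cases "length \<delta> < length \<gamma>")
      case False
      thus ?thesis
        using poisson_factor_sum[OF r L(2), of "length \<delta> - length \<gamma>"] by (simp add: entry_abel_mean[OF r])
    qed (simp add: entry_abel_mean[OF r] entry_short)
  next
    fix L and \<delta> :: "'n list" assume "length \<delta> \<le> L"
    thus "(\<Sum>m\<in>{..L}. (poisson_factor r m (length \<delta>))\<^sup>2) \<le> 1" "(\<Sum>m\<in>{..L}. (poisson_factor r m (length \<delta>))\<^sup>2) \<le> 1"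
      using poisson_factor_sum[OF r, of "length \<delta>" L 0] by (simp_all add: power2_eq_square)
  qed simp
qed (auto simp: abel_mean_def)

text \<open>For fixed \<open>\<gamma>\<close> the Abel mean differs from \<open>A\<close> on this
  vector by a diagonal contraction \<open>V r\<close> applied afterwards. Its weights tend to 1, and
  by boundedness convergence on basis vectors is enough.\<close>

lemma abel_mean_tendsto: "((\<lambda>r. abel_mean r (l2_basis \<gamma>)) \<longlongrightarrow> A (l2_basis \<gamma>)) (at_left 1)"
proof -
  \<comment> \<open>Degrees are counted from that of \<open>\<gamma>\<close>; the value 1 for other
    \<open>r\<close> keeps the weights bounded by 1 throughout.\<close>
  define w where "w r \<delta> = (if 0 \<le> r \<and> r < 1 then r ^ (length \<delta> - length \<gamma>) else 1)" for r :: real and \<delta> :: "'n list"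
  have w: "\<bar>w r \<delta>\<bar> \<le> 1" for r \<delta>
    by (auto simp: w_def power_le_one)
  have "\<forall>r. \<exists>V :: 'n fock \<Rightarrow>\<^sub>B 'n fock. (\<forall>\<delta>. cblinfun_apply V (l2_basis \<delta>) = w r \<delta> *\<^sub>R l2_basis \<delta>) \<and> norm V \<le> 1"
  proof
    fix r
    obtain V :: "'n fock \<Rightarrow>\<^sub>B 'n fock" where
      V: "\<forall>i h. cblinfun_apply V (tensor (l2_basis i) h) = w r i *\<^sub>R tensor (l2_basis (id i)) h" "norm V \<le> 1"
      using ex_weighted_injection[OF inj_on_id, of "w r" 1] w by blast
    from V(1)[rule_format, of _ 1] V(2)
    show "\<exists>V :: 'n fock \<Rightarrow>\<^sub>B 'n fock. (\<forall>\<delta>. cblinfun_apply V (l2_basis \<delta>) = w r \<delta> *\<^sub>R l2_basis \<delta>) \<and> norm V \<le> 1"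
      by (auto simp: tensor_complex)
  qed
  then obtain V :: "real \<Rightarrow> ('n fock \<Rightarrow>\<^sub>B 'n fock)"
    where V: "\<And>r \<delta>. cblinfun_apply (V r) (l2_basis \<delta>) = w r \<delta> *\<^sub>R l2_basis \<delta>" and norm_V: "\<And>r. norm (V r) \<le> 1"
    by metis
  have V_nth: "l2_nth (V r f) \<delta> = complex_of_real (w r \<delta>) * l2_nth f \<delta>" for r f \<delta>
  proof -
    have "((\<lambda>i. l2_nth (V r (l2_nth f i *\<^sub>C l2_basis i)) \<delta>) has_sum l2_nth (V r f) \<delta>) UNIV"
      using has_sum_bounded_linear[OF bounded_linear_compose[OF bounded_linear_l2_nth bounded_linear_cblinfun_apply] l2_has_sum_basis[of f]]
      by (simp add: tensor_complex)
    thus ?thesis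
      by (rule has_sum_unique[OF _ has_sum_finite_neutralI[of "{\<delta>}"]])
        (auto simp: V scaleC_complex_def scaleR_conv_of_real)
  qed
  have "((\<lambda>r. V r (A (l2_basis \<gamma>))) \<longlongrightarrow> A (l2_basis \<gamma>)) (at_left 1)"
  proof (rule l2_tendsto[of "\<lambda>r. cblinfun_apply (V r)" 1 "\<lambda>x. x"])
    show "linear (cblinfun_apply (V r))" for r
      by (rule bounded_linear.linear[OF bounded_linear_cblinfun_apply])
    show "norm (V r x) \<le> 1 * norm x" for r x
      using norm_cblinfun[of "V r" x] norm_V[of r] by (meson mult_right_mono norm_ge_zero order_trans)
    fix \<delta> :: "'n list" and h :: complex
    have "((\<lambda>r::real. r ^ (length \<delta> - length \<gamma>)) \<longlongrightarrow> 1 ^ (length \<delta> - length \<gamma>)) (at_left 1)"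
      by (intro tendsto_intros)
    hence "((\<lambda>r. w r \<delta>) \<longlongrightarrow> 1 ^ (length \<delta> - length \<gamma>)) (at_left 1)"
      by (rule Lim_transform_eventually) (use eventually_at_left_real[of 0 "1::real"] in \<open>auto elim!: eventually_mono simp: w_def\<close>)
    hence "((\<lambda>r. h *\<^sub>C w r \<delta> *\<^sub>R l2_basis \<delta>) \<longlongrightarrow> h *\<^sub>C 1 *\<^sub>R (l2_basis \<delta> :: 'n fock)) (at_left 1)"
      by (intro bounded_linear.tendsto[OF bounded_linear_scaleC] tendsto_scaleR tendsto_const) simp
    thus "((\<lambda>r. V r (tensor (l2_basis \<delta>) h)) \<longlongrightarrow> tensor (l2_basis \<delta>) h) (at_left 1)"
      by (simp add: tensor_complex V)
  qed simp
  moreover have "\<forall>\<^sub>F r in at_left 1. V r (A (l2_basis \<gamma>)) = abel_mean r (l2_basis \<gamma>)"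
    using eventually_at_left_real[of 0 "1::real"]
    by (auto elim!: eventually_mono intro!: l2_eqI simp: V_nth entry_abel_mean w_def)
  ultimately show ?thesis by (rule Lim_transform_eventually)
qed

end

end

section \<open>Transfer of the Abel means to \<open>T\<close>\<close>

context pure_model
begin

lemma \<Psi>_radial_term: "\<Psi> (radial_term c (weighted_shift b) r k) = radial_term c T r k"
  by (simp add: radial_term_def \<Psi>_sum \<Psi>_scaleC \<Psi>_W)

text \<open>A bounded linear \<open>\<Psi>\<close> may be applied termwise to the norm-convergent
  series in the shifts, so convergence for \<open>T\<close> is inherited.\<close>

lemma \<Psi>_abel_mean:
  assumes "fourier_rep b c A" "0 \<le> r" "r < 1"
  shows "summable (radial_term c T r)" "\<Psi> (abel_mean c r) = (\<Sum>k. radial_term c T r k)"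
proof -
  note s = summable_radial_term[OF assms]
  show "summable (radial_term c T r)"
    using bounded_linear.summable[OF bounded_linear_\<Psi> s] by (simp add: \<Psi>_radial_term)
  show "\<Psi> (abel_mean c r) = (\<Sum>k. radial_term c T r k)"
    using bounded_linear.suminf[OF bounded_linear_\<Psi> s] assms by (simp add: \<Psi>_radial_term abel_mean_def[OF assms(1)])
qed

lemma coinvariant_abel_mean:
  assumes rep: "fourier_rep b c A"
  shows "coinvariant (abel_mean c r)"
proof (cases "0 \<le> r \<and> r < 1")
  case True
  let ?S = "\<lambda>n. \<Sum>k<n. radial_term c (weighted_shift b) r k"
  have lim: "?S \<longlonglongrightarrow> abel_mean c r"
    using summable_LIMSEQ[OF summable_radial_term[OF rep]] True by (simp add: abel_mean_def[OF rep])
  then obtain C where C: "\<And>n. norm (?S n) \<le> C"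
    using convergent_imp_Bseq[of ?S] by (auto simp: convergent_def Bseq_def)
  show ?thesis
  proof (rule coinvariant_limit[of sequentially ?S C])
    show "coinvariant (?S n)" for n
      unfolding radial_term_def by (intro coinvariant_sum coinvariant_scaleC coinvariant_W)
    show "(\<lambda>n. ?S n (l2_basis \<gamma>)) \<longlonglongrightarrow> abel_mean c r (l2_basis \<gamma>)" for \<gamma>
      by (intro capply.tendsto lim tendsto_const)
  qed (use C in auto)
next
  case False
  hence "abel_mean c r = 0" by (auto simp: abel_mean_def[OF rep])
  thus ?thesis by (simp add: coinvariant_0)
qed

lemma coinvariant_hardy:
  assumes "fourier_rep b c A"
  shows "coinvariant A"
  using coinvariant_limit[OF trivial_limit_at_left_real coinvariant_abel_mean[OF assms]
      norm_abel_mean[OF assms] abel_mean_tendsto[OF assms]] .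

lemma \<Psi>_radial_limit:
  assumes "fourier_rep b c A"
  shows "sot_tendsto (\<lambda>r. \<Sum>k. radial_term c T r k) (\<Psi> A) (at_left 1)"
  unfolding sot_tendsto_def
proof
  fix x
  have "((\<lambda>r. \<Psi> (abel_mean c r) x) \<longlongrightarrow> \<Psi> A x) (at_left 1)"
    by (rule \<Psi>_tendsto[OF norm_abel_mean[OF assms] abel_mean_tendsto[OF assms]])
  moreover have "\<forall>\<^sub>F r in at_left 1. \<Psi> (abel_mean c r) x = (\<Sum>k. radial_term c T r k) x"
    using eventually_at_left_real[of 0 "1::real"]
    by (auto elim!: eventually_mono simp: \<Psi>_abel_mean(2)[OF assms])
  ultimately show "((\<lambda>r. (\<Sum>k. radial_term c T r k) x) \<longlongrightarrow> \<Psi> A x) (at_left 1)"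
    by (rule Lim_transform_eventually)
qed

end

section \<open>Continuity and complete contractivity\<close>

text \<open>Uniform boundedness twice: for the functionals
  \<open>\<lambda>y. cinner y (A n x)\<close> with \<open>x\<close> fixed, which bounds
  \<open>A n x\<close> in \<open>n\<close>, then for the operators \<open>A n\<close>.\<close>

lemma wot_convergent_bounded:
  fixes A :: "nat \<Rightarrow> ('a::chilbert_space \<Rightarrow>\<^sub>B 'b::chilbert_space)"
  assumes "wot_tendsto A L sequentially"
  shows "\<exists>C. \<forall>n. norm (A n) \<le> C"
proof -
  have pw: "\<exists>B. \<forall>n. norm (A n x) \<le> B" for x
  proof -
    have "\<exists>B. \<forall>n. cmod (cinner y (A n x)) \<le> B" for y
    proof -
      have "(\<lambda>n. cinner (A n x) y) \<longlonglongrightarrow> cinner (L x) y"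
        using assms by (simp add: wot_tendsto_def)
      hence "Bseq (\<lambda>n. cinner (A n x) y)"
        by (intro convergent_imp_Bseq convergentI)
      then obtain B where "\<And>n. cmod (cinner (A n x) y) \<le> B"
        by (auto simp: Bseq_def)
      thus ?thesis by (metis cinner_commute complex_mod_cnj)
    qed
    then obtain B where B: "B \<ge> 0" "\<And>n y. cmod (cinner y (A n x)) \<le> B * norm y"
      using uniform_boundedness[of "\<lambda>n y. cinner y (A n x)"] cinner.bounded_linear_left by blast
    have "norm (A n x) \<le> B" for n
      by (rule norm_le_cinnerI[OF B(1)]) (metis B(2) cinner_commute complex_mod_cnj)
    thus ?thesis by blast
  qed
  obtain C where C: "C \<ge> 0" "\<And>n x. norm (A n x) \<le> C * norm x"
    using uniform_boundedness[of "\<lambda>n. cblinfun_apply (A n)"] pw bounded_linear_cblinfun_apply by blast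
  thus ?thesis by (metis norm_cblinfun_bound)
qed

lemma sot_imp_wot: "sot_tendsto A L F \<Longrightarrow> wot_tendsto A L F"
  by (auto simp: sot_tendsto_def wot_tendsto_def intro!: cinner.tendsto tendsto_const)

section \<open>Norms of operator matrices and their ampliations\<close>

lemma op_matrix_norm_bdd:
  fixes M :: "nat \<Rightarrow> nat \<Rightarrow> ('a::chilbert_space \<Rightarrow>\<^sub>B 'a)"
  shows "bdd_above {sqrt (\<Sum>i<k. (norm (\<Sum>j<k. M i j (x j)))\<^sup>2) |x. (\<Sum>j<k. (norm (x j))\<^sup>2) \<le> 1}"
proof (rule bdd_aboveI, safe)
  fix x :: "nat \<Rightarrow> 'a" assume x: "(\<Sum>j<k. (norm (x j))\<^sup>2) \<le> 1"
  \<comment> \<open>A crude bound through the entries suffices: it only has to make the real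
    supremum in \<open>op_matrix_norm\<close> meaningful.\<close>
  have "norm (x j) \<le> 1" if "j < k" for j
  proof -
    have "(norm (x j))\<^sup>2 \<le> (\<Sum>j<k. (norm (x j))\<^sup>2)"
      using that by (intro member_le_sum) auto
    hence "(norm (x j))\<^sup>2 \<le> 1\<^sup>2" using x by simp
    thus ?thesis by (rule power2_le_imp_le) simp
  qed
  hence "norm (M i j (x j)) \<le> norm (M i j)" if "j < k" for i j
    using norm_cblinfun[of "M i j" "x j"] that by (meson mult_left_le norm_ge_zero order_trans)
  hence "norm (\<Sum>j<k. M i j (x j)) \<le> (\<Sum>j<k. norm (M i j))" for i
    by (intro sum_norm_le) auto
  hence "(\<Sum>i<k. (norm (\<Sum>j<k. M i j (x j)))\<^sup>2) \<le> (\<Sum>i<k. (\<Sum>j<k. norm (M i j))\<^sup>2)"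
    by (intro sum_mono power_mono) auto
  thus "sqrt (\<Sum>i<k. (norm (\<Sum>j<k. M i j (x j)))\<^sup>2) \<le> sqrt (\<Sum>i<k. (\<Sum>j<k. norm (M i j))\<^sup>2)"
    by simp
qed

lemma op_matrix_norm_nonneg: "0 \<le> op_matrix_norm k M"
proof -
  have "0 \<in> {sqrt (\<Sum>i<k. (norm (\<Sum>j<k. M i j (x j)))\<^sup>2) |x. (\<Sum>j<k. (norm (x j))\<^sup>2) \<le> 1}"
    by (auto intro!: exI[of _ "\<lambda>_. 0"])
  thus ?thesis unfolding op_matrix_norm_def using op_matrix_norm_bdd by (rule cSup_upper)
qed

lemma op_matrix_norm_upper:
  fixes M :: "nat \<Rightarrow> nat \<Rightarrow> ('a::chilbert_space \<Rightarrow>\<^sub>B 'a)"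
  shows "(\<Sum>i<k. (norm (\<Sum>j<k. M i j (x j)))\<^sup>2) \<le> (op_matrix_norm k M)\<^sup>2 * (\<Sum>j<k. (norm (x j))\<^sup>2)"
proof (cases "(\<Sum>j<k. (norm (x j))\<^sup>2) = 0")
  case True
  hence "x j = 0" if "j < k" for j
    using that by (simp add: sum_nonneg_eq_0_iff)
  thus ?thesis by simp
next
  case False
  define s where "s = sqrt (\<Sum>j<k. (norm (x j))\<^sup>2)"
  have s2: "s\<^sup>2 = (\<Sum>j<k. (norm (x j))\<^sup>2)" by (simp add: s_def sum_nonneg)
  have s: "s > 0" using False by (simp add: s_def sum_nonneg less_le)
  define y where "y j = (1 / s) *\<^sub>R x j" for j
  have "(\<Sum>j<k. (norm (y j))\<^sup>2) = (1 / s)\<^sup>2 * s\<^sup>2"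
    unfolding s2 by (simp add: y_def power_mult_distrib sum_distrib_left power_divide)
  hence y: "(\<Sum>j<k. (norm (y j))\<^sup>2) \<le> 1"
    using s by (simp add: power_divide)
  have "sqrt (\<Sum>i<k. (norm (\<Sum>j<k. M i j (y j)))\<^sup>2) \<le> op_matrix_norm k M"
    unfolding op_matrix_norm_def using y by (intro cSup_upper op_matrix_norm_bdd) blast
  hence "(\<Sum>i<k. (norm (\<Sum>j<k. M i j (y j)))\<^sup>2) \<le> (op_matrix_norm k M)\<^sup>2"
    using sqrt_le_D by blast
  moreover have "(\<Sum>i<k. (norm (\<Sum>j<k. M i j (y j)))\<^sup>2) = (1 / s)\<^sup>2 * (\<Sum>i<k. (norm (\<Sum>j<k. M i j (x j)))\<^sup>2)"
    by (simp add: y_def scaleR_sum_right[symmetric] power_mult_distrib sum_distrib_left power_divide)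
  ultimately show ?thesis
    unfolding s2[symmetric] using s by (simp add: power_divide field_simps)
qed

text \<open>Regroups tensor factors: the first argument lies in
  \<open>l2 \<otimes> F\<^sup>2\<close>, the result in
  \<open>l2 \<otimes> (F\<^sup>2 \<otimes> H)\<close>. It has the inner products of a tensor map, so
  \<open>tensor_contraction\<close> applies to it too.\<close>

lift_definition tensor_family :: "('k, ('i, complex) l2) l2 \<Rightarrow> 'a::complex_inner \<Rightarrow> ('k, ('i, 'a) l2) l2"
  is "\<lambda>e h n. tensor (e n) h"
  by (simp add: norm_tensor power_mult_distrib summable_on_cmult_left)

lemma cinner_tensor_family:
  "cinner (tensor_family e h) (tensor_family e' h') = cinner e e' * cinner h h'"
  unfolding cinner_l2_def[of "tensor_family e h"] cinner_l2_def[of e] tensor_family.rep_eq cinner_tensor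
  by (rule infsum_cmult_left')

lemma tensor_family_single: "tensor_family (tensor (l2_basis n) f) h = tensor (l2_basis n) (tensor f h)"
  by (rule l2_eqI) (simp add: tensor_family.rep_eq tensor_scaleC_left)

text \<open>Turns the matrix into one operator, extended by zero beyond the first \<open>k\<close>
  coordinates, so that \<open>tensor_contraction\<close> can treat it as a single
  \<open>M\<close>.\<close>

lemma ex_matrix_operator:
  fixes M :: "nat \<Rightarrow> nat \<Rightarrow> ('a::chilbert_space \<Rightarrow>\<^sub>B 'a)"
  shows "\<exists>B :: (nat, 'a) l2 \<Rightarrow>\<^sub>B (nat, 'a) l2. norm B \<le> op_matrix_norm k M \<and>
    (\<forall>F. cblinfun_apply B F = (\<Sum>i<k. tensor (l2_basis i) (\<Sum>j<k. M i j (l2_nth F j))))"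
proof -
  define f where "f F = (\<Sum>i<k. tensor (l2_basis i) (\<Sum>j<k. M i j (l2_nth F j)))" for F :: "(nat, 'a) l2"
  have norm_f: "norm (f F) \<le> op_matrix_norm k M * norm F" for F
  proof (rule power2_le_imp_le)
    have "(norm (f F))\<^sup>2 = (\<Sum>i<k. (norm (\<Sum>j<k. M i j (l2_nth F j)))\<^sup>2)"
      unfolding f_def by (rule norm_sum_tensor_basis) simp
    also have "\<dots> \<le> (op_matrix_norm k M)\<^sup>2 * (\<Sum>j<k. (norm (l2_nth F j))\<^sup>2)"
      by (rule op_matrix_norm_upper)
    also have "\<dots> \<le> (op_matrix_norm k M)\<^sup>2 * (norm F)\<^sup>2"
      by (intro mult_left_mono sum_le_norm_l2) auto
    finally show "(norm (f F))\<^sup>2 \<le> (op_matrix_norm k M * norm F)\<^sup>2"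
      by (simp add: power_mult_distrib)
  qed (simp add: op_matrix_norm_nonneg)
  have "\<exists>B. cblinfun_apply B = f"
  proof (rule ex_cblinfun)
    show "f (F + G) = f F + f G" for F G
      by (simp add: f_def sum.distrib tensor.add_right)
    show "f (c *\<^sub>C F) = c *\<^sub>C f F" for c F
      by (simp add: f_def complex_vector.scale_sum_right[symmetric] tensor_scaleC_right)
    show "norm (f F) \<le> norm F * op_matrix_norm k M" for F
      using norm_f[of F] by (simp add: mult.commute)
  qed
  then obtain B where B: "cblinfun_apply B = f" by blast
  have "norm B \<le> op_matrix_norm k M"
    by (rule norm_cblinfun_bound) (simp_all add: op_matrix_norm_nonneg B norm_f)
  with B show ?thesis by (intro exI[of _ B]) (simp add: f_def)
qed

text \<open>Up to regrouping, the matrix of ampliations is \<open>B \<otimes> I\<close> for the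
  single operator \<open>B\<close> of \<open>ex_matrix_operator\<close>, and tensoring with the
  identity does not raise the norm. This is the source of complete contractivity.\<close>

lemma ampliation_matrix_bound:
  fixes M :: "nat \<Rightarrow> nat \<Rightarrow> (('i, complex) l2 \<Rightarrow>\<^sub>B ('i, complex) l2)" and G :: "nat \<Rightarrow> ('i, 'a::chilbert_space) l2"
  shows "(\<Sum>i<k. (norm (\<Sum>j<k. ampliation (M i j) (G j)))\<^sup>2) \<le> (op_matrix_norm k M)\<^sup>2 * (\<Sum>j<k. (norm (G j))\<^sup>2)"
proof -
  obtain B :: "(nat, ('i, complex) l2) l2 \<Rightarrow>\<^sub>B (nat, ('i, complex) l2) l2"
    where norm_B: "norm B \<le> op_matrix_norm k M"
      and B: "\<And>F. cblinfun_apply B F = (\<Sum>i<k. tensor (l2_basis i) (\<Sum>j<k. M i j (l2_nth F j)))"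
    using ex_matrix_operator[of k M] by blast
  let ?P = "\<lambda>J j. \<Sum>\<alpha>\<in>J. tensor (l2_basis \<alpha>) (l2_nth (G j) \<alpha>)"
  have fin: "(\<Sum>i<k. (norm (\<Sum>j<k. ampliation (M i j) (?P J j)))\<^sup>2) \<le> (op_matrix_norm k M)\<^sup>2 * (\<Sum>j<k. (norm (?P J j))\<^sup>2)"
    if J: "finite J" for J
  proof -
    define e where "e = (\<lambda>(j::nat, \<alpha>::'i). tensor (l2_basis j) (l2_basis \<alpha>) :: (nat, ('i, complex) l2) l2)"
    define h where "h = (\<lambda>(j, \<alpha>). l2_nth (G j) \<alpha>)"
    \<comment> \<open>\<open>?X\<close> is the regrouped tuple of finite sections of the
      \<open>G j\<close>; \<open>?Y\<close> is its image under \<open>B \<otimes> I\<close>.\<close>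
    let ?X = "\<Sum>p\<in>{..<k} \<times> J. tensor_family (e p) (h p)" and ?Y = "\<Sum>p\<in>{..<k} \<times> J. tensor_family (B (e p)) (h p)"
    have "?X = (\<Sum>j<k. \<Sum>\<alpha>\<in>J. tensor (l2_basis j) (tensor (l2_basis \<alpha>) (l2_nth (G j) \<alpha>)))"
      by (simp add: sum.cartesian_product e_def h_def case_prod_beta tensor_family_single)
    also have "\<dots> = (\<Sum>j<k. tensor (l2_basis j) (?P J j))"
      by (simp add: tensor.sum_right)
    finally have X: "(norm ?X)\<^sup>2 = (\<Sum>j<k. (norm (?P J j))\<^sup>2)"
      by (simp only: norm_sum_tensor_basis finite_lessThan)
    have Y: "l2_nth ?Y i = (\<Sum>j<k. ampliation (M i j) (?P J j))" if i: "i < k" for i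
    proof -
      have Be: "l2_nth (B (tensor (l2_basis j) f)) i = M i j f" if "j < k" for j f
      proof -
        have col: "(\<Sum>c<k. M a c (l2_nth (tensor (l2_basis j) f) c)) = M a j f" for a
        proof -
          have "(\<Sum>c<k. M a c (l2_nth (tensor (l2_basis j) f) c)) = (\<Sum>c<k. if c = j then M a j f else 0)"
            by (intro sum.cong refl) auto
          thus ?thesis using that by simp
        qed
        have "l2_nth (B (tensor (l2_basis j) f)) i = (\<Sum>a<k. if a = i then M i j f else 0)"
          unfolding B col l2_nth_sum by (intro sum.cong refl) auto
        thus ?thesis using i by simp
      qed
      have "l2_nth ?Y i = (\<Sum>j<k. \<Sum>\<alpha>\<in>J. tensor (l2_nth (B (tensor (l2_basis j) (l2_basis \<alpha>))) i) (l2_nth (G j) \<alpha>))"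
        by (simp add: sum.cartesian_product e_def h_def case_prod_beta tensor_family.rep_eq)
      also have "\<dots> = (\<Sum>j<k. \<Sum>\<alpha>\<in>J. tensor (M i j (l2_basis \<alpha>)) (l2_nth (G j) \<alpha>))"
        by (intro sum.cong refl) (simp add: Be)
      finally show ?thesis by (simp add: capply.sum_right)
    qed
    have "(\<Sum>i<k. (norm (\<Sum>j<k. ampliation (M i j) (?P J j)))\<^sup>2) = (\<Sum>i<k. (norm (l2_nth ?Y i))\<^sup>2)"
      by (intro sum.cong refl) (simp add: Y del: l2_nth_sum)
    also have "\<dots> \<le> (norm ?Y)\<^sup>2"
      by (rule sum_le_norm_l2) simp
    also have "\<dots> \<le> (norm B * norm ?X)\<^sup>2"
      by (intro power_mono tensor_contraction cinner_tensor_family) auto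
    also have "\<dots> \<le> (op_matrix_norm k M * norm ?X)\<^sup>2"
      by (intro power_mono mult_right_mono norm_B) auto
    finally show ?thesis
      unfolding power_mult_distrib X .
  qed
  have P: "((\<lambda>J. ?P J j) \<longlongrightarrow> G j) (finite_subsets_at_top UNIV)" for j
    using l2_has_sum_basis[of "G j"] by (simp add: has_sum_def)
  show ?thesis
  proof (rule tendsto_le)
    show "((\<lambda>J. \<Sum>i<k. (norm (\<Sum>j<k. ampliation (M i j) (?P J j)))\<^sup>2) \<longlongrightarrow>
        (\<Sum>i<k. (norm (\<Sum>j<k. ampliation (M i j) (G j)))\<^sup>2)) (finite_subsets_at_top UNIV)"
      by (intro tendsto_sum tendsto_power tendsto_norm capply.tendsto tendsto_const P)
    show "((\<lambda>J. (op_matrix_norm k M)\<^sup>2 * (\<Sum>j<k. (norm (?P J j))\<^sup>2)) \<longlongrightarrow>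
        (op_matrix_norm k M)\<^sup>2 * (\<Sum>j<k. (norm (G j))\<^sup>2)) (finite_subsets_at_top UNIV)"
      by (intro tendsto_intros P)
  qed (auto intro!: eventually_finite_subsets_at_top_weakI fin)
qed

section \<open>Gram--Schmidt systems and slices\<close>

fun gram_schmidt :: "(nat \<Rightarrow> 'a::complex_inner) \<Rightarrow> nat \<Rightarrow> 'a"
  where "gram_schmidt f n = sgn (f n - (\<Sum>m<n. cinner (f n) (gram_schmidt f m) *\<^sub>C gram_schmidt f m))"

declare gram_schmidt.simps [simp del]

text \<open>Since \<open>sgn 0 = 0\<close>, a vector dependent on its predecessors produces zero, so
  the system is orthonormal up to zero vectors. This identity expresses the normalization for both
  cases at once.\<close>

lemma gram_schmidt_self: "cinner x (gram_schmidt f n) * cinner (gram_schmidt f n) (gram_schmidt f n) = cinner x (gram_schmidt f n)"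
proof -
  obtain v where "gram_schmidt f n = sgn v"
    using gram_schmidt.simps by blast
  thus ?thesis by (cases "v = 0") (simp_all add: cinner_self norm_sgn)
qed

lemma gram_schmidt_orthogonal: "m < n \<Longrightarrow> cinner (gram_schmidt f n) (gram_schmidt f m) = 0"
proof (induction n arbitrary: m rule: less_induct)
  case (less n)
  let ?e = "gram_schmidt f"
  have orth: "cinner (?e l) (?e m) = 0" if "l < n" "l \<noteq> m" for l
  proof (cases l m rule: linorder_cases)
    assume "l < m"
    hence "cinner (?e m) (?e l) = 0" by (rule less.IH[OF less.prems])
    thus ?thesis by (subst cinner_commute) simp
  next
    assume "m < l"
    thus ?thesis by (rule less.IH[OF that(1)])
  qed (use that in simp)
  have "cinner (\<Sum>l<n. cinner (f n) (?e l) *\<^sub>C ?e l) (?e m) = (\<Sum>l<n. if l = m then cinner (f n) (?e m) * cinner (?e m) (?e m) else 0)"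
    unfolding cinner.sum_left by (intro sum.cong refl) (auto simp: cinner_scaleC_left orth)
  also have "\<dots> = cinner (f n) (?e m)"
    using less.prems by (simp add: gram_schmidt_self)
  finally show ?case
    by (subst gram_schmidt.simps) (simp add: sgn_div_norm cinner_scaleR_left cinner.diff_left)
qed

lemma gram_schmidt_orthogonal': "m \<noteq> n \<Longrightarrow> cinner (gram_schmidt f n) (gram_schmidt f m) = 0"
proof (cases m n rule: linorder_cases)
  assume "n < m"
  hence "cinner (gram_schmidt f m) (gram_schmidt f n) = 0" by (rule gram_schmidt_orthogonal)
  thus ?thesis by (subst cinner_commute) simp
qed (simp_all add: gram_schmidt_orthogonal)

lemma gram_schmidt_expansion: "f n = (\<Sum>m\<le>n. cinner (f n) (gram_schmidt f m) *\<^sub>C gram_schmidt f m)"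
proof -
  let ?e = "gram_schmidt f"
  define g where "g = f n - (\<Sum>m<n. cinner (f n) (?e m) *\<^sub>C ?e m)"
  have e: "?e n = sgn g" unfolding g_def by (rule gram_schmidt.simps)
  have "cinner (f n) (?e n) = cinner g (?e n)"
    by (simp add: g_def cinner.diff_left cinner.sum_left cinner_scaleC_left gram_schmidt_orthogonal')
  also have "\<dots> *\<^sub>C ?e n = g"
    unfolding e by (cases "g = 0")
      (simp_all add: sgn_div_norm cinner_scaleC_right cinner_self scaleR_scaleC scaleC_scaleC power2_eq_square mult.assoc)
  finally show ?thesis
    by (simp add: g_def lessThan_Suc_atMost[symmetric])
qed

lemma gram_schmidt_Bessel:
  assumes "finite M"
  shows "(\<Sum>m\<in>M. (cmod (cinner x (gram_schmidt f m)))\<^sup>2) \<le> (norm x)\<^sup>2"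
proof -
  let ?e = "gram_schmidt f" and ?S = "\<Sum>m\<in>M. (cmod (cinner x (gram_schmidt f m)))\<^sup>2"
  define p where "p = (\<Sum>m\<in>M. cinner x (?e m) *\<^sub>C ?e m)"
  have xp: "cinner x p = complex_of_real ?S"
    by (simp add: p_def cinner.sum_right cinner_scaleC_right complex_norm_square mult.commute del: of_real_power)
  have "cinner (?e m) p = cnj (cinner x (?e m))" if "m \<in> M" for m
  proof -
    have "cinner (?e m) p = (\<Sum>l\<in>M. if l = m then cnj (cinner x (?e m)) * cinner (?e m) (?e m) else 0)"
      unfolding p_def cinner.sum_right
      by (intro sum.cong refl) (auto simp: cinner_scaleC_right gram_schmidt_orthogonal')
    also have "\<dots> = cnj (cinner x (?e m) * cinner (?e m) (?e m))"
      using assms that by (simp add: cinner_commute[of "?e m" "?e m", symmetric])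
    finally show ?thesis by (simp add: gram_schmidt_self del: complex_cnj_mult)
  qed
  hence "cinner p p = complex_of_real ?S"
    by (subst p_def, simp add: cinner.sum_left cinner_scaleC_left complex_norm_square del: of_real_power)
  hence "(norm p)\<^sup>2 = ?S"
    unfolding cinner_self of_real_eq_iff .
  moreover have "inner x p = ?S"
    unfolding inner_eq_Re_cinner xp by simp
  moreover have "0 \<le> (norm x)\<^sup>2 - 2 * inner x p + (norm p)\<^sup>2"
    using zero_le_power2[of "norm (x - p)"] unfolding power2_norm_eq_inner
    by (simp add: inner_diff_left inner_diff_right inner_commute)
  ultimately show ?thesis by simp
qed

text \<open>\<open>R\<close> is the slice map
  \<open>I \<otimes> \<langle>\<cdot>, e\<rangle>\<close>, which strips the second tensor
  factor.\<close>

lemma ex_slice: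
  fixes e :: "'a::chilbert_space"
  shows "\<exists>R :: ('i, 'a) l2 \<Rightarrow>\<^sub>B ('i, complex) l2. \<forall>F i. l2_nth (cblinfun_apply R F) i = cinner (l2_nth F i) e"
proof -
  define r where "r F = Abs_l2 (\<lambda>i. cinner (l2_nth F i) e)" for F :: "('i, 'a) l2"
  have le: "(norm (cinner x e))\<^sup>2 \<le> (norm e)\<^sup>2 * (norm x)\<^sup>2" for x
    using power_mono[OF cinner_cauchy_schwarz norm_ge_zero, of x e 2]
    by (simp add: power_mult_distrib mult.commute)
  have "(\<lambda>i. (norm (cinner (l2_nth F i) e))\<^sup>2) summable_on UNIV" for F :: "('i, 'a) l2"
    by (rule summable_on_comparison_test[OF summable_on_cmult_right[OF l2_summable[of F]] le]) auto
  hence nth: "l2_nth (r F) = (\<lambda>i. cinner (l2_nth F i) e)" for F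
    by (simp add: r_def Abs_l2_inverse)
  have "\<exists>R. cblinfun_apply R = r"
  proof (rule ex_cblinfun)
    show "r (F + G) = r F + r G" "r (c *\<^sub>C F) = c *\<^sub>C r F" for F G c
      by (auto intro!: l2_eqI simp: nth cinner_add_left cinner_scaleC_left scaleC_complex_def)
    show "norm (r F) \<le> norm F * norm e" for F
    proof (rule power2_le_imp_le)
      have "(norm (r F))\<^sup>2 \<le> (\<Sum>\<^sub>\<infinity>i. (norm e)\<^sup>2 * (norm (l2_nth F i))\<^sup>2)"
        unfolding norm_l2_power2
        by (intro infsum_mono l2_summable summable_on_cmult_right) (simp add: nth le)
      also have "\<dots> = (norm F * norm e)\<^sup>2"
        by (simp add: infsum_cmult_right' norm_l2_power2[symmetric] power_mult_distrib)
      finally show "(norm (r F))\<^sup>2 \<le> (norm F * norm e)\<^sup>2" .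
    qed simp
  qed
  then obtain R where "cblinfun_apply R = r" by blast
  thus ?thesis by (intro exI[of _ R]) (simp add: nth)
qed

context
  fixes f :: "nat \<Rightarrow> 'a::chilbert_space" and R :: "nat \<Rightarrow> ('i, 'a) l2 \<Rightarrow>\<^sub>B ('i, complex) l2"
  assumes R: "\<And>m F i. l2_nth (cblinfun_apply (R m) F) i = cinner (l2_nth F i) (gram_schmidt f m)"
begin

lemma slice_tensor: "R m (tensor g h) = cinner h (gram_schmidt f m) *\<^sub>C g"
  by (rule l2_eqI) (simp add: R cinner_scaleC_left scaleC_complex_def)

text \<open>Slices act on the factor that \<open>A \<otimes> I\<close> leaves alone. Forms of the
  ampliation thereby become forms of \<open>A\<close> itself.\<close>

lemma slice_ampliation: "R m (ampliation A F) = A (R m F)"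
proof -
  have "R m o\<^sub>C ampliation A = A o\<^sub>C R m"
    by (rule l2_cblinfun_eqI) (simp add: slice_tensor)
  thus ?thesis by (metis cblinfun_compose.rep_eq)
qed

lemma slice_Bessel:
  assumes "finite M"
  shows "(\<Sum>m\<in>M. (norm (R m F))\<^sup>2) \<le> (norm F)\<^sup>2"
proof (rule tendsto_upperbound)
  show "((\<lambda>J. \<Sum>m\<in>M. \<Sum>i\<in>J. (norm (l2_nth (R m F) i))\<^sup>2) \<longlongrightarrow> (\<Sum>m\<in>M. (norm (R m F))\<^sup>2)) (finite_subsets_at_top UNIV)"
    using has_sum_infsum[OF l2_summable] unfolding has_sum_def norm_l2_power2 by (intro tendsto_sum)
  have "(\<Sum>m\<in>M. \<Sum>i\<in>J. (norm (l2_nth (R m F) i))\<^sup>2) \<le> (norm F)\<^sup>2" if "finite J" for J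
  proof -
    have "(\<Sum>m\<in>M. \<Sum>i\<in>J. (norm (l2_nth (R m F) i))\<^sup>2) =
        (\<Sum>i\<in>J. \<Sum>m\<in>M. (cmod (cinner (l2_nth F i) (gram_schmidt f m)))\<^sup>2)"
      unfolding R by (rule sum.swap)
    also have "\<dots> \<le> (\<Sum>i\<in>J. (norm (l2_nth F i))\<^sup>2)"
      by (intro sum_mono gram_schmidt_Bessel assms)
    also have "\<dots> \<le> (norm F)\<^sup>2"
      by (rule sum_le_norm_l2[OF that])
    finally show ?thesis .
  qed
  thus "\<forall>\<^sub>F J in finite_subsets_at_top UNIV. (\<Sum>m\<in>M. \<Sum>i\<in>J. (norm (l2_nth (R m F) i))\<^sup>2) \<le> (norm F)\<^sup>2"
    by (intro eventually_finite_subsets_at_top_weakI)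
qed simp

text \<open>Equality in Bessel holds because the components of \<open>G\<close> lie in the span of
  the system. For an elementary tensor \<open>X\<close> only one component of \<open>G\<close> is
  seen, and its expansion is finite.\<close>

lemma slice_Parseval:
  assumes G: "\<And>i. \<exists>n. l2_nth G i = f n"
  shows "(\<lambda>m. cinner (R m X) (R m G)) sums cinner X G"
  unfolding sums_def
proof (rule l2_tendsto[of "\<lambda>N X. \<Sum>m<N. cinner (R m X) (R m G)" "norm G"])
  show "linear (\<lambda>X. \<Sum>m<N. cinner (R m X) (R m G))" for N
    by (intro bounded_linear.linear bounded_linear_sum
        bounded_linear_compose[OF cinner.bounded_linear_left bounded_linear_cblinfun_apply])
  show "bounded_linear (\<lambda>X. cinner X G)"
    by (rule cinner.bounded_linear_left)
  show "norm (\<Sum>m<N. cinner (R m X) (R m G)) \<le> norm G * norm X" for N X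
  proof -
    have "norm (\<Sum>m<N. cinner (R m X) (R m G)) \<le> (\<Sum>m<N. \<bar>norm (R m X)\<bar> * \<bar>norm (R m G)\<bar>)"
      by (intro sum_norm_le) (simp add: cinner_cauchy_schwarz)
    also have "\<dots> \<le> L2_set (\<lambda>m. norm (R m X)) {..<N} * L2_set (\<lambda>m. norm (R m G)) {..<N}"
      by (rule L2_set_mult_ineq)
    also have "\<dots> \<le> norm X * norm G"
      unfolding L2_set_def
      by (intro mult_mono real_le_lsqrt slice_Bessel) (auto intro: sum_nonneg)
    finally show ?thesis by (simp add: mult.commute)
  qed
  fix i and h :: 'a
  obtain n where n: "l2_nth G i = f n" using G by blast
  let ?e = "gram_schmidt f"
  \<comment> \<open>\<open>f n\<close> lies in the span of the system up to index \<open>n\<close>,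
    so only finitely many terms survive.\<close>
  have zero: "cinner (f n) (?e m) = 0" if "m > n" for m
    by (subst gram_schmidt_expansion[of f n])
      (use that in \<open>auto simp: cinner.sum_left cinner_scaleC_left gram_schmidt_orthogonal' intro!: sum.neutral\<close>)
  have "cinner (R m (tensor (l2_basis i) h)) (R m G) = cinner h (?e m) * cnj (cinner (f n) (?e m))" for m
    unfolding slice_tensor cinner_scaleC_left
    by (subst (2) cinner_commute) (simp add: cinner_l2_basis R n)
  moreover have "(\<lambda>m. cinner h (?e m) * cnj (cinner (f n) (?e m))) sums
      (\<Sum>m\<le>n. cinner h (?e m) * cnj (cinner (f n) (?e m)))"
    by (rule sums_finite) (auto simp: zero)
  moreover have "(\<Sum>m\<le>n. cinner h (?e m) * cnj (cinner (f n) (?e m))) = cinner h (f n)"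
    using arg_cong[OF gram_schmidt_expansion[of f n], of "cinner h"]
    by (simp add: cinner.sum_right cinner_scaleC_right mult.commute)
  moreover have "cinner (tensor (l2_basis i) h) G = cinner h (f n)"
    by (subst (1 2) cinner_commute) (simp add: cinner_tensor_basis n)
  ultimately show "(\<lambda>N. \<Sum>m<N. cinner (R m (tensor (l2_basis i) h)) (R m G)) \<longlonglongrightarrow> cinner (tensor (l2_basis i) h) G"
    by (simp add: sums_def)
qed

end

section \<open>Continuity and complete contractivity of the functional calculus\<close>

context pure_model
begin

lemma cinner_\<Psi>: "cinner (\<Psi> A x) y = cinner (ampliation A (K x)) (K y)"
  by (simp add: \<Psi>_apply cinner_adj_left)

lemma \<Psi>_wot_continuous:
  assumes "wot_tendsto A L sequentially"
  shows "wot_tendsto (\<lambda>k. \<Psi> (A k)) (\<Psi> L) sequentially"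
proof -
  obtain C where "\<And>k. norm (A k) \<le> C"
    using wot_convergent_bounded[OF assms] by blast
  from ampliation_wot_tendsto[OF this assms] show ?thesis
    unfolding wot_tendsto_def cinner_\<Psi> by blast
qed

lemma \<Psi>_sot_continuous:
  assumes "sot_tendsto A L sequentially"
  shows "sot_tendsto (\<lambda>k. \<Psi> (A k)) (\<Psi> L) sequentially"
proof -
  obtain C where C: "\<And>k. norm (A k) \<le> C"
    using wot_convergent_bounded[OF sot_imp_wot[OF assms]] by blast
  show ?thesis
    unfolding sot_tendsto_def
    by (intro allI \<Psi>_tendsto[where C = C] C) (use assms in \<open>simp add: sot_tendsto_def\<close>)
qed

lemma \<Psi>_completely_contractive: "op_matrix_norm k (\<lambda>i j. \<Psi> (M i j)) \<le> op_matrix_norm k M"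
  unfolding op_matrix_norm_def[of k "\<lambda>i j. \<Psi> (M i j)"]
proof (rule cSup_least)
  show "{sqrt (\<Sum>i<k. (norm (\<Sum>j<k. \<Psi> (M i j) (x j)))\<^sup>2) |x. (\<Sum>j<k. (norm (x j))\<^sup>2) \<le> 1} \<noteq> {}"
    by (auto intro!: exI[of _ "\<lambda>_. 0"])
  fix s assume "s \<in> {sqrt (\<Sum>i<k. (norm (\<Sum>j<k. \<Psi> (M i j) (x j)))\<^sup>2) |x. (\<Sum>j<k. (norm (x j))\<^sup>2) \<le> 1}"
  then obtain x where x: "(\<Sum>j<k. (norm (x j))\<^sup>2) \<le> 1"
    and s: "s = sqrt (\<Sum>i<k. (norm (\<Sum>j<k. \<Psi> (M i j) (x j)))\<^sup>2)" by blast
  have adj_le: "norm (adj K F) \<le> norm F" for F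
    using norm_cblinfun[of "adj K" F] mult_right_mono[OF norm_adj_K norm_ge_zero, of F] by simp
  have "(\<Sum>i<k. (norm (\<Sum>j<k. \<Psi> (M i j) (x j)))\<^sup>2) \<le> (\<Sum>i<k. (norm (\<Sum>j<k. ampliation (M i j) (K (x j))))\<^sup>2)"
    unfolding \<Psi>_apply capply.sum_right[symmetric]
    by (intro sum_mono power_mono adj_le) auto
  also have "\<dots> \<le> (op_matrix_norm k M)\<^sup>2 * (\<Sum>j<k. (norm (K (x j)))\<^sup>2)"
    by (rule ampliation_matrix_bound)
  also have "\<dots> \<le> (op_matrix_norm k M)\<^sup>2 * 1"
    using x by (intro mult_left_mono) (simp_all add: norm_K_apply)
  finally show "s \<le> op_matrix_norm k M"
    unfolding s by (intro real_le_lsqrt) (auto simp: op_matrix_norm_nonneg sum_nonneg)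
qed

text \<open>Choosing the \<open>R\<^sub>m\<close> to be the slices along an orthonormal basis of a separable subspace that contains
  all components of the \<open>K y\<^sub>k\<close> gives \<open>\<Sum>k. \<langle>\<Psi>(A) x\<^sub>k, y\<^sub>k\<rangle> = \<Sum>k m. \<langle>A R\<^sub>m K x\<^sub>k, R\<^sub>m K y\<^sub>k\<rangle>\<close>.\<close>

lemma predual_\<Psi>:
  assumes "\<omega> \<in> predual"
  shows "(\<lambda>A. \<omega> (\<Psi> A)) \<in> predual"
proof -
  obtain x y where x: "summable (\<lambda>k. (norm (x k))\<^sup>2)" and y: "summable (\<lambda>k. (norm (y k))\<^sup>2)"
    and \<omega>: "\<omega> = (\<lambda>A. \<Sum>k. cinner (cblinfun_apply A (x k)) (y k))"
    using assms by (auto simp: predual_def)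
  \<comment> \<open>Words over a finite alphabet are countable, so all components of all
    \<open>K (y k)\<close> fit into one sequence, which Gram--Schmidt can process.\<close>
  define f where "f n = l2_nth (K (y (fst (prod_decode n)))) (from_nat (snd (prod_decode n)))" for n
  have hit: "\<exists>n. l2_nth (K (y k)) \<alpha> = f n" for k \<alpha>
    by (rule exI[of _ "prod_encode (k, to_nat \<alpha>)"]) (simp add: f_def)
  have "\<forall>m. \<exists>R :: ('n list, 'h) l2 \<Rightarrow>\<^sub>B 'n fock. \<forall>F i. l2_nth (cblinfun_apply R F) i = cinner (l2_nth F i) (gram_schmidt f m)"
    using ex_slice by blast
  then obtain R :: "nat \<Rightarrow> ('n list, 'h) l2 \<Rightarrow>\<^sub>B 'n fock"
    where R: "\<And>m F i. l2_nth (cblinfun_apply (R m) F) i = cinner (l2_nth F i) (gram_schmidt f m)"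
    by metis
  define w where "w z p = R (snd p) (K (z (fst p)))" for z and p :: "nat \<times> nat"
  have sq: "(\<lambda>p. (norm (w z p))\<^sup>2) summable_on UNIV" if z: "summable (\<lambda>k. (norm (z k))\<^sup>2)" for z
  proof (rule nonneg_bdd_above_summable_on)
    show "bdd_above (sum (\<lambda>p. (norm (w z p))\<^sup>2) ` {F. F \<subseteq> UNIV \<and> finite F})"
    proof (rule bdd_aboveI2)
      fix F :: "(nat \<times> nat) set" assume "F \<in> {F. F \<subseteq> UNIV \<and> finite F}"
      hence F: "finite F" by simp
      \<comment> \<open>A finite set of pairs is enlarged to a rectangle; Bessel handles the sum
        over \<open>m\<close>, and the isometry \<open>K\<close> leaves the norms of the
        \<open>z k\<close>.\<close>
      have "(\<Sum>p\<in>F. (norm (w z p))\<^sup>2) \<le> (\<Sum>p\<in>fst ` F \<times> snd ` F. (norm (w z p))\<^sup>2)"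
        using F by (intro sum_mono2) (auto simp: image_iff Bex_def intro: prod.collapse)
      also have "\<dots> = (\<Sum>k\<in>fst ` F. \<Sum>m\<in>snd ` F. (norm (R m (K (z k))))\<^sup>2)"
        by (simp add: sum.cartesian_product w_def case_prod_beta)
      also have "\<dots> \<le> (\<Sum>k\<in>fst ` F. (norm (z k))\<^sup>2)"
        using slice_Bessel[OF R finite_imageI[OF F, of snd], of "K (z k)" for k]
        by (intro sum_mono) (simp add: norm_K_apply)
      also have "\<dots> \<le> (\<Sum>k. (norm (z k))\<^sup>2)"
        using F by (intro sum_le_suminf z) auto
      finally show "(\<Sum>p\<in>F. (norm (w z p))\<^sup>2) \<le> (\<Sum>k. (norm (z k))\<^sup>2)" .
    qed
  qed simp
  have main: "(\<Sum>k. cinner (\<Psi> A (x k)) (y k)) = (\<Sum>n. cinner (A (w x (prod_decode n))) (w y (prod_decode n)))" for A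
  proof -
    define g where "g p = cinner (A (w x p)) (w y p)" for p
    have "g summable_on UNIV"
    proof (rule abs_summable_summable, rule summable_on_comparison_test)
      show "(\<lambda>p. norm A * ((norm (w x p))\<^sup>2 + (norm (w y p))\<^sup>2)) summable_on UNIV"
        by (intro summable_on_cmult_right summable_on_add sq x y)
      fix p
      have "norm (g p) \<le> norm (A (w x p)) * norm (w y p)"
        unfolding g_def by (rule cinner_cauchy_schwarz)
      also have "\<dots> \<le> (norm A * norm (w x p)) * norm (w y p)"
        by (intro mult_right_mono norm_cblinfun) auto
      also have "norm (w x p) * norm (w y p) \<le> (norm (w x p))\<^sup>2 + (norm (w y p))\<^sup>2"
        using sum_squares_bound[of "norm (w x p)" "norm (w y p)"]
          mult_nonneg_nonneg[OF norm_ge_zero norm_ge_zero, of "w x p" "w y p"] by linarith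
      hence "(norm A * norm (w x p)) * norm (w y p) \<le> norm A * ((norm (w x p))\<^sup>2 + (norm (w y p))\<^sup>2)"
        unfolding mult.assoc by (intro mult_left_mono) auto
      finally show "norm (g p) \<le> norm A * ((norm (w x p))\<^sup>2 + (norm (w y p))\<^sup>2)" .
    qed simp
    \<comment> \<open>One absolutely convergent double sum is evaluated twice: along
      \<open>prod_decode\<close>, and as an iterated sum over \<open>k\<close> and
      \<open>m\<close>.\<close>
    then obtain S where S: "(g has_sum S) UNIV"
      unfolding summable_on_def by blast
    have "((\<lambda>n. g (prod_decode n)) has_sum S) UNIV"
      using has_sum_reindex_bij_betw[OF bij_prod_decode, where f = g and S = S] S by simp
    hence "(\<lambda>n. g (prod_decode n)) sums S"
      by (rule has_sum_imp_sums)
    moreover have "((\<lambda>k. cinner (\<Psi> A (x k)) (y k)) has_sum S) UNIV"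
    proof (rule has_sum_SigmaD[where f = g and S = S and A = UNIV and B = "\<lambda>_. UNIV"])
      show "(g has_sum S) (UNIV \<times> UNIV)" using S by simp
      fix k
      have "(\<lambda>(k, m). g (k, m)) summable_on (UNIV \<times> UNIV)"
        using S by (auto simp: summable_on_def)
      hence "(\<lambda>m. g (k, m)) summable_on UNIV"
        by (rule summable_on_SigmaD1) simp
      then obtain s where s: "((\<lambda>m. g (k, m)) has_sum s) UNIV"
        unfolding summable_on_def by blast
      have "(\<lambda>m. g (k, m)) sums cinner (\<Psi> A (x k)) (y k)"
        using slice_Parseval[OF R hit, of "ampliation A (K (x k))" k]
        by (simp add: g_def w_def cinner_\<Psi> slice_ampliation[OF R])
      with s show "((\<lambda>m. g (k, m)) has_sum cinner (\<Psi> A (x k)) (y k)) UNIV"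
        using has_sum_imp_sums[OF s] sums_unique2 by blast
    qed
    hence "(\<lambda>k. cinner (\<Psi> A (x k)) (y k)) sums S"
      by (rule has_sum_imp_sums)
    ultimately show ?thesis
      unfolding g_def by (simp add: sums_iff)
  qed
  have "summable (\<lambda>n. (norm ((w z \<circ> prod_decode) n))\<^sup>2)" if "summable (\<lambda>k. (norm (z k))\<^sup>2)" for z
    using summable_on_reindex_bij_betw[OF bij_prod_decode, of "\<lambda>p. (norm (w z p))\<^sup>2"] sq[OF that]
    by (intro summable_on_imp_summable) simp
  from this[OF x] this[OF y] show ?thesis
    unfolding predual_def mem_Collect_eq
    by (intro exI[of _ "w x \<circ> prod_decode"] exI[of _ "w y \<circ> prod_decode"] conjI) (simp_all add: \<omega> main)
qed

text \<open>By \<open>predual_\<Psi>\<close> the preimage of a subbasic set is again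
  subbasic.\<close>

lemma \<Psi>_weak_star_continuous:
  "continuous_map (subtopology weak_star_topology S) weak_star_topology \<Psi>"
  unfolding weak_star_topology_def[where 'a = 'h]
proof (rule continuous_on_generated_topo)
  fix U :: "('h \<Rightarrow>\<^sub>B 'h) set" assume "U \<in> {\<omega> -` V |\<omega> V. \<omega> \<in> predual \<and> open V}"
  then obtain \<omega> V where U: "U = \<omega> -` V" and \<omega>: "\<omega> \<in> predual" "open V" by blast
  have "openin weak_star_topology ((\<lambda>A. \<omega> (\<Psi> A)) -` V)"
    unfolding weak_star_topology_def
    using predual_\<Psi>[OF \<omega>(1)] \<omega>(2) by (intro topology_generated_by_Basis) blast
  moreover have "\<Psi> -` U \<inter> topspace (subtopology weak_star_topology S) =
      ((\<lambda>A. \<omega> (\<Psi> A)) -` V \<inter> topspace weak_star_topology) \<inter> S"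
    by (auto simp: U)
  ultimately show "openin (subtopology weak_star_topology S) (\<Psi> -` U \<inter> topspace (subtopology weak_star_topology S))"
    by (auto simp: openin_subtopology)
next
  \<comment> \<open>The zero functional shows that the generating sets cover all operators, so the
    image of \<open>\<Psi>\<close> lies in the topological space.\<close>
  have "(\<lambda>_. 0) \<in> (predual :: (('h \<Rightarrow>\<^sub>B 'h) \<Rightarrow> complex) set)"
    unfolding predual_def by (auto intro!: exI[of _ "\<lambda>_. 0"])
  hence "(\<lambda>_ :: 'h \<Rightarrow>\<^sub>B 'h. 0 :: complex) -` UNIV \<in> {\<omega> -` V |\<omega> V. \<omega> \<in> predual \<and> open V}"
    by blast
  thus "\<Psi> ` topspace (subtopology weak_star_topology S) \<subseteq> \<Union>{\<omega> -` V |\<omega> V. \<omega> \<in> predual \<and> open V}"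
    by auto
qed

end

theorem theorem2p7:
  fixes b :: "'n::finite list \<Rightarrow> real"
    and T :: "'n \<Rightarrow> ('h::chilbert_space \<Rightarrow>\<^sub>B 'h)"
  assumes "admissible b"
    and "\<And>i. bdd_above (range (\<lambda>\<alpha>. b \<alpha> / b (\<alpha> @ [i])))"
    and "pure_tuple b T"
  shows
    "seq_wot_continuous_on (hardy_algebra b) (hardy_calculus b T) \<and>
     seq_sot_continuous_on (hardy_algebra b) (hardy_calculus b T) \<and>

     unital_hom_on (hardy_algebra b) (hardy_calculus b T) \<and>
     completely_contractive_on (hardy_algebra b) (hardy_calculus b T) \<and>

     continuous_map (subtopology weak_star_topology (hardy_algebra b)) weak_star_topology
       (hardy_calculus b T) \<and>
     clinear_on (hardy_algebra b) (hardy_calculus b T) \<and>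
     (\<forall>m d. hardy_calculus b T (\<Sum>\<alpha> | length \<alpha> \<le> m. d \<alpha> *\<^sub>C word_op (weighted_shift b) \<alpha>) =
       (\<Sum>\<alpha> | length \<alpha> \<le> m. d \<alpha> *\<^sub>C word_op T \<alpha>)) \<and>

     (radially_pure b (weighted_shift b) \<longrightarrow>
       (\<forall>A c. A \<in> hardy_algebra b \<and> fourier_rep b c A \<longrightarrow>
         (\<forall>r\<in>{0..<1}. summable (radial_term c T r)) \<and>
         sot_tendsto (\<lambda>r. \<Sum>k. radial_term c T r k) (hardy_calculus b T A) (at_left 1)))"
proof -
  interpret pure_model b T
    by unfold_locales (use assms in \<open>auto simp: admissible_def\<close>)
  have lin: "clinear_on (hardy_algebra b) \<Psi>"
    by (simp add: clinear_on_def \<Psi>_add \<Psi>_scaleC)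
  \<comment> \<open>\<open>A\<close> is a bounded strong limit of its Abel means, hence coinvariant,
    which settles products with \<open>A\<close> on the left.\<close>
  have mult: "\<Psi> (A o\<^sub>C B) = \<Psi> A o\<^sub>C \<Psi> B" if "A \<in> hardy_algebra b" for A B
    using that coinvariant_hardy by (auto simp: hardy_algebra_def intro: coinvariant_compose)
  show ?thesis
  proof (intro conjI allI impI)
    show "seq_wot_continuous_on (hardy_algebra b) \<Psi>"
      by (simp add: seq_wot_continuous_on_def \<Psi>_wot_continuous)
    show "seq_sot_continuous_on (hardy_algebra b) \<Psi>"
      by (simp add: seq_sot_continuous_on_def \<Psi>_sot_continuous)
    show "unital_hom_on (hardy_algebra b) \<Psi>"
      by (simp add: unital_hom_on_def lin \<Psi>_id mult)
    show "completely_contractive_on (hardy_algebra b) \<Psi>"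
      by (simp add: completely_contractive_on_def \<Psi>_completely_contractive)
    show "\<Psi> (\<Sum>\<alpha> | length \<alpha> \<le> m. d \<alpha> *\<^sub>C W \<alpha>) = (\<Sum>\<alpha> | length \<alpha> \<le> m. d \<alpha> *\<^sub>C word_op T \<alpha>)" for m d
      by (simp add: \<Psi>_sum \<Psi>_scaleC \<Psi>_W)
    fix A c assume "A \<in> hardy_algebra b \<and> fourier_rep b c A"
    hence "fourier_rep b c A" ..
    thus "\<forall>r\<in>{0..<1}. summable (radial_term c T r)"
      "sot_tendsto (\<lambda>r. \<Sum>k. radial_term c T r k) (\<Psi> A) (at_left 1)"
      using \<Psi>_abel_mean(1) \<Psi>_radial_limit by auto
  qed (simp_all add: lin \<Psi>_weak_star_continuous)
qed

end
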